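(* Let $X$ be a compact complex manifold with $\dim_{\mathbb C}X=n$. The sG cone $\mathcal{SG}_X\subset E_{2,A}^{n-1,n-1}(X,\mathbb R)$, the H-S cone $\mathcal{HS}_X\subset E_{3,A}^{1,1}(X,\mathbb R)$ and the SKT cone $\mathcal{SKT}_X\subset E_{1,A}^{1,1}(X,\mathbb R)$ of $X$ are open convex cones in their respective cohomology vector spaces.
   Context: Hermitian metrics are identified with smooth positive definite $(1,1)$-forms $\omega$. $\omega$ is strongly Gauduchon (sG) if $\partial\omega^{n-1}$ is $\bar\partial$-exact; SKT if $\partial\bar\partial\omega=0$; Hermitian-symplectic (H-S) if there is a smooth $(0,2)$-form $\rho^{0,2}$ with $d(\overline{\rho^{0,2}}+\omega+\rho^{0,2})=0$. A smooth $(p,q)$-form $\alpha$ is $E_1\overline{E}_1$-closed if $\partial\bar\partial\alpha=0$. For $r\ge2$ it is $E_r\overline{E}_r$-closed if there are smooth forms $\eta_1,\dots,\eta_{r-1}$ and $\rho_1,\dots,\rho_{r-1}$ with $\partial\alpha=\bar\partial\eta_1$, $\partial\eta_1=\bar\partial\eta_2,\dots,\partial\eta_{r-2}=\bar\partial\eta_{r-1}$ and $\bar\partial\alpha=\partial\rho_1$, $\bar\partial\rho_1=\partial\rho_2,\dots,\bar\partial\rho_{r-2}=\partial\rho_{r-1}$. The $E_r$-Aeppli cohomology $E_{r,A}^{p,q}(X)$ is the (finite-dimensional) quotient of the $E_r\overline{E}_r$-closed smooth $(p,q)$-forms by those lying in $\mathrm{Im}\,\partial+\mathrm{Im}\,\bar\partial$;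 $\{\alpha\}_{E_{r,A}}$ is the class of $\alpha$. For $p=q$, conjugation of forms induces a real structure on $E_{r,A}^{p,p}(X)$ and $E_{r,A}^{p,p}(X,\mathbb R)$ is the real subspace of classes representable by real forms. If $\omega$ is sG then $\omega^{n-1}$ is $E_2\overline{E}_2$-closed; if $\omega$ is H-S then $\omega$ is $E_3\overline{E}_3$-closed. The cones are $\mathcal{SG}_X=\{\{\omega^{n-1}\}_{E_{2,A}}\mid\omega\text{ an sG metric on }X\}$, $\mathcal{HS}_X=\{\{\omega\}_{E_{3,A}}\mid\omega\text{ an H-S metric on }X\}$, $\mathcal{SKT}_X=\{\{\omega\}_{E_{1,A}}\mid\omega\text{ an SKT metric on }X\}$ (each possibly empty).
   Formalization: The claim about the sG cone is stated for n ≥ 2 only: for n = 1 one has ω^{n-1} = 1, so the sG cone is the single class {1}, which is neither a cone nor open; the H-S and SKT claims are stated for every n ≥ 1. *)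

theory Defs
  imports "HOL-Analysis.Analysis" "HOL-Library.Function_Algebras"
begin

section \<open>Complex manifolds\<close>

text \<open>Charts take values in \<open>complex^'n\<close>, so the complex dimension is \<open>CARD('n)\<close>.\<close>

type_synonym ('a, 'n) chart = "'a set \<times> ('a \<Rightarrow> complex ^ 'n)"

abbreviation chart_image :: "('a, 'n::finite) chart \<Rightarrow> (complex ^ 'n) set"
  where "chart_image c \<equiv> snd c ` fst c"

definition transition ::
    "('a, 'n::finite) chart \<Rightarrow> ('a, 'n) chart \<Rightarrow> complex ^ 'n \<Rightarrow> complex ^ 'n"
  where "transition c c' = snd c' \<circ> inv_into (fst c) (snd c)"

definition overlap :: "('a, 'n::finite) chart \<Rightarrow> ('a, 'n) chart \<Rightarrow> (complex ^ 'n) set"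
  where "overlap c c' = snd c ` (fst c \<inter> fst c')"

definition holomorphic_map_on ::
    "(complex ^ 'n::finite \<Rightarrow> complex ^ 'm::finite) \<Rightarrow> (complex ^ 'n) set \<Rightarrow> bool"
  where "holomorphic_map_on f S \<longleftrightarrow>
    (\<forall>z\<in>S. \<exists>D. (f has_derivative D) (at z) \<and> (\<forall>a v. D (a *s v) = a *s D v))"

definition complex_manifold :: "'a topology \<Rightarrow> ('a, 'n::finite) chart set \<Rightarrow> bool"
  where "complex_manifold X A \<longleftrightarrow>
    Hausdorff_space X \<and> second_countable X \<and> (\<Union>c\<in>A. fst c) = topspace X \<and>
    (\<forall>c\<in>A. openin X (fst c) \<and> open (chart_image c) \<and>
      homeomorphic_map (subtopology X (fst c)) (top_of_set (chart_image c)) (snd c)) \<and>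
    (\<forall>c\<in>A. \<forall>c'\<in>A. holomorphic_map_on (transition c c') (overlap c c'))"

definition compact_complex_manifold :: "'a topology \<Rightarrow> ('a, 'n::finite) chart set \<Rightarrow> bool"
  where "compact_complex_manifold X A \<longleftrightarrow> complex_manifold X A \<and> compact_space X"


section \<open>Smooth complex-valued differential forms\<close>

primrec Ck_on ::
    "nat \<Rightarrow> 'v::real_normed_vector set \<Rightarrow> ('v \<Rightarrow> 'w::real_normed_vector) \<Rightarrow> bool"
  where
    "Ck_on 0 S f \<longleftrightarrow> continuous_on S f"
  | "Ck_on (Suc k) S f \<longleftrightarrow>
      f differentiable_on S \<and> (\<forall>v. Ck_on k S (\<lambda>x. frechet_derivative f (at x) v))"

definition smooth_on :: "'v::real_normed_vector set \<Rightarrow> ('v \<Rightarrow> 'w::real_normed_vector) \<Rightarrow> bool"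
  where "smooth_on S f \<longleftrightarrow> (\<forall>k. Ck_on k S f)"

text \<open>A covector of mixed degree on a real vector space is encoded by its values on finite lists
  of vectors: its component of degree \<open>k\<close> is its restriction to the lists of length \<open>k\<close>.\<close>

definition alternating :: "('v::real_vector list \<Rightarrow> complex) \<Rightarrow> bool"
  where "alternating f \<longleftrightarrow>
    (\<forall>us ws. linear (\<lambda>v. f (us @ v # ws))) \<and> (\<forall>vs. \<not> distinct vs \<longrightarrow> f vs = 0)"

text \<open>A differential form is given by its expression \<open>\<alpha> c\<close> in every chart \<open>c\<close>: a function on the image
  of \<open>c\<close> with values in the covectors. Forms are set to zero where they have no meaning
  (outside the atlas, or outside the image of the chart), so that two forms are equal iff they are
  equal as functions.\<close>

type_synonym ('a, 'n) form =
  "('a, 'n) chart \<Rightarrow> complex ^ 'n \<Rightarrow> (complex ^ 'n) list \<Rightarrow> complex"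

text \<open>The smooth complex-valued forms, possibly of mixed degree; the last condition says that the
  local expressions are related by pull-back along the transition maps.\<close>

definition smooth_form :: "('a, 'n::finite) chart set \<Rightarrow> ('a, 'n) form \<Rightarrow> bool"
  where "smooth_form A \<alpha> \<longleftrightarrow>
    (\<forall>c z vs. \<not> (c \<in> A \<and> z \<in> chart_image c) \<longrightarrow> \<alpha> c z vs = 0) \<and>
    (\<forall>c\<in>A. \<forall>z\<in>chart_image c. alternating (\<alpha> c z)) \<and>
    (\<forall>c\<in>A. \<forall>vs. smooth_on (chart_image c) (\<lambda>z. \<alpha> c z vs)) \<and>
    (\<forall>c\<in>A. \<forall>c'\<in>A. \<forall>z\<in>overlap c c'. \<forall>vs.
       \<alpha> c z vs = \<alpha> c' (transition c c' z)
                    (map (frechet_derivative (transition c c') (at z)) vs))"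

text \<open>Forms of bidegree \<open>(p,q)\<close>: those of degree \<open>p + q\<close> on which multiplication of all tangent vectors
  by a complex number \<open>a\<close> acts by \<open>a\<^sup>p \<cdot> (cnj a)\<^sup>q\<close>. The covectors with this property are exactly the
  combinations of the products of \<open>p\<close> of the \<open>dz\<^sub>i\<close> and \<open>q\<close> of the \<open>d(cnj z\<^sub>j)\<close>.\<close>

definition pq_form :: "('a, 'n::finite) chart set \<Rightarrow> nat \<Rightarrow> nat \<Rightarrow> ('a, 'n) form \<Rightarrow> bool"
  where "pq_form A p q \<alpha> \<longleftrightarrow> smooth_form A \<alpha> \<and>
    (\<forall>c z vs. length vs \<noteq> p + q \<longrightarrow> \<alpha> c z vs = 0) \<and>
    (\<forall>c z vs a. length vs = p + q \<longrightarrow>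
       \<alpha> c z (map (\<lambda>v. a *s v) vs) = a ^ p * cnj a ^ q * \<alpha> c z vs)"

definition conj_form :: "('a, 'n) form \<Rightarrow> ('a, 'n) form"
  where "conj_form \<alpha> = (\<lambda>c z vs. cnj (\<alpha> c z vs))"

definition real_form :: "('a, 'n) form \<Rightarrow> bool"
  where "real_form \<alpha> \<longleftrightarrow> conj_form \<alpha> = \<alpha>"

definition scale_form :: "real \<Rightarrow> ('a, 'n) form \<Rightarrow> ('a, 'n) form"
  where "scale_form t \<alpha> = (\<lambda>c z vs. of_real t * \<alpha> c z vs)"

text \<open>The exterior product, as the signed sum over all shuffles: \<open>I\<close> is the set of positions of the
  arguments handed to \<open>f\<close>, and the exponent counts the inversions of the corresponding permutation.\<close>

definition wedge :: "('v list \<Rightarrow> complex) \<Rightarrow> ('v list \<Rightarrow> complex) \<Rightarrow> 'v list \<Rightarrow> complex"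
  where "wedge f g vs =
    (\<Sum>I\<in>Pow {..<length vs}.
       (-1) ^ card {(i, j). i \<in> I \<and> j \<in> {..<length vs} - I \<and> j < i} *
       f (nths vs I) * g (nths vs ({..<length vs} - I)))"

primrec form_power :: "('a, 'n::finite) chart set \<Rightarrow> ('a, 'n) form \<Rightarrow> nat \<Rightarrow> ('a, 'n) form"
  where
    "form_power A \<alpha> 0 =
      (\<lambda>c z vs. if c \<in> A \<and> z \<in> chart_image c \<and> vs = [] then 1 else 0)"
  | "form_power A \<alpha> (Suc m) = (\<lambda>c z. wedge (\<alpha> c z) (form_power A \<alpha> m c z))"


section \<open>The operators d, del and delbar\<close>

text \<open>For \<open>L f z v\<close> equal to the derivative of \<open>f\<close> at \<open>z\<close> in direction \<open>v\<close> this is the exterior derivative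
  \<open>d\<alpha>(v\<^sub>0,\<dots>,v\<^sub>k) = \<Sum>\<^sub>i (-1)\<^sup>i (D\<^bsub>v\<^sub>i\<^esub> \<alpha>)(v\<^sub>0,\<dots>,v\<^sub>i omitted,\<dots>,v\<^sub>k)\<close> in each chart. Keeping only the
  complex linear part (\<open>\<Sum>\<^sub>j \<partial>f/\<partial>z\<^sub>j dz\<^sub>j\<close>) or the antilinear part (\<open>\<Sum>\<^sub>j \<partial>f/\<partial>(cnj z\<^sub>j) d(cnj z\<^sub>j)\<close>) of the
  differential of the coefficients yields del and delbar.\<close>

definition exterior_by ::
    "(((complex ^ 'n \<Rightarrow> complex) \<Rightarrow> complex ^ 'n \<Rightarrow> complex ^ 'n \<Rightarrow> complex)) \<Rightarrow>
      ('a, 'n::finite) chart set \<Rightarrow> ('a, 'n) form \<Rightarrow> ('a, 'n) form"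
  where "exterior_by L A \<alpha> = (\<lambda>c z vs.
    if c \<in> A \<and> z \<in> chart_image c
    then \<Sum>i<length vs. (-1) ^ i * L (\<lambda>w. \<alpha> c w (take i vs @ drop (Suc i) vs)) z (vs ! i)
    else 0)"

definition lin_part :: "(complex ^ 'n::finite \<Rightarrow> complex) \<Rightarrow> complex ^ 'n \<Rightarrow> complex ^ 'n \<Rightarrow> complex"
  where "lin_part f z v =
    (frechet_derivative f (at z) v - \<i> * frechet_derivative f (at z) (\<i> *s v)) / 2"

definition antilin_part :: "(complex ^ 'n::finite \<Rightarrow> complex) \<Rightarrow> complex ^ 'n \<Rightarrow> complex ^ 'n \<Rightarrow> complex"
  where "antilin_part f z v =
    (frechet_derivative f (at z) v + \<i> * frechet_derivative f (at z) (\<i> *s v)) / 2"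

definition ext_d :: "('a, 'n::finite) chart set \<Rightarrow> ('a, 'n) form \<Rightarrow> ('a, 'n) form"
  where "ext_d = exterior_by (\<lambda>f z. frechet_derivative f (at z))"

definition del :: "('a, 'n::finite) chart set \<Rightarrow> ('a, 'n) form \<Rightarrow> ('a, 'n) form"
  where "del = exterior_by lin_part"

definition delbar :: "('a, 'n::finite) chart set \<Rightarrow> ('a, 'n) form \<Rightarrow> ('a, 'n) form"
  where "delbar = exterior_by antilin_part"


section \<open>Special Hermitian metrics\<close>

text \<open>With \<open>\<omega> = i \<Sum> h\<^sub>j\<^sub>k dz\<^sub>j \<and> d(cnj z\<^sub>k)\<close> one has \<open>\<omega>(v, i v) = 2 \<Sum> h\<^sub>j\<^sub>k v\<^sub>j cnj v\<^sub>k\<close>.\<close>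

definition hermitian_metric :: "('a, 'n::finite) chart set \<Rightarrow> ('a, 'n) form \<Rightarrow> bool"
  where "hermitian_metric A \<omega> \<longleftrightarrow> pq_form A 1 1 \<omega> \<and> real_form \<omega> \<and>
    (\<forall>c\<in>A. \<forall>z\<in>chart_image c. \<forall>v. v \<noteq> 0 \<longrightarrow> Re (\<omega> c z [v, \<i> *s v]) > 0)"

definition sG_metric :: "('a, 'n::finite) chart set \<Rightarrow> ('a, 'n) form \<Rightarrow> bool"
  where "sG_metric A \<omega> \<longleftrightarrow> hermitian_metric A \<omega> \<and>
    (\<exists>\<eta>. smooth_form A \<eta> \<and> del A (form_power A \<omega> (CARD('n) - 1)) = delbar A \<eta>)"

definition HS_metric :: "('a, 'n::finite) chart set \<Rightarrow> ('a, 'n) form \<Rightarrow> bool"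
  where "HS_metric A \<omega> \<longleftrightarrow> hermitian_metric A \<omega> \<and>
    (\<exists>\<rho>. pq_form A 0 2 \<rho> \<and> ext_d A (conj_form \<rho> + \<omega> + \<rho>) = 0)"

definition SKT_metric :: "('a, 'n::finite) chart set \<Rightarrow> ('a, 'n) form \<Rightarrow> bool"
  where "SKT_metric A \<omega> \<longleftrightarrow> hermitian_metric A \<omega> \<and> del A (delbar A \<omega>) = 0"


section \<open>Higher-page Aeppli cohomology\<close>

text \<open>The notion is used for \<open>r \<ge> 1\<close> only.\<close>

definition ErEr_closed :: "('a, 'n::finite) chart set \<Rightarrow> nat \<Rightarrow> ('a, 'n) form \<Rightarrow> bool"
  where "ErEr_closed A r \<alpha> \<longleftrightarrow>
    (if r = 1 then del A (delbar A \<alpha>) = 0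
     else \<exists>\<eta> \<rho>. (\<forall>i\<in>{1..r-1}. smooth_form A (\<eta> i) \<and> smooth_form A (\<rho> i)) \<and>
       del A \<alpha> = delbar A (\<eta> 1) \<and>
       (\<forall>i\<in>{1..<r-1}. del A (\<eta> i) = delbar A (\<eta> (Suc i))) \<and>
       delbar A \<alpha> = del A (\<rho> 1) \<and>
       (\<forall>i\<in>{1..<r-1}. delbar A (\<rho> i) = del A (\<rho> (Suc i))))"

definition Er_cycles ::
    "('a, 'n::finite) chart set \<Rightarrow> nat \<Rightarrow> nat \<Rightarrow> nat \<Rightarrow> ('a, 'n) form set"
  where "Er_cycles A r p q = {\<alpha>. pq_form A p q \<alpha> \<and> ErEr_closed A r \<alpha>}"

definition im_del_delbar :: "('a, 'n::finite) chart set \<Rightarrow> ('a, 'n) form set"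
  where "im_del_delbar A =
    {del A \<beta> + delbar A \<gamma> | \<beta> \<gamma>. smooth_form A \<beta> \<and> smooth_form A \<gamma>}"

definition aeppli_rel ::
    "('a, 'n::finite) chart set \<Rightarrow> nat \<Rightarrow> nat \<Rightarrow> nat \<Rightarrow> (('a, 'n) form \<times> ('a, 'n) form) set"
  where "aeppli_rel A r p q =
    {(\<alpha>, \<beta>). \<alpha> \<in> Er_cycles A r p q \<and> \<beta> \<in> Er_cycles A r p q \<and> \<beta> - \<alpha> \<in> im_del_delbar A}"

definition aeppli_class ::
    "('a, 'n::finite) chart set \<Rightarrow> nat \<Rightarrow> nat \<Rightarrow> nat \<Rightarrow> ('a, 'n) form \<Rightarrow> ('a, 'n) form set"
  where "aeppli_class A r p q \<alpha> = aeppli_rel A r p q `` {\<alpha>}"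

definition aeppli_cohomology ::
    "('a, 'n::finite) chart set \<Rightarrow> nat \<Rightarrow> nat \<Rightarrow> nat \<Rightarrow> ('a, 'n) form set set"
  where "aeppli_cohomology A r p q = Er_cycles A r p q // aeppli_rel A r p q"

record 'v real_space =
  carr :: "'v set"
  vzero :: 'v
  vadd :: "'v \<Rightarrow> 'v \<Rightarrow> 'v"
  vscale :: "real \<Rightarrow> 'v \<Rightarrow> 'v"

text \<open>The real vector space of real classes of bidegree \<open>(p,p)\<close>, with the operations induced by
  those on forms.\<close>

definition real_aeppli ::
    "('a, 'n::finite) chart set \<Rightarrow> nat \<Rightarrow> nat \<Rightarrow> ('a, 'n) form set real_space"
  where "real_aeppli A r p =
    \<lparr> carr = {P \<in> aeppli_cohomology A r p p. \<exists>\<alpha>\<in>P. real_form \<alpha>},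
      vzero = aeppli_class A r p p 0,
      vadd = (\<lambda>P Q. \<Union>\<alpha>\<in>P. \<Union>\<beta>\<in>Q. aeppli_class A r p p (\<alpha> + \<beta>)),
      vscale = (\<lambda>t P. \<Union>\<alpha>\<in>P. aeppli_class A r p p (scale_form t \<alpha>)) \<rparr>"


section \<open>Open convex cones in a finite-dimensional real vector space\<close>

primrec lin_comb :: "'v real_space \<Rightarrow> (nat \<Rightarrow> real) \<Rightarrow> (nat \<Rightarrow> 'v) \<Rightarrow> nat \<Rightarrow> 'v"
  where
    "lin_comb V x b 0 = vzero V"
  | "lin_comb V x b (Suc m) = vadd V (lin_comb V x b m) (vscale V (x m) (b m))"

text \<open>A set is open iff its preimage under every linear map from some \<open>\<real>\<^sup>m\<close> is open. If the space is
  finite-dimensional, this is its usual topology: a linear bijection from \<open>\<real>\<^sup>m\<close>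
  is then a homeomorphism.\<close>

definition vs_topology :: "'v real_space \<Rightarrow> 'v topology"
  where "vs_topology V = topology (\<lambda>U. U \<subseteq> carr V \<and>
    (\<forall>m b. b ` {..<m} \<subseteq> carr V \<longrightarrow>
       openin (powertop_real {..<m})
         {x \<in> topspace (powertop_real {..<m}). lin_comb V x b m \<in> U}))"

lemma openin_vs_topology:
  "openin (vs_topology V) U \<longleftrightarrow> U \<subseteq> carr V \<and>
    (\<forall>m b. b ` {..<m} \<subseteq> carr V \<longrightarrow>
       openin (powertop_real {..<m})
         {x \<in> topspace (powertop_real {..<m}). lin_comb V x b m \<in> U})"
proof -
  let ?pre = "\<lambda>m b U. {x \<in> topspace (powertop_real {..<m}). lin_comb V x b m \<in> U}"
  have Int: "?pre m b (S \<inter> T) = ?pre m b S \<inter> ?pre m b T" for m b S T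
    by blast
  have Un: "?pre m b (\<Union>K) = \<Union>(?pre m b ` K)" for m b K
    by blast
  have "istopology (\<lambda>U. U \<subseteq> carr V \<and>
      (\<forall>m b. b ` {..<m} \<subseteq> carr V \<longrightarrow> openin (powertop_real {..<m}) (?pre m b U)))"
    unfolding istopology_def Int Un by (auto intro!: openin_Union)
  then show ?thesis
    unfolding vs_topology_def by (simp add: topology_inverse')
qed

definition convex_cone_in :: "'v real_space \<Rightarrow> 'v set \<Rightarrow> bool"
  where "convex_cone_in V C \<longleftrightarrow> C \<subseteq> carr V \<and>
    (\<forall>x\<in>C. \<forall>t>0. vscale V t x \<in> C) \<and>
    (\<forall>x\<in>C. \<forall>y\<in>C. \<forall>t\<in>{0..1}. vadd V (vscale V (1 - t) x) (vscale V t y) \<in> C)"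

definition open_convex_cone_in :: "'v real_space \<Rightarrow> 'v set \<Rightarrow> bool"
  where "open_convex_cone_in V C \<longleftrightarrow> convex_cone_in V C \<and> openin (vs_topology V) C"


section \<open>The three cones\<close>

definition SG_cone :: "('a, 'n::finite) chart set \<Rightarrow> ('a, 'n) form set set"
  where "SG_cone A =
    {aeppli_class A 2 (CARD('n) - 1) (CARD('n) - 1) (form_power A \<omega> (CARD('n) - 1)) | \<omega>.
      sG_metric A \<omega>}"

definition HS_cone :: "('a, 'n::finite) chart set \<Rightarrow> ('a, 'n) form set set"
  where "HS_cone A = {aeppli_class A 3 1 1 \<omega> | \<omega>. HS_metric A \<omega>}"

definition SKT_cone :: "('a, 'n::finite) chart set \<Rightarrow> ('a, 'n) form set set"
  where "SKT_cone A = {aeppli_class A 1 1 1 \<omega> | \<omega>. SKT_metric A \<omega>}"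

end

theory Submission
  imports Defs
begin

text \<open>
  Each of the three cones is the image in cohomology of a set \<open>G\<close> of forms: real closed forms, in the
  sense of the page of the spectral sequence concerned, that satisfy a pointwise condition of positivity.
  Closed forms make up a vector space and positivity is preserved by sums and by positive multiples, so
  the images are convex cones. For openness, a class near that of \<open>\<theta> \<in> G\<close> is represented by \<open>\<theta>\<close> plus a
  small combination of finitely many fixed real closed forms; on a compact manifold this stays positive.
  This argument, \<open>open_convex_cone_of_cycles\<close> together with \<open>positivity_stable\<close>, takes care of the
  analysis. It remains to describe the sets \<open>G\<close>.

  For the SKT cone, \<open>G\<close> consists of the metrics that are \<open>E\<^sub>1\<close>-closed, by definition. For the
  Hermitian-symplectic cone, it consists of the metrics that are \<open>E\<^sub>3\<close>-closed: the form \<open>\<rho>\<close> is,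
  up to sign and conjugation, the \<open>(2,0)\<close>-part of the first form of a solution of the \<open>E\<^sub>3\<close>-equations
  (\<open>HS_imp_E3_closed\<close>, \<open>E3_closed_imp_HS\<close>).

  For the strongly Gauduchon cone, \<open>G\<close> is the set of the powers \<open>\<omega>\<^bsup>n-1\<^esup>\<close>, which has to be described by a
  linear condition and positivity as well. By Michelsohn's observation, \<open>\<omega> \<mapsto> \<omega>\<^bsup>n-1\<^esup>\<close> is a bijection between
  positive forms of bidegree \<open>(1,1)\<close> and \<open>(n-1,n-1)\<close>. In terms of Hermitian matrices it is \<open>H \<mapsto> adj H\<close>,
  with inverse \<open>B \<mapsto> (det B)\<^bsup>1/(n-1)\<^esup> B\<^sup>-\<^sup>1\<close>. Matrices, inverses and determinants are avoided by a duality
  \<open>star\<close> between forms of degree \<open>2n - 2\<close> and of degree 2: the dual of \<open>\<sigma>\<^bsup>n-1\<^esup>\<close> is a multiple of the inverse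
  of \<open>\<sigma>\<close> (\<open>star_wedge_power_pair\<close>), hence repeating the construction gives back a multiple of \<open>\<sigma>\<close>
  (\<open>star_star_wedge_power\<close>). So the root of \<open>f\<close> is \<open>star ((star f)\<^bsup>n-1\<^esup>)\<close>, which is polynomial in \<open>f\<close>,
  times a power of a positive rational expression in \<open>f\<close>, and is therefore smooth; since roots are unique,
  the local roots are compatible with the changes of charts (\<open>positive_cycle_root\<close>).
\<close>

section \<open>Exterior products by recursion on the arguments\<close>

text \<open>The interior product. With \<open>grade\<close>, the sign by which an antiderivation passes a factor,
  it turns the shuffle formula for the exterior product into a recursion on the list of arguments,
  along which most of the identities below are proved by induction.\<close>

definition contract :: "'v \<Rightarrow> ('v list \<Rightarrow> complex) \<Rightarrow> 'v list \<Rightarrow> complex"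
  where "contract v f = (\<lambda>vs. f (v # vs))"

definition grade :: "('v list \<Rightarrow> complex) \<Rightarrow> 'v list \<Rightarrow> complex"
  where "grade f = (\<lambda>vs. (-1) ^ length vs * f vs)"

lemma wedge_Nil: "wedge f g [] = f [] * g []"
  by (simp add: wedge_def)

lemma Pow_lessThan_Suc:
  "Pow {..<Suc n} = (\<lambda>J. insert 0 (Suc ` J)) ` Pow {..<n} \<union> (`) Suc ` Pow {..<n}"
proof -
  have "Pow (Suc ` {..<n}) = (`) Suc ` Pow {..<n}"
    by (simp add: image_Pow_surj)
  then show ?thesis
    unfolding lessThan_Suc_eq_insert_0 Pow_insert by (simp add: image_image Un_commute)
qed

text \<open>Interior multiplication is an antiderivation. A set of positions of \<open>v # vs\<close> either contains
  position 0, which creates no inversion, or it does not, and then position 0 is preceded in the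
  shuffle by every chosen position: this is the sign of \<open>grade\<close>.\<close>

lemma wedge_Cons:
  "wedge f g (v # vs) = wedge (contract v f) g vs + wedge (grade f) (contract v g) vs"
proof -
  let ?n = "length vs"
  define s where "s n I = card {(i, j). i \<in> I \<and> j \<in> {..<n} - I \<and> j < i}" for n and I :: "nat set"
  define F where "F I = (-1) ^ s (Suc ?n) I * f (nths (v # vs) I)
    * g (nths (v # vs) ({..<Suc ?n} - I))" for I
  have inj1: "inj_on (\<lambda>J. insert 0 (Suc ` J)) (Pow {..<?n})"
  proof (rule inj_onI)
    fix J K assume *: "insert 0 (Suc ` J) = insert 0 (Suc ` K)"
    have "Suc ` J = insert 0 (Suc ` J) - {0}" by auto
    also have "\<dots> = Suc ` K" unfolding * by auto
    finally show "J = K" by (simp add: inj_image_eq_iff)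
  qed
  have inj2: "inj_on ((`) Suc) (Pow {..<?n})"
    by (simp add: inj_on_def inj_image_eq_iff)
  have s1: "s (Suc ?n) (insert 0 (Suc ` J)) = s ?n J" if "J \<subseteq> {..<?n}" for J
  proof -
    have "{(i, j). i \<in> insert 0 (Suc ` J) \<and> j \<in> {..<Suc ?n} - insert 0 (Suc ` J) \<and> j < i}
      = map_prod Suc Suc ` {(i, j). i \<in> J \<and> j \<in> {..<?n} - J \<and> j < i}" (is "?L = ?R")
    proof
      show "?L \<subseteq> ?R"
      proof (rule subsetI)
        fix x assume "x \<in> ?L"
        then obtain i j where x: "x = (i, j)" and a: "i \<in> insert 0 (Suc ` J)"
          "j \<in> {..<Suc ?n}" "j \<notin> insert 0 (Suc ` J)" "j < i" by auto
        then obtain i' j' where ij: "i = Suc i'" "j = Suc j'" by (metis Suc_pred gr0I insert_iff less_nat_zero_code)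
        with a show "x \<in> ?R"
          unfolding x by (intro image_eqI[of _ _ "(i', j')"]) auto
      qed
    qed auto
    then show ?thesis unfolding s_def
      by (simp add: card_image inj_on_def)
  qed
  have s2: "s (Suc ?n) (Suc ` J) = card J + s ?n J" if "J \<subseteq> {..<?n}" for J
  proof -
    have fin: "finite J" using that finite_subset by blast
    have fin2: "finite {(i, j). i \<in> J \<and> j \<in> {..<?n} - J \<and> j < i}"
      by (rule finite_subset[of _ "J \<times> {..<?n}"]) (use fin in auto)
    have "{(i, j). i \<in> Suc ` J \<and> j \<in> {..<Suc ?n} - Suc ` J \<and> j < i}
      = (\<lambda>i. (Suc i, 0)) ` J \<union> map_prod Suc Suc ` {(i, j). i \<in> J \<and> j \<in> {..<?n} - J \<and> j < i}"
      (is "?L = ?R")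
    proof
      show "?L \<subseteq> ?R"
      proof (rule subsetI)
        fix x assume "x \<in> ?L"
        then obtain i j where x: "x = (Suc i, j)" and a: "i \<in> J"
          "j \<in> {..<Suc ?n}" "j \<notin> Suc ` J" "j < Suc i" by auto
        show "x \<in> ?R"
        proof (cases j)
          case 0 with a x show ?thesis by auto
        next
          case (Suc j')
          with a have "x \<in> map_prod Suc Suc ` {(i, j). i \<in> J \<and> j \<in> {..<?n} - J \<and> j < i}"
            unfolding x by (intro image_eqI[of _ _ "(i, j')"]) auto
          then show ?thesis by blast
        qed
      qed
    qed auto
    then have "s (Suc ?n) (Suc ` J) = card ((\<lambda>i. (Suc i, 0::nat)) ` J \<union>
        map_prod Suc Suc ` {(i, j). i \<in> J \<and> j \<in> {..<?n} - J \<and> j < i})"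
      unfolding s_def by (rule arg_cong)
    also have "\<dots> = card ((\<lambda>i. (Suc i, 0::nat)) ` J) +
        card (map_prod Suc Suc ` {(i, j). i \<in> J \<and> j \<in> {..<?n} - J \<and> j < i})"
      by (rule card_Un_disjoint[OF finite_imageI[OF fin] finite_imageI[OF fin2]]) auto
    also have "card ((\<lambda>i. (Suc i, 0::nat)) ` J) = card J"
      by (rule card_image) (simp add: inj_on_def)
    also have "card (map_prod Suc Suc ` {(i, j). i \<in> J \<and> j \<in> {..<?n} - J \<and> j < i}) = s ?n J"
      unfolding s_def by (rule card_image) (auto simp: inj_on_def)
    finally show ?thesis .
  qed
  have F1: "F (insert 0 (Suc ` J))
      = (-1) ^ s ?n J * contract v f (nths vs J) * g (nths vs ({..<?n} - J))"
    if "J \<subseteq> {..<?n}" for J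
  proof -
    have "{j. Suc j < Suc ?n \<and> Suc j \<notin> insert 0 (Suc ` J)} = {..<?n} - J" by auto
    then show ?thesis unfolding F_def s1[OF that]
      by (simp add: nths_Cons contract_def image_iff flip: lessThan_iff)
  qed
  have F2: "F (Suc ` J)
      = (-1) ^ s ?n J * grade f (nths vs J) * contract v g (nths vs ({..<?n} - J))"
    if "J \<subseteq> {..<?n}" for J
  proof -
    have "{j. j < ?n \<and> j \<notin> J} = {..<?n} - J" by auto
    moreover have "card J = length (nths vs J)"
      using that unfolding length_nths by (intro arg_cong[of _ _ card]) auto
    ultimately show ?thesis unfolding F_def s2[OF that]
      by (simp add: nths_Cons contract_def grade_def image_iff power_add)
  qed
  have "wedge f g (v # vs) = sum F (Pow {..<Suc ?n})"
    by (simp add: wedge_def F_def s_def)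
  also have "\<dots> = sum F ((\<lambda>J. insert 0 (Suc ` J)) ` Pow {..<?n}) + sum F ((`) Suc ` Pow {..<?n})"
    unfolding Pow_lessThan_Suc by (rule sum.union_disjoint) auto
  also have "\<dots> = (\<Sum>J\<in>Pow {..<?n}. F (insert 0 (Suc ` J))) + (\<Sum>J\<in>Pow {..<?n}. F (Suc ` J))"
    by (simp add: sum.reindex[OF inj1] sum.reindex[OF inj2])
  also have "\<dots> = wedge (contract v f) g vs + wedge (grade f) (contract v g) vs"
    unfolding wedge_def s_def[symmetric]
    by (intro arg_cong2[where f = "(+)"] sum.cong) (simp_all add: F1 F2)
  finally show ?thesis .
qed

lemma wedge_zero_left [simp]: "wedge (\<lambda>_. 0) g = (\<lambda>_. 0)"
  and wedge_zero_right [simp]: "wedge f (\<lambda>_. 0) = (\<lambda>_. 0)"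
  by (simp_all add: wedge_def fun_eq_iff)

lemma wedge_add_left: "wedge (\<lambda>vs. f vs + f' vs) g vs = wedge f g vs + wedge f' g vs"
  by (simp add: wedge_def algebra_simps sum.distrib)

lemma wedge_add_right: "wedge f (\<lambda>vs. g vs + g' vs) vs = wedge f g vs + wedge f g' vs"
  by (simp add: wedge_def algebra_simps sum.distrib)

lemma wedge_scale_left: "wedge (\<lambda>vs. a * f vs) g vs = a * wedge f g vs"
  by (simp add: wedge_def sum_distrib_left mult_ac)

lemma wedge_scale_right: "wedge f (\<lambda>vs. a * g vs) vs = a * wedge f g vs"
  by (simp add: wedge_def sum_distrib_left mult_ac)

lemma contract_grade: "contract v (grade f) = (\<lambda>vs. - grade (contract v f) vs)"
  by (simp add: contract_def grade_def fun_eq_iff)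

lemma length_nths_complement:
  "length (nths vs I) + length (nths vs ({..<length vs} - I)) = length vs"
proof -
  have "{i. i < length vs \<and> i \<in> I} \<union> {i. i < length vs \<and> i \<in> {..<length vs} - I} = {..<length vs}"
    "{i. i < length vs \<and> i \<in> I} \<inter> {i. i < length vs \<and> i \<in> {..<length vs} - I} = {}"
    by auto
  then show ?thesis unfolding length_nths
    using card_Un_disjoint[of "{i. i < length vs \<and> i \<in> I}"
        "{i. i < length vs \<and> i \<in> {..<length vs} - I}"] by simp
qed

lemma wedge_eq_0_if_length:
  assumes "\<And>vs. length vs \<noteq> k \<Longrightarrow> f vs = 0" "\<And>vs. length vs \<noteq> l \<Longrightarrow> g vs = 0" "length vs \<noteq> k + l"
  shows "wedge f g vs = 0"
  unfolding wedge_def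
proof (rule sum.neutral, rule ballI)
  fix I
  have "length (nths vs I) \<noteq> k \<or> length (nths vs ({..<length vs} - I)) \<noteq> l"
    using length_nths_complement[of vs I] assms(3) by auto
  then show "(-1) ^ card {(i, j). i \<in> I \<and> j \<in> {..<length vs} - I \<and> j < i} *
       f (nths vs I) * g (nths vs ({..<length vs} - I)) = 0"
    using assms(1,2) by auto
qed

lemma grade_wedge:
  fixes f g :: "'v list \<Rightarrow> complex"
  shows "grade (wedge f g) = wedge (grade f) (grade g)"
proof
  fix vs :: "'v list"
  have *: "(-1) ^ length vs * (x * a * b) = x * ((-1) ^ length (nths vs I) * a)
      * ((-1) ^ length (nths vs ({..<length vs} - I)) * b)" for I and x a b :: complex
  proof -
    have "(-1) ^ length vs = (-1) ^ length (nths vs I) *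
        ((-1) ^ length (nths vs ({..<length vs} - I)) :: complex)"
      using length_nths_complement[of vs I] by (metis power_add)
    then show ?thesis by (simp only: mult_ac)
  qed
  show "grade (wedge f g) vs = wedge (grade f) (grade g) vs"
    unfolding grade_def wedge_def sum_distrib_left by (rule sum.cong[OF refl *])
qed

lemma wedge_assoc:
  fixes f g h :: "'v list \<Rightarrow> complex"
  shows "wedge (wedge f g) h = wedge f (wedge g h)"
proof
  fix vs :: "'v list" show "wedge (wedge f g) h vs = wedge f (wedge g h) vs"
  proof (induction vs arbitrary: f g h)
    case Nil
    then show ?case by (simp add: wedge_Nil)
  next
    case (Cons v vs)
    have c: "contract v (wedge f g) = (\<lambda>vs. wedge (contract v f) g vs + wedge (grade f) (contract v g) vs)"
      for f g :: "'v list \<Rightarrow> complex" by (rule ext) (simp add: contract_def[of _ "wedge f g"] wedge_Cons)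
    show ?case
      by (simp add: wedge_Cons c wedge_add_left wedge_add_right Cons.IH grade_wedge)
  qed
qed

lemma contract_wedge:
  "contract v (wedge f g) = (\<lambda>vs. wedge (contract v f) g vs + wedge (grade f) (contract v g) vs)"
  by (rule ext) (simp add: contract_def[of _ "wedge f g"] wedge_Cons)

definition covec :: "('v \<Rightarrow> complex) \<Rightarrow> 'v list \<Rightarrow> complex"
  where "covec \<xi> vs = (if length vs = 1 then \<xi> (hd vs) else 0)"

definition unit_form :: "'v list \<Rightarrow> complex"
  where "unit_form vs = (if vs = [] then 1 else 0)"

lemma contract_unit [simp]: "contract v unit_form = (\<lambda>_. 0)"
  and grade_unit [simp]: "grade unit_form = unit_form"
  by (simp_all add: contract_def grade_def unit_form_def fun_eq_iff)

lemma contract_covec: "contract v (covec \<xi>) = (\<lambda>vs. \<xi> v * unit_form vs)"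
  and grade_covec: "grade (covec \<xi>) = (\<lambda>vs. - covec \<xi> vs)"
  by (simp_all add: contract_def grade_def covec_def unit_form_def fun_eq_iff)

lemma wedge_unit_left [simp]: "wedge unit_form f = f"
proof
  fix vs show "wedge unit_form f vs = f vs"
    by (induction vs arbitrary: f)
      (simp_all add: wedge_Nil wedge_Cons, simp_all add: unit_form_def contract_def)
qed

lemma wedge_unit_right [simp]: "wedge f unit_form = f"
proof
  fix vs show "wedge f unit_form vs = f vs"
    by (induction vs arbitrary: f)
      (simp_all add: wedge_Nil wedge_Cons, simp_all add: unit_form_def contract_def)
qed

lemma wedge_minus_left: "wedge (\<lambda>vs. - f vs) g vs = - wedge f g vs"
  using wedge_scale_left[of "-1" f g vs] by simp

lemma wedge_covec_Cons:
  "wedge (covec \<xi>) f (v # vs) = \<xi> v * f vs - wedge (covec \<xi>) (contract v f) vs"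
  by (simp add: wedge_Cons contract_covec grade_covec wedge_scale_left wedge_minus_left)

text \<open>In each term of the exterior product the one-form is evaluated at one of the arguments.\<close>

lemma wedge_covec_eq_0:
  assumes "\<forall>v\<in>set vs. \<xi> v = 0"
  shows "wedge (covec \<xi>) f vs = 0"
  using assms by (induction vs arbitrary: f) (simp_all add: wedge_Nil covec_def wedge_covec_Cons)

lemma wedge_covec_covec: "wedge (covec \<xi>) (covec \<eta>) vs = - wedge (covec \<eta>) (covec \<xi>) vs"
proof (cases vs)
  case Nil
  then show ?thesis by (simp add: wedge_Nil covec_def)
next
  case (Cons v ws)
  then show ?thesis
    by (simp add: wedge_covec_Cons contract_covec wedge_scale_right)
qed

lemma wedge_covec_anticommute:
  "wedge (covec \<xi>) (wedge (covec \<eta>) f) vs = - wedge (covec \<eta>) (wedge (covec \<xi>) f) vs"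
proof -
  have "wedge (covec \<xi>) (covec \<eta>) = (\<lambda>vs. - wedge (covec \<eta>) (covec \<xi>) vs)"
    by (rule ext) (rule wedge_covec_covec)
  then show ?thesis
    by (simp flip: wedge_assoc add: wedge_minus_left)
qed

lemma wedge_covec_self: "wedge (covec \<xi>) (wedge (covec \<xi>) f) vs = 0"
  using wedge_covec_anticommute[of \<xi> \<xi> f vs] by simp

definition two_form :: "('v list \<Rightarrow> complex) \<Rightarrow> bool"
  where "two_form \<sigma> \<longleftrightarrow> (\<forall>vs. length vs \<noteq> 2 \<longrightarrow> \<sigma> vs = 0)"

lemma two_form_simps:
  assumes "two_form \<sigma>"
  shows "grade \<sigma> = \<sigma>" "contract v \<sigma> = covec (\<lambda>w. \<sigma> [v, w])"
proof -
  show "grade \<sigma> = \<sigma>"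
  proof
    fix vs show "grade \<sigma> vs = \<sigma> vs"
      using assms by (cases "length vs = 2") (auto simp: two_form_def grade_def)
  qed
  show "contract v \<sigma> = covec (\<lambda>w. \<sigma> [v, w])"
  proof
    fix vs show "contract v \<sigma> vs = covec (\<lambda>w. \<sigma> [v, w]) vs"
      using assms by (cases vs; cases "tl vs") (auto simp: two_form_def contract_def covec_def)
  qed
qed

lemma wedge_two_form_covec:
  assumes "two_form \<sigma>"
  shows "wedge \<sigma> (covec \<xi>) = wedge (covec \<xi>) \<sigma>"
proof
  fix vs show "wedge \<sigma> (covec \<xi>) vs = wedge (covec \<xi>) \<sigma> vs"
  proof (cases vs)
    case Nil
    then show ?thesis by (simp add: wedge_Nil covec_def)
  next
    case (Cons v ws)
    show ?thesis unfolding Cons wedge_covec_Cons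
      using wedge_covec_covec[of \<xi> "\<lambda>w. \<sigma> [v, w]" ws]
      by (simp add: wedge_Cons two_form_simps[OF assms] contract_covec wedge_scale_right)
  qed
qed

primrec wedge_power :: "('v list \<Rightarrow> complex) \<Rightarrow> nat \<Rightarrow> 'v list \<Rightarrow> complex"
  where "wedge_power \<sigma> 0 = unit_form"
  | "wedge_power \<sigma> (Suc m) = wedge \<sigma> (wedge_power \<sigma> m)"

text \<open>The row expansion of a Pfaffian. It holds because a two-form commutes with every one-form, so the
  interior product meets each of the \<open>m + 1\<close> factors with the same result.\<close>

lemma contract_wedge_power:
  assumes "two_form \<sigma>"
  shows "contract v (wedge_power \<sigma> (Suc m))
    = (\<lambda>vs. of_nat (Suc m) * wedge (covec (\<lambda>w. \<sigma> [v, w])) (wedge_power \<sigma> m) vs)"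
proof (induction m)
  case 0
  then show ?case by (simp add: two_form_simps[OF assms])
next
  case (Suc m)
  let ?x = "covec (\<lambda>w. \<sigma> [v, w])"
  have "wedge \<sigma> (wedge ?x (wedge_power \<sigma> m)) = wedge ?x (wedge_power \<sigma> (Suc m))"
    using wedge_two_form_covec[OF assms, of "\<lambda>w. \<sigma> [v, w]"]
    by (simp flip: wedge_assoc)
  moreover have "contract v (wedge_power \<sigma> (Suc (Suc m)))
    = (\<lambda>vs. wedge ?x (wedge_power \<sigma> (Suc m)) vs + wedge \<sigma> (contract v (wedge_power \<sigma> (Suc m))) vs)"
    unfolding wedge_power.simps(2)[of \<sigma> "Suc m"] contract_wedge two_form_simps[OF assms] ..
  ultimately show ?case
    unfolding Suc.IH wedge_scale_right by (simp add: fun_eq_iff algebra_simps)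
qed

lemma wedge_power_eq_0_if_length:
  assumes "two_form \<sigma>" "length vs \<noteq> 2 * m"
  shows "wedge_power \<sigma> m vs = 0"
  using assms(2)
proof (induction m arbitrary: vs)
  case 0
  then show ?case by (simp add: unit_form_def)
next
  case (Suc m)
  then show ?case using assms(1) unfolding two_form_def wedge_power.simps
    by (intro wedge_eq_0_if_length[of 2 _ "2 * m"]) auto
qed

lemma wedge_power_scale: "wedge_power (\<lambda>vs. a * \<sigma> vs) m vs = a ^ m * wedge_power \<sigma> m vs"
proof (induction m arbitrary: vs)
  case (Suc m)
  have "wedge_power (\<lambda>vs. a * \<sigma> vs) m = (\<lambda>vs. a ^ m * wedge_power \<sigma> m vs)"
    by (rule ext) (rule Suc.IH)
  then show ?case by (simp add: wedge_scale_left wedge_scale_right mult_ac)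
qed simp

definition pull :: "('u \<Rightarrow> 'v) \<Rightarrow> ('v list \<Rightarrow> complex) \<Rightarrow> 'u list \<Rightarrow> complex"
  where "pull g f = (\<lambda>vs. f (map g vs))"

lemma pull_wedge: "pull g (wedge f h) = wedge (pull g f) (pull g h)"
  by (simp add: pull_def wedge_def nths_map fun_eq_iff)

lemma pull_wedge_power: "pull g (wedge_power \<sigma> m) = wedge_power (pull g \<sigma>) m"
  by (induction m) (simp_all add: pull_wedge, simp add: pull_def unit_form_def fun_eq_iff)

lemma pull_covec: "pull g (covec \<xi>) = covec (\<lambda>v. \<xi> (g v))"
  by (auto simp: pull_def covec_def fun_eq_iff hd_map length_0_conv[symmetric] simp del: length_0_conv)

section \<open>Alternating covectors\<close>

lemma linear_times:
  fixes f :: "'v::real_vector \<Rightarrow> complex"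
  assumes "linear f" shows "linear (\<lambda>v. a * f v)" "linear (\<lambda>v. f v * a)"
  using assms by (auto intro!: linearI simp: linear_add linear_scale algebra_simps)

lemma swap_adjacent:
  fixes f :: "'v::real_vector list \<Rightarrow> complex"
  assumes lin: "\<And>us ws. linear (\<lambda>v. f (us @ v # ws))"
    and adj: "\<And>us v ws. f (us @ v # v # ws) = 0"
  shows "f (us @ v # w # ws) = - f (us @ w # v # ws)"
proof -
  have l1: "f (us @ (x + y) # z # ws) = f (us @ x # z # ws) + f (us @ y # z # ws)" for x y z
    by (rule linear_add[OF lin])
  have l2: "f (us @ z # (x + y) # ws) = f (us @ z # x # ws) + f (us @ z # y # ws)" for x y z
    using linear_add[OF lin[of "us @ [z]"]] by simp
  have "f (us @ (v + w) # (v + w) # ws) = f (us @ v # w # ws) + f (us @ w # v # ws)"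
    by (simp only: l1 l2) (simp add: adj)
  then have "0 = f (us @ v # w # ws) + f (us @ w # v # ws)"
    by (simp only: adj)
  from this[symmetric] show ?thesis
    by (simp only: eq_neg_iff_add_eq_0)
qed

text \<open>Vanishing on lists with two equal neighbours suffices: by polarization neighbours may be swapped
  up to sign, and two equal entries can be brought next to each other.\<close>

lemma alternatingI:
  fixes f :: "'v::real_vector list \<Rightarrow> complex"
  assumes lin: "\<And>us ws. linear (\<lambda>v. f (us @ v # ws))"
    and adj: "\<And>us v ws. f (us @ v # v # ws) = 0"
  shows "alternating f"
proof -
  have *: "f (us @ v # ws @ v # zs) = 0" for us v ws zs
  proof (induction ws arbitrary: us)
    case Nil
    then show ?case by (simp add: adj)
  next
    case (Cons w ws)
    show ?case
      using Cons[of "us @ [w]"] swap_adjacent[OF lin adj, of us v w "ws @ v # zs"] by simp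
  qed
  show ?thesis
    unfolding alternating_def
  proof (intro conjI allI impI)
    fix vs :: "'v list" assume "\<not> distinct vs"
    then obtain us ws zs v where "vs = us @ [v] @ ws @ [v] @ zs"
      using not_distinct_decomp by blast
    then show "f vs = 0" using *[of us v ws zs] by simp
  qed (rule lin)
qed

lemma alternating_linear: "alternating f \<Longrightarrow> linear (\<lambda>v. f (us @ v # ws))"
  and alternating_not_distinct: "alternating f \<Longrightarrow> \<not> distinct vs \<Longrightarrow> f vs = 0"
  by (auto simp: alternating_def)

lemma alternating_linear_Cons: "alternating f \<Longrightarrow> linear (\<lambda>v. f (v # ws))"
  using alternating_linear[of f "[]"] by simp

lemma alternating_swap:
  "alternating f \<Longrightarrow> f (us @ v # w # ws) = - f (us @ w # v # ws)"
  by (rule swap_adjacent) (auto intro: alternating_linear alternating_not_distinct)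

lemma alternating_contract:
  assumes "alternating f" shows "alternating (contract v f)"
  unfolding alternating_def
proof (intro conjI allI impI)
  fix us ws show "linear (\<lambda>w. contract v f (us @ w # ws))"
    using alternating_linear[OF assms, of "v # us" ws] by (simp add: contract_def)
qed (use assms in \<open>simp add: contract_def alternating_not_distinct\<close>)

lemma alternating_zero: "alternating (\<lambda>_. 0)"
  by (simp add: alternating_def linear_zero)

lemma alternating_add: "alternating f \<Longrightarrow> alternating g \<Longrightarrow> alternating (\<lambda>vs. f vs + g vs)"
  by (simp add: alternating_def linear_compose_add)

lemma alternating_scale: "alternating f \<Longrightarrow> alternating (\<lambda>vs. a * f vs)"
  by (simp add: alternating_def linear_times)

lemma alternating_grade: 
  assumes "alternating f" shows "alternating (grade f)"
  unfolding alternating_def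
proof (intro conjI allI impI)
  fix us ws show "linear (\<lambda>v. grade f (us @ v # ws))"
    using linear_times(1)[OF alternating_linear[OF assms], of "(-1) ^ Suc (length us + length ws)" us ws]
    by (simp add: grade_def)
qed (use assms in \<open>simp add: grade_def alternating_not_distinct\<close>)

lemma alternating_unit: "alternating unit_form"
  by (auto simp: alternating_def unit_form_def linear_zero)

lemma alternating_covec: 
  assumes "linear \<xi>" shows "alternating (covec \<xi>)"
proof (rule alternatingI)
  fix us ws :: "'a list"
  show "linear (\<lambda>v. covec \<xi> (us @ v # ws))"
    using assms by (cases "us = [] \<and> ws = []") (auto simp: covec_def linear_zero)
qed (simp add: covec_def)

text \<open>Both properties concern one or two positions of the list. The antiderivation rule removes the
  entries in front of them one at a time, at the cost of replacing the factors by their interior products.\<close>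

lemma alternating_wedge:
  fixes f g :: "'v::real_vector list \<Rightarrow> complex"
  assumes "alternating f" "alternating g"
  shows "alternating (wedge f g)"
proof (rule alternatingI)
  fix us ws :: "'v list"
  show "linear (\<lambda>v. wedge f g (us @ v # ws))"
    using assms
  proof (induction us arbitrary: f g)
    case Nil
    have "linear (\<lambda>v. contract v h vs)" if "alternating h" for h :: "'v list \<Rightarrow> complex" and vs
      unfolding contract_def by (rule alternating_linear_Cons[OF that])
    with Nil show ?case
      unfolding append_Nil wedge_Cons unfolding wedge_def
      by (intro linear_compose_add linear_compose_sum ballI linear_times) auto
  next
    case (Cons u us)
    then show ?case
      by (auto simp: wedge_Cons intro!: linear_compose_add alternating_contract alternating_grade)
  qed
next
  fix us ws :: "'v list" and v :: 'v
  have c0: "contract v (contract v h) = (\<lambda>_. 0)" if "alternating h" for h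
    by (rule ext) (simp add: contract_def alternating_not_distinct[OF that])
  show "wedge f g (us @ v # v # ws) = 0"
    using assms
  proof (induction us arbitrary: f g)
    case Nil
    then show ?case
      by (simp add: wedge_Cons c0 contract_grade wedge_minus_left)
  next
    case (Cons u us)
    then show ?case
      by (simp add: wedge_Cons alternating_contract alternating_grade)
  qed
qed

lemma alternating_wedge_power: "alternating \<sigma> \<Longrightarrow> alternating (wedge_power \<sigma> m)"
  by (induction m) (simp_all add: alternating_unit alternating_wedge)

lemma alternating_pull:
  assumes "linear g" "alternating f" shows "alternating (pull g f)"
proof (rule alternatingI)
  fix us ws
  show "linear (\<lambda>v. pull g f (us @ v # ws))"
    using linear_compose[OF assms(1) alternating_linear[OF assms(2), of "map g us" "map g ws"]]
    by (simp add: pull_def o_def)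
qed (simp add: pull_def alternating_not_distinct[OF assms(2)])

text \<open>The vectors \<open>x\<close> at which the value is zero form a subspace, which contains the other arguments.\<close>

lemma alternating_span_eq_0:
  assumes "alternating h" "x \<in> span (set us \<union> set ws)"
  shows "h (us @ x # ws) = 0"
proof -
  have "span (set us \<union> set ws) \<subseteq> {x. h (us @ x # ws) = 0}"
  proof (rule span_minimal)
    show "set us \<union> set ws \<subseteq> {x. h (us @ x # ws) = 0}"
      using alternating_not_distinct[OF assms(1)] by auto
    show "subspace {x. h (us @ x # ws) = 0}"
      by (rule linear_subspace_kernel[OF alternating_linear[OF assms(1)]])
  qed
  with assms(2) show ?thesis by auto
qed

lemma alternating_eq_0_if_length:
  fixes h :: "'v::euclidean_space list \<Rightarrow> complex"
  assumes "alternating h" "length vs > DIM('v)"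
  shows "h vs = 0"
proof (cases "distinct vs")
  case True
  then have "card (set vs) > DIM('v)" using assms(2) by (simp add: distinct_card)
  then have "dependent (set vs)" using independent_bound by (meson not_less)
  then obtain a where a: "a \<in> set vs" "a \<in> span (set vs - {a})"
    unfolding dependent_def by blast
  then obtain us ws where vs: "vs = us @ a # ws" by (meson split_list)
  have "set vs - {a} \<subseteq> set us \<union> set ws" unfolding vs by auto
  then have "a \<in> span (set us \<union> set ws)" using a(2) span_mono by blast
  then show ?thesis unfolding vs by (rule alternating_span_eq_0[OF assms(1)])
qed (rule alternating_not_distinct[OF assms(1)])

lemma alternating_move_front:
  assumes "alternating f"
  shows "f (us @ v # ws) = (-1) ^ length us * f (v # us @ ws)"
  using assms
proof (induction us arbitrary: f)
  case (Cons u us)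
  have "f ((u # us) @ v # ws) = contract u f (us @ v # ws)" by (simp add: contract_def)
  also have "\<dots> = (-1) ^ length us * contract u f (v # us @ ws)"
    by (rule Cons.IH[OF alternating_contract[OF Cons.prems]])
  also have "contract u f (v # us @ ws) = - f (v # u # us @ ws)"
    using alternating_swap[OF Cons.prems, of "[]" u v] by (simp add: contract_def)
  finally show ?case by simp
qed simp

lemma alternating_mset_eq_0:
  assumes "alternating f" "mset vs = mset ws" "f vs = 0"
  shows "f ws = 0"
  using assms
proof (induction vs arbitrary: ws f)
  case (Cons v vs)
  then have "v \<in> set ws" by (metis list.set_intros(1) set_mset_mset)
  then obtain as bs where ws: "ws = as @ v # bs" by (meson split_list)
  have "contract v f (as @ bs) = 0"
  proof (rule Cons.IH)
    show "alternating (contract v f)" by (rule alternating_contract[OF Cons.prems(1)])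
  qed (use Cons.prems in \<open>auto simp: ws contract_def\<close>)
  then show ?case
    unfolding ws alternating_move_front[OF Cons.prems(1)] by (simp add: contract_def)
qed simp

text \<open>By multilinearity it is enough to consider lists of basis vectors. Such a list of full length
  repeats a vector or is a permutation of the basis.\<close>

lemma top_form_eq_0:
  assumes alt: "alternating h" and d: "distinct bs" and sp: "span (set bs) = UNIV"
    and 0: "h bs = 0" and len: "length vs = length bs"
  shows "h vs = 0"
proof -
  have "h (us @ ws) = 0" if "set ws \<subseteq> set bs" "length (us @ ws) = length bs" for us ws
    using that
  proof (induction us arbitrary: ws rule: rev_induct)
    case Nil
    show ?case
    proof (cases "distinct ws")
      case True
      have "set ws = set bs"
        using Nil True d by (intro card_subset_eq) (auto simp: distinct_card)
      then have "mset bs = mset ws" using set_eq_iff_mset_eq_distinct[OF d True] by simp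
      then show ?thesis using alternating_mset_eq_0[OF alt _ 0] by simp
    qed (simp add: alternating_not_distinct[OF alt])
  next
    case (snoc u us)
    have "span (set bs) \<subseteq> {x. h (us @ x # ws) = 0}"
    proof (rule span_minimal)
      show "set bs \<subseteq> {x. h (us @ x # ws) = 0}"
        using snoc.IH[of "_ # ws"] snoc.prems by auto
      show "subspace {x. h (us @ x # ws) = 0}"
        by (rule linear_subspace_kernel[OF alternating_linear[OF alt]])
    qed
    then show ?case using sp by auto
  qed
  from this[of "[]" vs] show ?thesis using len by simp
qed

definition inner_covec :: "'v::real_inner \<Rightarrow> 'v list \<Rightarrow> complex"
  where "inner_covec x = covec (\<lambda>v. complex_of_real (v \<bullet> x))"

lemma alternating_inner_covec: "alternating (inner_covec x)"
  unfolding inner_covec_def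
  by (rule alternating_covec) (auto intro!: linearI simp: inner_add_left scaleR_conv_of_real)

text \<open>Fewer vectors than the dimension leave room for a vector orthogonal to all of them: the exterior
  product with its dual one-form, evaluated at this vector and the given ones, recovers \<open>h\<close>.\<close>

lemma wedge_inner_covec_injective:
  fixes h :: "'v::euclidean_space list \<Rightarrow> complex"
  assumes "\<And>x ws. length ws = Suc (length vs) \<Longrightarrow> wedge (inner_covec x) h ws = 0"
    and "length vs < DIM('v)"
  shows "h vs = 0"
proof -
  have "dim (set vs) < DIM('v)"
    using assms(2) dim_le_card'[of "set vs"] card_length[of vs] by simp
  then obtain x where x: "x \<noteq> 0" "\<And>y. y \<in> span (set vs) \<Longrightarrow> orthogonal x y"
    using orthogonal_to_subspace_exists by blast
  then have "wedge (covec (\<lambda>v. complex_of_real (v \<bullet> x))) (contract x h) vs = 0"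
    by (intro wedge_covec_eq_0) (auto simp: orthogonal_def inner_commute span_base)
  then show ?thesis
    using assms(1)[of "x # vs" x] x(1) by (simp add: inner_covec_def wedge_covec_Cons)
qed

section \<open>The complex structure and the standard frame\<close>

lemma linear_vector_smult: "linear ((*s) (a::complex) :: complex ^ 'n \<Rightarrow> _)"
  by (rule linearI) (simp_all add: vec_eq_iff algebra_simps)

lemma J_J [simp]: "\<i> *s (\<i> *s v) = - (v :: complex ^ 'n)"
  by (simp add: vec_eq_iff)

lemma inner_J_J [simp]: "(\<i> *s v) \<bullet> (\<i> *s w) = v \<bullet> (w :: complex ^ 'n::finite)"
  by (simp add: inner_vec_def inner_complex_def add.commute)

lemma vector_smult_complex: "(a::complex) *s v = Re a *\<^sub>R v + Im a *\<^sub>R (\<i> *s (v :: complex ^ 'n))"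
  by (simp add: vec_eq_iff complex_eq_iff)

text \<open>The real basis \<open>b\<^sub>1, i b\<^sub>1, b\<^sub>2, i b\<^sub>2, \<dots>\<close> belonging to a complex basis.\<close>

definition J_pairs :: "(complex ^ 'n) list \<Rightarrow> (complex ^ 'n) list"
  where "J_pairs bs = concat (map (\<lambda>b. [b, \<i> *s b]) bs)"

lemma J_pairs_simps [simp]: "J_pairs [] = []" "J_pairs (b # bs) = b # \<i> *s b # J_pairs bs"
  by (simp_all add: J_pairs_def)

lemma length_J_pairs [simp]: "length (J_pairs bs) = 2 * length bs"
  by (induction bs) auto

lemma set_J_pairs: "set (J_pairs bs) = set bs \<union> (*s) \<i> ` set bs"
  by (induction bs) auto

text \<open>Multiplication by \<open>i\<close> replaces each pair \<open>b, i b\<close> by \<open>i b, - b\<close>: two changes of sign.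
  In other words, complex linear maps preserve the orientation.\<close>

lemma alternating_rotate_J_pairs:
  assumes "alternating h"
  shows "h (us @ map ((*s) \<i>) (J_pairs bs)) = h (us @ J_pairs bs)"
proof (induction bs arbitrary: us)
  case (Cons b bs)
  let ?ws = "map ((*s) \<i>) (J_pairs bs)"
  have "h (us @ map ((*s) \<i>) (J_pairs (b # bs))) = h ((us @ [\<i> *s b]) @ (- b) # ?ws)"
    by simp
  also have "\<dots> = - h ((us @ [\<i> *s b]) @ b # ?ws)"
    by (rule linear_neg[OF alternating_linear[OF assms]])
  also have "\<dots> = h ((us @ [b, \<i> *s b]) @ ?ws)"
    using alternating_swap[OF assms, of us b "\<i> *s b" ?ws] by simp
  also have "\<dots> = h ((us @ [b, \<i> *s b]) @ J_pairs bs)"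
    by (rule Cons.IH)
  finally show ?case by simp
qed simp

text \<open>An arbitrary enumeration of the index type; it only serves to order the real standard basis.\<close>

definition frame_list :: "'n::finite list"
  where "frame_list = (SOME js. distinct js \<and> set js = UNIV)"

definition frame_basis :: "(complex ^ 'n::finite) list"
  where "frame_basis = map (\<lambda>j. axis j 1) frame_list"

abbreviation frame :: "(complex ^ 'n::finite) list"
  where "frame \<equiv> J_pairs frame_basis"

lemma frame_list: "distinct (frame_list :: 'n::finite list)" "set (frame_list :: 'n list) = UNIV"
proof -
  have "distinct (frame_list :: 'n list) \<and> set (frame_list :: 'n list) = UNIV"
    unfolding frame_list_def by (rule someI_ex) (metis finite_distinct_list finite)
  then show "distinct (frame_list :: 'n list)" "set (frame_list :: 'n list) = UNIV" by auto
qed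

lemma length_frame_basis: "length (frame_basis :: (complex ^ 'n::finite) list) = CARD('n)"
  using distinct_card[OF frame_list(1)[where 'n = 'n]] by (simp add: frame_basis_def frame_list(2))

lemma length_frame: "length (frame :: (complex ^ 'n::finite) list) = 2 * CARD('n)"
  by (simp add: length_frame_basis)

lemma set_frame: "set (frame :: (complex ^ 'n::finite) list) = Basis"
proof -
  have "\<i> *s axis j 1 = (axis j \<i> :: complex ^ 'n)" for j
    by (simp add: vec_eq_iff axis_def)
  then show ?thesis
    unfolding set_J_pairs frame_basis_def set_map frame_list image_image Basis_vec_def
      Basis_complex_def by (simp only: UN_insert UN_empty Un_empty_right) blast
qed

lemma DIM_complex_vec: "DIM(complex ^ 'n::finite) = 2 * CARD('n)"
  by simp

lemma distinct_frame: "distinct (frame :: (complex ^ 'n::finite) list)"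
  by (rule card_distinct) (simp only: set_frame length_frame DIM_complex_vec)

lemma top_form_frame_eq_0:
  fixes h :: "(complex ^ 'n::finite) list \<Rightarrow> complex"
  assumes "alternating h" "h frame = 0" "length vs = 2 * CARD('n)"
  shows "h vs = 0"
  by (rule top_form_eq_0[OF assms(1) distinct_frame _ assms(2)])
    (simp_all only: set_frame span_Basis assms length_frame)

text \<open>The exterior product of the dual basis has value 1 on the basis.\<close>

lemma ex_volume_form:
  "\<exists>h :: (complex ^ 'n::finite) list \<Rightarrow> complex. alternating h \<and> h frame \<noteq> 0"
proof -
  define H where "H es = foldr (\<lambda>e. wedge (inner_covec e)) es unit_form" for es :: "(complex ^ 'n) list"
  have alt: "alternating (H es)" for es
    unfolding H_def by (induction es) (simp_all add: alternating_unit alternating_wedge alternating_inner_covec)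
  have "H es es = 1" if "distinct es" "set es \<subseteq> Basis" for es
    using that
  proof (induction es)
    case Nil
    then show ?case by (simp add: H_def unit_form_def)
  next
    case (Cons e es)
    have "wedge (covec (\<lambda>v. complex_of_real (v \<bullet> e))) (contract e (H es)) es = 0"
      using Cons.prems by (intro wedge_covec_eq_0) (auto simp: inner_Basis)
    moreover have "H (e # es) = wedge (covec (\<lambda>v. complex_of_real (v \<bullet> e))) (H es)"
      by (simp add: H_def inner_covec_def)
    ultimately show ?case using Cons by (simp add: wedge_covec_Cons inner_Basis)
  qed
  from this[OF distinct_frame] have "H frame frame \<noteq> 0" by (simp only: set_frame) auto
  with alt show ?thesis by blast
qed

section \<open>Duality and roots of positive covectors of bidegree (n-1,n-1)\<close>

definition real_valued :: "('v list \<Rightarrow> complex) \<Rightarrow> bool"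
  where "real_valued f \<longleftrightarrow> (\<forall>vs. f vs \<in> \<real>)"

lemma real_valued_wedge: "real_valued f \<Longrightarrow> real_valued g \<Longrightarrow> real_valued (wedge f g)"
  unfolding real_valued_def wedge_def by (auto intro!: sum_in_Reals Reals_mult Reals_power)

lemma real_valued_wedge_power: "real_valued \<sigma> \<Longrightarrow> real_valued (wedge_power \<sigma> m)"
  by (induction m) (simp_all add: real_valued_wedge, simp add: real_valued_def unit_form_def)

lemma real_valued_inner_covec: "real_valued (inner_covec x)"
  by (simp add: real_valued_def inner_covec_def covec_def)

lemma real_valued_of_Re: "real_valued f \<Longrightarrow> complex_of_real (Re (f vs)) = f vs"
  by (simp add: real_valued_def)

text \<open>A Hodge-type duality from covectors of degree \<open>2n - 2\<close> to covectors of degree 2. A form \<open>f\<close> of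
  degree \<open>2n - 2\<close> is the same as a pairing of one-forms, \<open>(\<xi>, \<eta>) \<mapsto> \<xi> \<and> \<eta> \<and> f\<close>, up to a volume form;
  one-forms are identified with vectors by the euclidean inner product. This depends on
  the chart, but whether the dual of a form is positive does not (\<open>pos11_star_change_chart\<close>).\<close>

definition star :: "((complex ^ 'n::finite) list \<Rightarrow> complex) \<Rightarrow> (complex ^ 'n) list \<Rightarrow> complex"
  where "star f vs =
    (if length vs = 2 then wedge (inner_covec (vs ! 0)) (wedge (inner_covec (vs ! 1)) f) frame else 0)"

lemma star_pair: "star f [u, v] = wedge (inner_covec u) (wedge (inner_covec v) f) frame"
  by (simp add: star_def)

lemma two_form_star: "two_form (star f)"
  by (simp add: two_form_def star_def)

lemma linear_inner_covec: "linear (\<lambda>x. inner_covec x vs)"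
  by (rule linearI) (simp_all add: inner_covec_def covec_def inner_add_right scaleR_conv_of_real)

lemma linear_wedge_inner_covec: "linear (\<lambda>x. wedge (inner_covec x) g vs)"
  unfolding wedge_def
  by (intro linear_compose_sum ballI linear_times linear_inner_covec)

lemma alternating_star:
  fixes f :: "(complex ^ 'n::finite) list \<Rightarrow> complex"
  shows "alternating (star f)"
proof (rule alternatingI)
  fix us ws :: "(complex ^ 'n) list"
  consider w where "us = []" "ws = [w]" | u where "us = [u]" "ws = []" | "length us + length ws \<noteq> 1"
    by (metis One_nat_def add_is_1 length_0_conv length_Suc_conv)
  then show "linear (\<lambda>v. star f (us @ v # ws))"
  proof cases
    case 1
    then show ?thesis by (simp add: star_pair linear_wedge_inner_covec)
  next
    case 2
    then show ?thesis
      unfolding 2 append_Cons append_Nil star_pair wedge_def[of "inner_covec u"]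
      by (intro linear_compose_sum ballI linear_times linear_wedge_inner_covec)
  next
    case 3
    then show ?thesis by (simp add: star_def linear_zero)
  qed
next
  fix us ws :: "(complex ^ 'n) list" and v
  show "star f (us @ v # v # ws) = 0"
    by (cases "us = [] \<and> ws = []")
      (auto simp: star_pair inner_covec_def wedge_covec_self, auto simp: star_def)
qed

lemma star_add: "star (\<lambda>vs. f vs + g vs) vs = star f vs + star g vs"
proof -
  have "wedge (inner_covec v) (\<lambda>vs. f vs + g vs)
    = (\<lambda>vs. wedge (inner_covec v) f vs + wedge (inner_covec v) g vs)" for v
    by (rule ext) (rule wedge_add_right)
  then show ?thesis by (simp add: star_def wedge_add_right)
qed

lemma star_scale: "star (\<lambda>vs. a * f vs) vs = a * star f vs"
proof -
  have "wedge (inner_covec v) (\<lambda>vs. a * f vs) = (\<lambda>vs. a * wedge (inner_covec v) f vs)" for v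
    by (rule ext) (rule wedge_scale_right)
  then show ?thesis by (simp add: star_def wedge_scale_right)
qed

lemma real_valued_star:
  assumes "real_valued f" shows "real_valued (star f)"
proof -
  have "real_valued (wedge (inner_covec u) (wedge (inner_covec v) f))" for u v
    by (intro real_valued_wedge real_valued_inner_covec assms)
  then show ?thesis by (simp add: real_valued_def star_def)
qed

text \<open>Multiplication by \<open>i\<close> is orthogonal, leaves \<open>f\<close> unchanged and preserves the volume.\<close>

lemma star_J_invariant:
  assumes "alternating f" "\<And>vs. f (map ((*s) \<i>) vs) = f vs"
  shows "star f [\<i> *s u, \<i> *s v] = star f [u, v]"
proof -
  have c: "pull ((*s) \<i>) (inner_covec (\<i> *s u)) = inner_covec u" for u :: "complex ^ 'n"
    by (simp add: inner_covec_def pull_covec)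
  have p: "pull ((*s) \<i>) f = f" using assms(2) by (simp add: pull_def)
  let ?w = "wedge (inner_covec (\<i> *s u)) (wedge (inner_covec (\<i> *s v)) f)"
  have alt: "alternating ?w"
    by (intro alternating_wedge alternating_inner_covec assms)
  have "star f [\<i> *s u, \<i> *s v] = ?w (map ((*s) \<i>) frame)"
    using alternating_rotate_J_pairs[OF alt, of "[]"] by (simp add: star_pair)
  also have "\<dots> = pull ((*s) \<i>) ?w frame" by (simp add: pull_def)
  also have "\<dots> = star f [u, v]" by (simp add: pull_wedge c p star_pair)
  finally show ?thesis .
qed

lemma length_2E:
  assumes "length vs = 2" obtains u v where "vs = [u, v]"
  using assms by (auto simp: length_Suc_conv numeral_2_eq_2)

text \<open>If \<open>\<xi> \<and> \<eta> \<and> f\<close> vanishes on the frame, it vanishes identically, and the two one-forms can be cancelled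
  one after the other since the degrees are smaller than \<open>2n\<close>.\<close>

lemma star_injective:
  fixes f :: "(complex ^ 'n::finite) list \<Rightarrow> complex"
  assumes alt: "alternating f" and n: "CARD('n) = Suc m" and len: "\<And>vs. length vs \<noteq> 2 * m \<Longrightarrow> f vs = 0"
    and 0: "\<And>u v. star f [u, v] = 0"
  shows "f vs = 0"
proof (cases "length vs = 2 * m")
  case True
  show ?thesis
  proof (rule wedge_inner_covec_injective)
    fix x and ws :: "(complex ^ 'n) list" assume ws: "length ws = Suc (length vs)"
    show "wedge (inner_covec x) f ws = 0"
    proof (rule wedge_inner_covec_injective)
      fix y and us :: "(complex ^ 'n) list" assume us: "length us = Suc (length ws)"
      show "wedge (inner_covec y) (wedge (inner_covec x) f) us = 0"
      proof (rule top_form_frame_eq_0)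
        show "alternating (wedge (inner_covec y) (wedge (inner_covec x) f))"
          by (intro alternating_wedge alternating_inner_covec alt)
        show "wedge (inner_covec y) (wedge (inner_covec x) f) frame = 0"
          using 0[of y x] by (simp add: star_pair)
      qed (simp add: us ws True n)
    qed (simp add: ws True n)
  qed (simp add: True n)
qed (rule len)

text \<open>The real positive covectors of bidegree \<open>(1,1)\<close>. Invariance under \<open>i\<close> suffices to express the
  bidegree (see \<open>pos11_smult\<close> below).\<close>

definition pos11 :: "((complex ^ 'n::finite) list \<Rightarrow> complex) \<Rightarrow> bool"
  where "pos11 \<sigma> \<longleftrightarrow> alternating \<sigma> \<and> two_form \<sigma> \<and> real_valued \<sigma> \<and>
    (\<forall>u v. \<sigma> [\<i> *s u, \<i> *s v] = \<sigma> [u, v]) \<and> (\<forall>v. v \<noteq> 0 \<longrightarrow> Re (\<sigma> [v, \<i> *s v]) > 0)"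

lemma pos11D:
  assumes "pos11 \<sigma>"
  shows "alternating \<sigma>" "two_form \<sigma>" "real_valued \<sigma>" "\<sigma> [\<i> *s u, \<i> *s v] = \<sigma> [u, v]"
    "v \<noteq> 0 \<Longrightarrow> Re (\<sigma> [v, \<i> *s v]) > 0"
  using assms by (auto simp: pos11_def)

lemma alternating_pair:
  assumes "alternating \<sigma>"
  shows "linear (\<lambda>u. \<sigma> [u, v])" "linear (\<lambda>v. \<sigma> [u, v])" "\<sigma> [v, v] = 0" "\<sigma> [u, v] = - \<sigma> [v, u]"
  using alternating_linear[OF assms, of "[]" "[v]"] alternating_linear[OF assms, of "[u]" "[]"]
    alternating_not_distinct[OF assms, of "[v, v]"] alternating_swap[OF assms, of "[]" u v "[]"]
  by simp_all

lemma J_skew: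
  assumes "pos11 \<sigma>" shows "\<sigma> [u, \<i> *s v] = - \<sigma> [\<i> *s u, v]"
  using pos11D(4)[OF assms, of u "\<i> *s v"] linear_neg[OF alternating_pair(2)[OF pos11D(1)[OF assms]]]
  by simp

text \<open>Gram-Schmidt. Subtracting complex multiples of \<open>b\<close> from the later vectors makes them
  \<open>\<sigma>\<close>-orthogonal to \<open>b\<close> and does not change any alternating covector on the list, and then the row
  expansion along \<open>b\<close> has the single term \<open>\<sigma>(b, i b)\<close>. That some alternating \<open>h\<close> does not vanish on the list
  expresses linear independence in the form that the induction needs.\<close>

lemma wedge_power_J_pairs_pos:
  fixes bs :: "(complex ^ 'n::finite) list"
  assumes pos: "pos11 \<sigma>" and h: "alternating h" "h (J_pairs bs) \<noteq> 0"
  shows "Re (wedge_power \<sigma> (length bs) (J_pairs bs)) > 0"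
  using h
proof (induction "length bs" arbitrary: bs h)
  case 0
  then show ?case by (simp add: unit_form_def)
next
  case (Suc m)
  note alt = pos11D(1)[OF pos] and two = pos11D(2)[OF pos] and re = pos11D(3)[OF pos]
  from Suc.hyps(2) obtain b bs' where bs: "bs = b # bs'" and m: "m = length bs'"
    by (metis length_Suc_conv)
  have b0: "b \<noteq> 0"
  proof
    assume "b = 0"
    then show False
      using Suc.prems linear_0[OF alternating_linear_Cons[OF Suc.prems(1)]] by (simp add: bs)
  qed
  define s where "s = Re (\<sigma> [b, \<i> *s b])"
  have s: "s > 0" unfolding s_def by (rule pos11D(5)[OF pos b0])
  have sb: "\<sigma> [b, \<i> *s b] = of_real s" by (simp add: s_def real_valued_of_Re[OF re])
  \<comment> \<open>the coefficient for which \<open>u - c u *s b\<close> is \<open>\<sigma>\<close>-orthogonal to \<open>b\<close> and to \<open>i b\<close>\<close>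
  define c where "c u = Complex (- Re (\<sigma> [\<i> *s b, u]) / s) (Re (\<sigma> [b, u]) / s)" for u
  define proj where "proj u = u - c u *s b" for u
  have cb: "c u *s b = Re (c u) *\<^sub>R b + Im (c u) *\<^sub>R (\<i> *s b)" for u
    by (rule vector_smult_complex)
  have e: "\<sigma> [w, proj u] = \<sigma> [w, u] - (Re (c u) * \<sigma> [w, b] + Im (c u) * \<sigma> [w, \<i> *s b])" for u w
    unfolding proj_def cb
    by (simp only: linear_diff[OF alternating_pair(2)[OF alt]] linear_add[OF alternating_pair(2)[OF alt]]
        linear_scale[OF alternating_pair(2)[OF alt]]) (simp only: scaleR_conv_of_real)
  have v1: "\<sigma> [b, proj u] = 0" for u
    using s by (simp add: e sb alternating_pair(3)[OF alt] c_def real_valued_of_Re[OF re])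
  have v2: "\<sigma> [\<i> *s b, proj u] = 0" for u
    using s alternating_pair(4)[OF alt, of "\<i> *s b" b]
    by (simp add: e sb alternating_pair(3)[OF alt] c_def real_valued_of_Re[OF re])
  have v3: "\<sigma> [b, \<i> *s proj u] = 0" for u
    using J_skew[OF pos, of b] v2 by simp
  \<comment> \<open>the projection leaves every alternating covector unchanged\<close>
  have drop: "g (us @ J_pairs (map proj ws)) = g (us @ J_pairs ws)"
    if g: "alternating g" and us: "b \<in> set us" "\<i> *s b \<in> set us" for g us ws
    using us
  proof (induction ws arbitrary: us)
    case (Cons u ws)
    have sp: "a *s b \<in> span (set us \<union> X)" for a X
      unfolding vector_smult_complex[of a]
      using Cons.prems by (intro span_add span_scale span_base) auto
    have d: "g (us' @ (x - a *s b) # zs) = g (us' @ x # zs)" if "set us \<subseteq> set us'" for us' x a zs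
    proof -
      have "a *s b \<in> span (set us' \<union> set zs)"
        using sp[of a "set us' \<union> set zs"] that by (simp add: Un_absorb1 flip: Un_assoc)
      then show ?thesis
        using linear_diff[OF alternating_linear[OF g, of us' zs], of x "a *s b"]
          alternating_span_eq_0[OF g] by simp
    qed
    have "\<i> *s proj u = \<i> *s u - (\<i> * c u) *s b"
      by (simp add: proj_def vec_eq_iff algebra_simps)
    then have "g (us @ J_pairs (map proj (u # ws)))
        = g (us @ u # (\<i> *s u - (\<i> * c u) *s b) # J_pairs (map proj ws))"
      using d[of us u "c u"] by (simp add: proj_def)
    also have "\<dots> = g ((us @ [u, \<i> *s u]) @ J_pairs (map proj ws))"
      using d[of "us @ [u]" "\<i> *s u" "\<i> * c u"] by (simp add: subset_insertI)
    also have "\<dots> = g ((us @ [u, \<i> *s u]) @ J_pairs ws)"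
      using Cons.prems by (intro Cons.IH) auto
    finally show ?case by simp
  qed simp
  let ?ws = "J_pairs (map proj bs')"
  have "contract (\<i> *s b) (contract b h) ?ws = h (J_pairs bs)"
    using drop[OF Suc.prems(1), of "[b, \<i> *s b]" bs'] by (simp add: contract_def bs)
  then have "Re (wedge_power \<sigma> (length (map proj bs')) ?ws) > 0"
    using Suc.prems by (intro Suc.hyps(1)[of _ "contract (\<i> *s b) (contract b h)"])
      (simp_all add: m alternating_contract)
  then have IH: "Re (wedge_power \<sigma> m ?ws) > 0" by (simp add: m)
  have "wedge_power \<sigma> (Suc m) (J_pairs bs) = wedge_power \<sigma> (Suc m) (b # \<i> *s b # ?ws)"
    using drop[OF alternating_wedge_power[OF alt], of "[b, \<i> *s b]" "Suc m" bs'] by (simp add: bs)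
  also have "\<dots> = contract b (wedge_power \<sigma> (Suc m)) (\<i> *s b # ?ws)" by (simp add: contract_def)
  also have "\<dots> = of_nat (Suc m) * (\<sigma> [b, \<i> *s b] * wedge_power \<sigma> m ?ws -
      wedge (covec (\<lambda>w. \<sigma> [b, w])) (contract (\<i> *s b) (wedge_power \<sigma> m)) ?ws)"
    unfolding contract_wedge_power[OF two] wedge_covec_Cons ..
  also have "wedge (covec (\<lambda>w. \<sigma> [b, w])) (contract (\<i> *s b) (wedge_power \<sigma> m)) ?ws = 0"
    by (rule wedge_covec_eq_0) (auto simp: set_J_pairs v1 v3)
  finally have "wedge_power \<sigma> (Suc m) (J_pairs bs) = of_real (real (Suc m) * s) * wedge_power \<sigma> m ?ws"
    by (simp add: sb)
  then show ?case using IH s by (simp add: Suc.hyps(2)[symmetric] del: wedge_power.simps)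
qed

lemma volume_pos:
  fixes \<sigma> :: "(complex ^ 'n::finite) list \<Rightarrow> complex"
  assumes "pos11 \<sigma>" "m = CARD('n)"
  shows "Re (wedge_power \<sigma> m frame) > 0"
proof -
  obtain h :: "(complex ^ 'n) list \<Rightarrow> complex" where "alternating h" "h frame \<noteq> 0"
    using ex_volume_form by blast
  from wedge_power_J_pairs_pos[OF assms(1) this] show ?thesis
    by (simp add: length_frame_basis assms(2))
qed

lemma linear_eq_inner:
  fixes g :: "'v::euclidean_space \<Rightarrow> real"
  assumes "linear g" shows "g v = v \<bullet> (\<Sum>b\<in>Basis. g b *\<^sub>R b)"
proof -
  have "g v = g (\<Sum>b\<in>Basis. (v \<bullet> b) *\<^sub>R b)" by (simp add: euclidean_representation)
  also have "\<dots> = (\<Sum>b\<in>Basis. (v \<bullet> b) * g b)"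
    using assms by (simp add: linear_sum linear_scale)
  finally show ?thesis by (simp add: inner_sum_right mult.commute)
qed

lemma linear_Re: "linear f \<Longrightarrow> linear (\<lambda>v. Re (f v))"
  by (rule linearI) (simp_all add: linear_add linear_scale)

text \<open>Positivity makes \<open>u \<mapsto> \<sigma>(u, \<cdot>)\<close> injective, hence bijective onto the dual space.\<close>

lemma pos11_dual_vector:
  assumes pos: "pos11 \<sigma>"
  obtains u where "\<And>v. \<sigma> [u, v] = of_real (v \<bullet> x)"
proof -
  define L where "L u = (\<Sum>b\<in>Basis. Re (\<sigma> [u, b]) *\<^sub>R b)" for u
  note lin = alternating_pair[OF pos11D(1)[OF pos]]
  have L: "\<sigma> [u, v] = of_real (v \<bullet> L u)" for u v
    using linear_eq_inner[OF linear_Re[OF lin(2)[of u]], of v] real_valued_of_Re[OF pos11D(3)[OF pos]]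
    unfolding L_def by metis
  have "linear L"
    unfolding L_def
    by (intro linear_compose_sum ballI linearI)
      (simp_all add: linear_add[OF lin(1)] linear_scale[OF lin(1)] algebra_simps)
  moreover have "u = 0" if "L u = 0" for u
    using L[of u "\<i> *s u"] pos11D(5)[OF pos, of u] that by auto
  ultimately have "surj L"
    by (intro linear_injective_imp_surjective) (auto simp: linear_injective_0)
  then obtain u where "L u = x" by (metis surjD)
  with L show ?thesis by (intro that[of u]) simp
qed

text \<open>Up to a volume factor, the dual of \<open>\<sigma>\<^bsup>n-1\<^esup>\<close> is the inverse of \<open>\<sigma>\<close>, the analogue of
  \<open>adj H = det H \<cdot> H\<^sup>-\<^sup>1\<close> for matrices. The reason is that \<open>y\<^sup>* \<and> \<sigma>\<^sup>n\<close> has degree \<open>2n + 1\<close> and so vanishes; its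
  interior product with \<open>u\<close> is the difference of the two sides, since the interior product of \<open>\<sigma>\<^sup>n\<close>
  with \<open>u\<close> is \<open>n x\<^sup>* \<and> \<sigma>\<^bsup>n-1\<^esup>\<close>.\<close>

lemma star_wedge_power_pair:
  fixes \<sigma> :: "(complex ^ 'n::finite) list \<Rightarrow> complex"
  assumes "alternating \<sigma>" "two_form \<sigma>" "CARD('n) = Suc m" and u: "\<And>v. \<sigma> [u, v] = of_real (v \<bullet> x)"
  shows "of_nat (Suc m) * star (wedge_power \<sigma> m) [y, x] = of_real (u \<bullet> y) * wedge_power \<sigma> (Suc m) frame"
proof -
  have c: "contract u (wedge_power \<sigma> (Suc m)) = (\<lambda>vs. of_nat (Suc m) * wedge (inner_covec x) (wedge_power \<sigma> m) vs)"
    unfolding contract_wedge_power[OF assms(2)] u inner_covec_def ..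
  have "alternating (wedge (inner_covec y) (wedge_power \<sigma> (Suc m)))"
    by (intro alternating_wedge alternating_inner_covec alternating_wedge_power assms)
  then have "wedge (inner_covec y) (wedge_power \<sigma> (Suc m)) (u # frame) = 0"
    by (rule alternating_eq_0_if_length) (simp add: length_frame_basis)
  then have "of_real (u \<bullet> y) * wedge_power \<sigma> (Suc m) frame
      - wedge (inner_covec y) (contract u (wedge_power \<sigma> (Suc m))) frame = 0"
    by (simp only: inner_covec_def wedge_covec_Cons)
  then show ?thesis
    unfolding c wedge_scale_right star_pair by simp
qed

lemma wedge_power_J_invariant:
  assumes "pos11 \<sigma>" shows "wedge_power \<sigma> m (map ((*s) \<i>) vs) = wedge_power \<sigma> m vs"
proof -
  have "pull ((*s) \<i>) \<sigma> vs = \<sigma> vs" for vs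
  proof (cases "length vs = 2")
    case True
    then obtain u v where "vs = [u, v]"
      by (auto elim: length_2E)
    then show ?thesis using pos11D(4)[OF assms] by (simp add: pull_def)
  next
    case False
    then show ?thesis using pos11D(2)[OF assms] by (simp add: two_form_def pull_def)
  qed
  then have "pull ((*s) \<i>) \<sigma> = \<sigma>" by blast
  then have "pull ((*s) \<i>) (wedge_power \<sigma> m) = wedge_power \<sigma> m" by (simp add: pull_wedge_power)
  then show ?thesis by (simp add: pull_def fun_eq_iff)
qed

lemma pos11_star_wedge_power:
  fixes \<sigma> :: "(complex ^ 'n::finite) list \<Rightarrow> complex"
  assumes pos: "pos11 \<sigma>" and n: "CARD('n) = Suc m"
  shows "pos11 (star (wedge_power \<sigma> m))"
  unfolding pos11_def
proof (intro conjI allI impI)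
  note d = pos11D[OF pos]
  show "alternating (star (wedge_power \<sigma> m))" "two_form (star (wedge_power \<sigma> m))"
    by (rule alternating_star two_form_star)+
  show "real_valued (star (wedge_power \<sigma> m))"
    by (intro real_valued_star real_valued_wedge_power d)
  fix v :: "complex ^ 'n"
  show "star (wedge_power \<sigma> m) [\<i> *s u, \<i> *s v] = star (wedge_power \<sigma> m) [u, v]" for u
    by (intro star_J_invariant alternating_wedge_power d wedge_power_J_invariant pos)
  assume v: "v \<noteq> 0"
  obtain u where u: "\<And>w. \<sigma> [u, w] = of_real (w \<bullet> (\<i> *s v))"
    using pos11_dual_vector[OF pos] by blast
  have "u \<noteq> 0"
  proof
    assume "u = 0"
    then have "(\<i> *s v) \<bullet> (\<i> *s v) = 0"
      using u[of "\<i> *s v"] linear_0[OF alternating_pair(1)[OF d(1)]] by simp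
    with v show False by (simp only: inner_J_J inner_eq_zero_iff)
  qed
  then have "u \<bullet> v > 0"
    using u[of "\<i> *s u"] pos11D(5)[OF pos, of u] by simp
  moreover have "Re (of_nat (Suc m) * star (wedge_power \<sigma> m) [v, \<i> *s v])
      = (u \<bullet> v) * Re (wedge_power \<sigma> (Suc m) frame)"
    unfolding star_wedge_power_pair[OF d(1,2) n u] by simp
  ultimately have "real (Suc m) * Re (star (wedge_power \<sigma> m) [v, \<i> *s v]) > 0"
    using volume_pos[OF pos n[symmetric]] by (simp del: wedge_power.simps)
  then show "Re (star (wedge_power \<sigma> m) [v, \<i> *s v]) > 0"
    by (simp add: zero_less_mult_iff)
qed

lemma two_form_eqI:
  assumes "two_form \<sigma>" "two_form \<tau>" "\<And>u v. \<sigma> [u, v] = \<tau> [u, v]"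
  shows "\<sigma> = \<tau>"
proof
  fix vs show "\<sigma> vs = \<tau> vs"
  proof (cases "length vs = 2")
    case True
    then obtain u v where "vs = [u, v]"
      by (auto elim: length_2E)
    then show ?thesis using assms(3) by simp
  qed (use assms(1,2) in \<open>simp add: two_form_def\<close>)
qed

text \<open>Taking inverses twice: the construction \<open>\<sigma> \<mapsto> star \<sigma>\<^bsup>n-1\<^esup>\<close>, applied two times, returns \<open>\<sigma>\<close> up to the quotient of the volumes.\<close>

lemma star_star_wedge_power:
  fixes \<sigma> :: "(complex ^ 'n::finite) list \<Rightarrow> complex"
  assumes pos: "pos11 \<sigma>" and n: "CARD('n) = Suc m" and \<tau>: "\<tau> = star (wedge_power \<sigma> m)"
  shows "star (wedge_power \<tau> m) = (\<lambda>vs. of_real (Re (wedge_power \<tau> (Suc m) frame) / Re (wedge_power \<sigma> (Suc m) frame)) * \<sigma> vs)"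
proof (rule two_form_eqI[OF two_form_star])
  note d = pos11D[OF pos]
  have pos': "pos11 \<tau>" unfolding \<tau> by (rule pos11_star_wedge_power[OF pos n])
  note d' = pos11D[OF pos']
  show "two_form (\<lambda>vs. of_real (Re (wedge_power \<tau> (Suc m) frame) / Re (wedge_power \<sigma> (Suc m) frame)) * \<sigma> vs)"
    using d(2) by (simp add: two_form_def)
  fix w x :: "complex ^ 'n"
  define D where "D = Re (wedge_power \<sigma> (Suc m) frame) / real (Suc m)"
  have D: "D > 0" unfolding D_def using volume_pos[OF pos n[symmetric]] by (simp del: wedge_power.simps)
  have cD: "wedge_power \<sigma> (Suc m) frame = of_real (real (Suc m) * D)"
    unfolding D_def using real_valued_of_Re[OF real_valued_wedge_power[OF d(3)]] by (simp del: wedge_power.simps of_nat_Suc)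
  \<comment> \<open>the vector dual to \<open>\<sigma>(\<cdot>, x) / D\<close>; it turns out to be the \<open>\<tau>\<close>-dual of \<open>x\<close>\<close>
  define y where "y = (\<Sum>b\<in>Basis. (Re (\<sigma> [b, x]) / D) *\<^sub>R b)"
  have "linear (\<lambda>v. Re (\<sigma> [v, x]) / D)"
    using linear_add[OF linear_Re[OF alternating_pair(1)[OF d(1), of x]]]
      linear_scale[OF linear_Re[OF alternating_pair(1)[OF d(1), of x]]]
    by (intro linearI) (simp_all add: add_divide_distrib)
  then have y: "Re (\<sigma> [v, x]) / D = v \<bullet> y" for v
    unfolding y_def by (rule linear_eq_inner)
  have \<tau>y: "\<tau> [y, v] = of_real (v \<bullet> x)" for v
  proof -
    obtain u where u: "\<And>w. \<sigma> [u, w] = of_real (w \<bullet> v)"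
      using pos11_dual_vector[OF pos] by blast
    have "of_nat (Suc m) * \<tau> [y, v] = of_nat (Suc m) * of_real ((u \<bullet> y) * D)"
      unfolding \<tau> star_wedge_power_pair[OF d(1,2) n u] cD by simp
    then have "\<tau> [y, v] = of_real ((u \<bullet> y) * D)"
      by (simp only: mult_cancel_left of_nat_eq_0_iff) simp
    also have "(u \<bullet> y) * D = v \<bullet> x"
      using D y[of u] u[of x] by (simp add: field_simps inner_commute)
    finally show ?thesis .
  qed
  have "of_nat (Suc m) * star (wedge_power \<tau> m) [w, x] = of_real (y \<bullet> w) * wedge_power \<tau> (Suc m) frame"
    by (rule star_wedge_power_pair[OF d'(1,2) n \<tau>y])
  also have "\<dots> = of_nat (Suc m) * (of_real (Re (wedge_power \<tau> (Suc m) frame) / Re (wedge_power \<sigma> (Suc m) frame)) * \<sigma> [w, x])"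
  proof -
    have "wedge_power \<tau> (Suc m) frame = of_real (Re (wedge_power \<tau> (Suc m) frame))"
      by (simp only: real_valued_of_Re[OF real_valued_wedge_power[OF d'(3)]])
    moreover have "\<sigma> [w, x] = of_real (Re (\<sigma> [w, x]))"
      by (simp only: real_valued_of_Re[OF d(3)])
    moreover have "(y \<bullet> w) * Re (wedge_power \<tau> (Suc m) frame) = real (Suc m) *
      (Re (wedge_power \<tau> (Suc m) frame) / Re (wedge_power \<sigma> (Suc m) frame) * Re (\<sigma> [w, x]))"
      using D y[of w] by (simp add: D_def inner_commute field_simps del: wedge_power.simps of_nat_Suc)
    ultimately show ?thesis
      by (metis of_real_mult of_real_of_nat_eq)
  qed
  finally show "star (wedge_power \<tau> m) [w, x]
      = of_real (Re (wedge_power \<tau> (Suc m) frame) / Re (wedge_power \<sigma> (Suc m) frame)) * \<sigma> [w, x]"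
    by (simp only: mult_cancel_left of_nat_eq_0_iff) simp
qed

text \<open>The root of a positive \<open>f\<close> of bidegree \<open>(n-1, n-1)\<close>, with \<open>m = n - 1\<close>. The form \<open>\<gamma>\<close> is proportional to the
  inverse of \<open>star f\<close> and \<open>\<gamma>\<^sup>m\<close> is \<open>f\<close> times the quotient of volumes, whose \<open>m\<close>-th root is removed by the
  scalar. All steps are polynomial in the coefficients of \<open>f\<close>, except for the power of a positive number:
  this is why the root of a smooth form is smooth.\<close>

definition root_form :: "nat \<Rightarrow> ((complex ^ 'n::finite) list \<Rightarrow> complex) \<Rightarrow> (complex ^ 'n) list \<Rightarrow> complex"
  where "root_form m f = (let \<tau> = star f; \<gamma> = star (wedge_power \<tau> m) in
    (\<lambda>vs. of_real ((Re (wedge_power \<gamma> (Suc m) frame) / Re (wedge_power \<tau> (Suc m) frame)) powr (- 1 / m)) * \<gamma> vs))"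

lemma pos11_scale:
  assumes "pos11 \<sigma>" "c > 0" shows "pos11 (\<lambda>vs. complex_of_real c * \<sigma> vs)"
  using assms unfolding pos11_def two_form_def real_valued_def
  by (auto intro!: alternating_scale)

lemma powr_root_power: "(c powr (- 1 / real m)) ^ m = 1 / c" if "c > 0" "m \<ge> 1"
proof -
  have "(c powr (- 1 / real m)) ^ m = c powr (real m * (- 1 / real m))"
    using that by (intro powr_power) auto
  also have "real m * (- 1 / real m) = - 1" using that by simp
  finally show ?thesis using that by (simp add: powr_minus_divide)
qed

text \<open>By \<open>star_star_wedge_power\<close> for \<open>\<tau> = star f\<close>, the dual of \<open>\<gamma>\<^sup>m\<close> is a multiple of the dual of \<open>f\<close>, and
  \<open>star\<close> is injective.\<close>

lemma root_form:
  fixes f :: "(complex ^ 'n::finite) list \<Rightarrow> complex"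
  assumes n: "CARD('n) = Suc m" and m: "m \<ge> 1" and alt: "alternating f"
    and len: "\<And>vs. length vs \<noteq> 2 * m \<Longrightarrow> f vs = 0" and pos: "pos11 (star f)"
  shows "pos11 (root_form m f)" "wedge_power (root_form m f) m = f"
proof -
  define \<tau> where "\<tau> = star f"
  define \<gamma> where "\<gamma> = star (wedge_power \<tau> m)"
  define c where "c = Re (wedge_power \<gamma> (Suc m) frame) / Re (wedge_power \<tau> (Suc m) frame)"
  have p: "pos11 \<tau>" "pos11 \<gamma>" unfolding \<gamma>_def using pos pos11_star_wedge_power[OF _ n] by (auto simp: \<tau>_def)
  have c: "c > 0" unfolding c_def using volume_pos[OF p(1) n[symmetric]] volume_pos[OF p(2) n[symmetric]]
    by (rule divide_pos_pos[rotated])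
  have r: "root_form m f = (\<lambda>vs. of_real (c powr (- 1 / real m)) * \<gamma> vs)"
    by (simp add: root_form_def Let_def \<tau>_def \<gamma>_def c_def)
  show "pos11 (root_form m f)" unfolding r by (rule pos11_scale[OF p(2)]) (use c in simp)
  have "star (wedge_power \<gamma> m) = (\<lambda>vs. of_real c * \<tau> vs)"
    using star_star_wedge_power[OF p(1) n \<gamma>_def] by (simp only: c_def)
  then have 0: "star (\<lambda>vs. wedge_power \<gamma> m vs + - of_real c * f vs) vs = 0" for vs
    by (simp only: star_add star_scale) (simp add: \<tau>_def)
  have "wedge_power \<gamma> m vs + - of_real c * f vs = 0" for vs
  proof (rule star_injective[OF _ n _ 0])
    show "alternating (\<lambda>vs. wedge_power \<gamma> m vs + - of_real c * f vs)"
      by (intro alternating_add alternating_scale alternating_wedge_power alt pos11D(1)[OF p(2)])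
  qed (simp add: len wedge_power_eq_0_if_length[OF pos11D(2)[OF p(2)]])
  then have *: "wedge_power \<gamma> m vs = of_real c * f vs" for vs by (simp add: add_eq_0_iff)
  show "wedge_power (root_form m f) m = f"
  proof
    fix vs
    have "wedge_power (root_form m f) m vs = of_real ((c powr (- 1 / real m)) ^ m * c) * f vs"
      unfolding r wedge_power_scale * by simp
    also have "(c powr (- 1 / real m)) ^ m * c = 1"
      using powr_root_power[OF c m] c by simp
    finally show "wedge_power (root_form m f) m vs = f vs" by simp
  qed
qed

text \<open>Uniqueness of the root: the \<open>\<gamma>\<close> made from \<open>\<sigma>\<^sup>m\<close> is a multiple \<open>b \<sigma>\<close>, and the
  two expressions for \<open>star \<gamma>\<^sup>m\<close> show that the volume quotient is \<open>b\<^sup>m\<close>.\<close>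

lemma root_form_wedge_power:
  fixes \<sigma> :: "(complex ^ 'n::finite) list \<Rightarrow> complex"
  assumes n: "CARD('n) = Suc m" and m: "m \<ge> 1" and pos: "pos11 \<sigma>"
  shows "root_form m (wedge_power \<sigma> m) = \<sigma>"
proof -
  define \<tau> where "\<tau> = star (wedge_power \<sigma> m)"
  define \<gamma> where "\<gamma> = star (wedge_power \<tau> m)"
  define c where "c = Re (wedge_power \<gamma> (Suc m) frame) / Re (wedge_power \<tau> (Suc m) frame)"
  define b where "b = Re (wedge_power \<tau> (Suc m) frame) / Re (wedge_power \<sigma> (Suc m) frame)"
  have p: "pos11 \<tau>" "pos11 \<gamma>" unfolding \<tau>_def \<gamma>_def
    by (intro pos11_star_wedge_power pos n)+
  have b: "b > 0" unfolding b_def using volume_pos[OF pos n[symmetric]] volume_pos[OF p(1) n[symmetric]]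
    by (rule divide_pos_pos[rotated])
  have \<gamma>: "\<gamma> = (\<lambda>vs. of_real b * \<sigma> vs)"
    using star_star_wedge_power[OF pos n \<tau>_def] by (simp only: \<gamma>_def b_def)
  have "star (wedge_power \<gamma> m) = (\<lambda>vs. of_real c * \<tau> vs)"
    using star_star_wedge_power[OF p(1) n \<gamma>_def] by (simp only: c_def)
  moreover have "wedge_power \<gamma> m = (\<lambda>vs. of_real (b ^ m) * wedge_power \<sigma> m vs)"
    unfolding \<gamma> by (simp add: wedge_power_scale fun_eq_iff)
  ultimately have "of_real (b ^ m) * \<tau> vs = of_real c * \<tau> vs" for vs
    by (simp only: \<tau>_def star_scale fun_eq_iff)
  moreover have "Re (\<tau> [axis undefined 1, \<i> *s axis undefined 1]) > 0"
    by (rule pos11D(5)[OF p(1)]) simp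
  then have "\<tau> [axis undefined 1, \<i> *s axis undefined 1] \<noteq> 0" by auto
  ultimately have "c = b ^ m"
    by (metis mult_cancel_right of_real_eq_iff)
  then have "c powr (- 1 / real m) * b = 1"
    using b m by (simp add: powr_powr powr_minus flip: powr_realpow)
  then have "of_real (c powr (- 1 / real m)) * (of_real b * z) = z" for z :: complex
    by (metis mult.assoc mult_1 of_real_1 of_real_mult)
  moreover have "root_form m (wedge_power \<sigma> m) = (\<lambda>vs. of_real (c powr (- 1 / real m)) * \<gamma> vs)"
    by (simp add: root_form_def Let_def \<tau>_def \<gamma>_def c_def)
  ultimately show ?thesis by (simp only: \<gamma>)
qed

section \<open>Smooth functions and smooth families of covectors\<close>

lemma Ck_on_SucD:
  assumes "open S" "Ck_on (Suc k) S f" "x \<in> S"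
  shows "(f has_derivative frechet_derivative f (at x)) (at x)"
  using assms by (auto simp: differentiable_on_eq_differentiable_at frechet_derivative_works)

lemma Ck_on_cong:
  assumes "open S" "\<And>x. x \<in> S \<Longrightarrow> f x = g x" "Ck_on k S f"
  shows "Ck_on k S g"
  using assms(2,3)
proof (induction k arbitrary: f g)
  case 0
  then show ?case using continuous_on_eq[of S f g] by simp
next
  case (Suc k)
  have d: "f differentiable (at x)" if "x \<in> S" for x
    using Suc.prems(2) assms(1) that by (simp add: differentiable_on_eq_differentiable_at)
  have e: "frechet_derivative f (at x) = frechet_derivative g (at x)" if "x \<in> S" for x
    using frechet_derivative_transform_within_open[OF d[OF that] assms(1) that Suc.prems(1)] .
  have "g differentiable (at x)" if "x \<in> S" for x
  proof -
    have "(f has_derivative frechet_derivative f (at x)) (at x)"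
      using d[OF that] by (simp add: frechet_derivative_works)
    from has_derivative_transform_within_open[OF this assms(1) that Suc.prems(1)]
    show ?thesis unfolding differentiable_def by blast
  qed
  moreover have "Ck_on k S (\<lambda>x. frechet_derivative g (at x) v)" for v
    by (rule Suc.IH[of "\<lambda>x. frechet_derivative f (at x) v"]) (use Suc.prems in \<open>simp_all add: e\<close>)
  ultimately show ?case
    using assms(1) by (simp add: differentiable_on_eq_differentiable_at)
qed

text \<open>Introduction with an explicit derivative, which need not be given as \<open>frechet_derivative\<close>.\<close>

lemma Ck_on_SucI:
  assumes "open S" "\<And>x. x \<in> S \<Longrightarrow> (f has_derivative f' x) (at x)" "\<And>v. Ck_on k S (\<lambda>x. f' x v)"
  shows "Ck_on (Suc k) S f"
proof -
  have "f' x = frechet_derivative f (at x)" if "x \<in> S" for x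
    using frechet_derivative_at[OF assms(2)[OF that]] .
  then have "Ck_on k S (\<lambda>x. frechet_derivative f (at x) v)" for v
    using Ck_on_cong[OF assms(1) _ assms(3)[of v]] by simp
  then show ?thesis
    using assms(1,2) by (auto simp: differentiable_on_eq_differentiable_at differentiable_def)
qed

lemma Ck_on_Suc_imp: "Ck_on (Suc k) S f \<Longrightarrow> Ck_on k S f"
proof (induction k arbitrary: f)
  case 0
  then show ?case by (simp add: differentiable_imp_continuous_on)
next
  case (Suc k)
  then show ?case by (metis Ck_on.simps(2))
qed

lemma Ck_on_const: "open S \<Longrightarrow> Ck_on k S (\<lambda>_. c)"
proof (induction k arbitrary: c)
  case (Suc k)
  show ?case
    by (rule Ck_on_SucI[where f' = "\<lambda>_ _. 0"]) (use Suc in auto)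
qed simp

lemma Ck_on_add: "open S \<Longrightarrow> Ck_on k S f \<Longrightarrow> Ck_on k S g \<Longrightarrow> Ck_on k S (\<lambda>x. f x + g x)"
proof (induction k arbitrary: f g)
  case 0
  then show ?case by (simp add: continuous_on_add)
next
  case (Suc k)
  show ?case
    by (rule Ck_on_SucI[OF Suc.prems(1)], rule has_derivative_add)
      (rule Ck_on_SucD[OF Suc.prems(1)], use Suc in auto)+
qed

lemma Ck_on_bounded_linear:
  assumes "bounded_linear h" "open S"
  shows "Ck_on k S f \<Longrightarrow> Ck_on k S (\<lambda>x. h (f x))"
proof (induction k arbitrary: f)
  case 0
  then show ?case by (simp add: bounded_linear.continuous_on[OF assms(1)])
next
  case (Suc k)
  show ?case
  proof (rule Ck_on_SucI[OF assms(2)])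
    fix x assume "x \<in> S"
    from bounded_linear.has_derivative[OF assms(1) Ck_on_SucD[OF assms(2) Suc.prems this]]
    show "((\<lambda>x. h (f x)) has_derivative (\<lambda>v. h (frechet_derivative f (at x) v))) (at x)" .
  qed (use Suc in auto)
qed

lemma Ck_on_mult:
  fixes f g :: "'v::real_normed_vector \<Rightarrow> 'w::real_normed_algebra"
  shows "open S \<Longrightarrow> Ck_on k S f \<Longrightarrow> Ck_on k S g \<Longrightarrow> Ck_on k S (\<lambda>x. f x * g x)"
proof (induction k arbitrary: f g)
  case 0
  then show ?case by (simp add: continuous_on_mult)
next
  case (Suc k)
  show ?case
  proof (rule Ck_on_SucI[OF Suc.prems(1)])
    fix x assume "x \<in> S"
    from has_derivative_mult[OF Ck_on_SucD[OF Suc.prems(1,2) this] Ck_on_SucD[OF Suc.prems(1,3) this]]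
    show "((\<lambda>x. f x * g x) has_derivative
        (\<lambda>v. f x * frechet_derivative g (at x) v + frechet_derivative f (at x) v * g x)) (at x)" .
  next
    fix v
    show "Ck_on k S (\<lambda>x. f x * frechet_derivative g (at x) v + frechet_derivative f (at x) v * g x)"
      using Suc.prems Ck_on_Suc_imp[OF Suc.prems(2)] Ck_on_Suc_imp[OF Suc.prems(3)]
      by (intro Ck_on_add Suc.IH) auto
  qed
qed

text \<open>The derivative contains the power with exponent \<open>a - 1\<close>, so the induction is over all exponents at once.\<close>

lemma Ck_on_powr:
  fixes f :: "'v::real_normed_vector \<Rightarrow> real"
  assumes "open S" "\<And>x. x \<in> S \<Longrightarrow> f x > 0"
  shows "Ck_on k S f \<Longrightarrow> Ck_on k S (\<lambda>x. f x powr a)"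
proof (induction k arbitrary: a)
  case 0
  have "\<forall>x\<in>S. f x \<noteq> 0" using assms(2) by force
  with 0 show ?case by (auto intro!: continuous_on_powr)
next
  case (Suc k)
  show ?case
  proof (rule Ck_on_SucI[OF assms(1)])
    fix x assume x: "x \<in> S"
    show "((\<lambda>x. f x powr a) has_derivative
        (\<lambda>v. frechet_derivative f (at x) v * (a * f x powr (a - 1)))) (at x)"
      by (rule DERIV_compose_FDERIV[OF has_real_derivative_powr[OF assms(2)[OF x]]
            Ck_on_SucD[OF assms(1) Suc.prems x]])
  next
    fix v
    show "Ck_on k S (\<lambda>x. frechet_derivative f (at x) v * (a * f x powr (a - 1)))"
      using Suc.prems Suc.IH[OF Ck_on_Suc_imp[OF Suc.prems]]
      by (intro Ck_on_mult Ck_on_const assms(1)) auto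
  qed
qed

lemma smooth_on_const: "open S \<Longrightarrow> smooth_on S (\<lambda>_. c)"
  by (simp add: smooth_on_def Ck_on_const)

lemma smooth_on_add: "open S \<Longrightarrow> smooth_on S f \<Longrightarrow> smooth_on S g \<Longrightarrow> smooth_on S (\<lambda>x. f x + g x)"
  by (simp add: smooth_on_def Ck_on_add)

lemma smooth_on_mult:
  fixes f g :: "'v::real_normed_vector \<Rightarrow> 'w::real_normed_algebra"
  shows "open S \<Longrightarrow> smooth_on S f \<Longrightarrow> smooth_on S g \<Longrightarrow> smooth_on S (\<lambda>x. f x * g x)"
  by (simp add: smooth_on_def Ck_on_mult)

lemma smooth_on_bounded_linear:
  "bounded_linear h \<Longrightarrow> open S \<Longrightarrow> smooth_on S f \<Longrightarrow> smooth_on S (\<lambda>x. h (f x))"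
  by (simp add: smooth_on_def Ck_on_bounded_linear)

lemma smooth_on_powr:
  fixes f :: "'v::real_normed_vector \<Rightarrow> real"
  shows "open S \<Longrightarrow> (\<And>x. x \<in> S \<Longrightarrow> f x > 0) \<Longrightarrow> smooth_on S f \<Longrightarrow> smooth_on S (\<lambda>x. f x powr a)"
  by (simp add: smooth_on_def Ck_on_powr)

lemma smooth_on_cong:
  "open S \<Longrightarrow> (\<And>x. x \<in> S \<Longrightarrow> f x = g x) \<Longrightarrow> smooth_on S f \<Longrightarrow> smooth_on S g"
  unfolding smooth_on_def by (metis Ck_on_cong)

lemma smooth_on_sum:
  "open S \<Longrightarrow> (\<And>i. i \<in> I \<Longrightarrow> smooth_on S (f i)) \<Longrightarrow> smooth_on S (\<lambda>x. \<Sum>i\<in>I. f i x)"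
  by (induction I rule: infinite_finite_induct) (simp_all add: smooth_on_const smooth_on_add)

lemma smooth_on_divide:
  fixes f g :: "'v::real_normed_vector \<Rightarrow> real"
  assumes "open S" "\<And>x. x \<in> S \<Longrightarrow> g x > 0" "smooth_on S f" "smooth_on S g"
  shows "smooth_on S (\<lambda>x. f x / g x)"
proof (rule smooth_on_cong[OF assms(1)])
  show "smooth_on S (\<lambda>x. f x * g x powr (- 1))"
    by (intro smooth_on_mult smooth_on_powr assms)
  show "f x * g x powr (- 1) = f x / g x" if "x \<in> S" for x
    using assms(2)[OF that] by (simp add: powr_minus_divide)
qed

lemma smooth_on_imp_differentiable:
  assumes "open S" "smooth_on S f" "x \<in> S" shows "f differentiable (at x)"
  using assms(2)[unfolded smooth_on_def, rule_format, of "Suc 0"] assms(1,3)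
  by (simp add: differentiable_on_eq_differentiable_at)

lemma smooth_on_imp_continuous: "smooth_on S f \<Longrightarrow> continuous_on S f"
  unfolding smooth_on_def by (metis Ck_on.simps(1))

lemma smooth_on_frechet_derivative:
  assumes "smooth_on S f" shows "smooth_on S (\<lambda>x. frechet_derivative f (at x) v)"
  using assms unfolding smooth_on_def by (metis Ck_on.simps(2))

definition smooth_family :: "'v::real_normed_vector set \<Rightarrow> ('v \<Rightarrow> 'u list \<Rightarrow> complex) \<Rightarrow> bool"
  where "smooth_family S F \<longleftrightarrow> (\<forall>vs. smooth_on S (\<lambda>z. F z vs))"

lemma smooth_family_wedge:
  assumes "open S" "smooth_family S F" "smooth_family S G"
  shows "smooth_family S (\<lambda>z. wedge (F z) (G z))"
  using assms unfolding smooth_family_def wedge_def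
  by (intro allI smooth_on_sum smooth_on_mult smooth_on_const) auto

lemma smooth_family_const: "open S \<Longrightarrow> smooth_family S (\<lambda>_. f)"
  by (simp add: smooth_family_def smooth_on_const)

lemma smooth_family_wedge_power:
  assumes "open S" "smooth_family S F"
  shows "smooth_family S (\<lambda>z. wedge_power (F z) m)"
  by (induction m) (simp_all add: smooth_family_const smooth_family_wedge assms)

lemma smooth_family_star:
  assumes "open S" "smooth_family S F"
  shows "smooth_family S (\<lambda>z. star (F z))"
proof -
  have "smooth_family S (\<lambda>z. wedge (inner_covec u) (wedge (inner_covec v) (F z)))" for u v
    by (intro smooth_family_wedge smooth_family_const assms)
  then have "smooth_on S (\<lambda>z. star (F z) vs)" for vs
    by (cases "length vs = 2") (simp_all add: smooth_family_def star_def smooth_on_const assms(1))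
  then show ?thesis by (simp add: smooth_family_def)
qed

lemma smooth_family_root_form:
  fixes F :: "'v::real_normed_vector \<Rightarrow> (complex ^ 'n::finite) list \<Rightarrow> complex"
  assumes S: "open S" and F: "smooth_family S F" and n: "CARD('n) = Suc m"
    and pos: "\<And>z. z \<in> S \<Longrightarrow> pos11 (star (F z))"
  shows "smooth_family S (\<lambda>z. root_form m (F z))"
proof -
  define T where "T z = star (F z)" for z
  define G where "G z = star (wedge_power (T z) m)" for z
  have s: "smooth_family S T" "smooth_family S G"
    unfolding T_def G_def by (intro smooth_family_star smooth_family_wedge_power S F)+
  have v: "smooth_on S (\<lambda>z. Re (wedge_power (T z) (Suc m) frame))" "smooth_on S (\<lambda>z. Re (wedge_power (G z) (Suc m) frame))"
    using smooth_family_wedge_power[OF S s(1), of "Suc m"] smooth_family_wedge_power[OF S s(2), of "Suc m"]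
    unfolding smooth_family_def
    by (intro smooth_on_bounded_linear[OF bounded_linear_Re S]; blast)+
  have p: "pos11 (T z)" "pos11 (G z)" if "z \<in> S" for z
    using pos[OF that] pos11_star_wedge_power[OF _ n] by (auto simp: G_def T_def)
  have vp: "Re (wedge_power (T z) (Suc m) frame) > 0" "Re (wedge_power (G z) (Suc m) frame) > 0" if "z \<in> S" for z
    using volume_pos[OF p(1)[OF that] n[symmetric]] volume_pos[OF p(2)[OF that] n[symmetric]] by blast+
  have "smooth_on S (\<lambda>z. complex_of_real ((Re (wedge_power (G z) (Suc m) frame) / Re (wedge_power (T z) (Suc m) frame))
      powr (- 1 / m)) * G z vs)" for vs
    using s(2) vp
    by (intro smooth_on_mult smooth_on_bounded_linear[OF bounded_linear_of_real] smooth_on_powr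
        smooth_on_divide S v divide_pos_pos) (auto simp: smooth_family_def)
  then show ?thesis
    by (simp add: smooth_family_def root_form_def Let_def T_def G_def)
qed

section \<open>Smooth forms on a complex manifold\<close>

abbreviation dtrans :: "('a, 'n::finite) chart \<Rightarrow> ('a, 'n) chart \<Rightarrow> complex ^ 'n \<Rightarrow> complex ^ 'n \<Rightarrow> complex ^ 'n"
  where "dtrans c c' z \<equiv> frechet_derivative (transition c c') (at z)"

text \<open>What the calculus of forms needs from a complex manifold: the charts have open images and the
  derivatives of the transition maps are complex linear.\<close>

locale complex_atlas =
  fixes A :: "('a, 'n::finite) chart set"
  assumes open_chart: "c \<in> A \<Longrightarrow> open (chart_image c)"
    and transition_in: "c \<in> A \<Longrightarrow> c' \<in> A \<Longrightarrow> z \<in> overlap c c' \<Longrightarrow> transition c c' z \<in> chart_image c'"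
    and linear_dtrans: "c \<in> A \<Longrightarrow> c' \<in> A \<Longrightarrow> z \<in> overlap c c' \<Longrightarrow> linear (dtrans c c' z)"
    and dtrans_smult: "c \<in> A \<Longrightarrow> c' \<in> A \<Longrightarrow> z \<in> overlap c c' \<Longrightarrow> dtrans c c' z (a *s v) = a *s dtrans c c' z v"

lemma overlap_subset: "overlap c c' \<subseteq> chart_image c"
  by (auto simp: overlap_def)

lemma chart_injective:
  assumes "complex_manifold X A" "c \<in> A" shows "inj_on (snd c) (fst c)"
proof -
  have "homeomorphic_map (subtopology X (fst c)) (top_of_set (chart_image c)) (snd c)" "openin X (fst c)"
    using assms unfolding complex_manifold_def by blast+
  moreover from this(2) have "topspace (subtopology X (fst c)) = fst c"
    using openin_subset[of X "fst c"] by auto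
  ultimately show ?thesis
    using homeomorphic_imp_injective_map by metis
qed

lemma transition_chart:
  assumes "complex_manifold X A" "c \<in> A" "p \<in> fst c"
  shows "transition c c' (snd c p) = snd c' p"
  using chart_injective[OF assms(1,2)] assms(3) by (simp add: transition_def)

lemma complex_manifold_atlas:
  fixes A :: "('a, 'n::finite) chart set"
  assumes "complex_manifold X A" shows "complex_atlas A"
proof (rule complex_atlas.intro)
  note M = assms[unfolded complex_manifold_def]
  fix c c' :: "('a, 'n) chart" and z assume c: "c \<in> A" "c' \<in> A" and z: "z \<in> overlap c c'"
  show "transition c c' z \<in> chart_image c'"
  proof -
    obtain p where "z = snd c p" "p \<in> fst c" "p \<in> fst c'" using z by (auto simp: overlap_def)
    then show ?thesis using transition_chart[OF assms c(1), of p c'] by simp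
  qed
  obtain D where D: "(transition c c' has_derivative D) (at z)" "\<And>a v. D (a *s v) = a *s D v"
    using M c z unfolding holomorphic_map_on_def by meson
  have "D = dtrans c c' z" by (rule frechet_derivative_at[OF D(1)])
  with D show "linear (dtrans c c' z)"
    using has_derivative_linear by blast
  show "dtrans c c' z (a *s v) = a *s dtrans c c' z v" for a v
    using D(2) \<open>D = dtrans c c' z\<close> by simp
qed (use assms in \<open>auto simp: complex_manifold_def\<close>)

lemma smooth_form_alt:
  "smooth_form A \<alpha> \<longleftrightarrow>
    (\<forall>c z. \<not> (c \<in> A \<and> z \<in> chart_image c) \<longrightarrow> \<alpha> c z = (\<lambda>_. 0)) \<and>
    (\<forall>c\<in>A. \<forall>z\<in>chart_image c. alternating (\<alpha> c z)) \<and>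
    (\<forall>c\<in>A. smooth_family (chart_image c) (\<alpha> c)) \<and>
    (\<forall>c\<in>A. \<forall>c'\<in>A. \<forall>z\<in>overlap c c'. \<alpha> c z = pull (dtrans c c' z) (\<alpha> c' (transition c c' z)))"
  unfolding smooth_form_def smooth_family_def pull_def fun_eq_iff by blast

lemma smooth_formD:
  assumes "smooth_form A \<alpha>"
  shows "\<not> (c \<in> A \<and> z \<in> chart_image c) \<Longrightarrow> \<alpha> c z = (\<lambda>_. 0)"
    and "c \<in> A \<Longrightarrow> z \<in> chart_image c \<Longrightarrow> alternating (\<alpha> c z)"
    and "c \<in> A \<Longrightarrow> smooth_family (chart_image c) (\<alpha> c)"
    and "c \<in> A \<Longrightarrow> c' \<in> A \<Longrightarrow> z \<in> overlap c c' \<Longrightarrow>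
      \<alpha> c z = pull (dtrans c c' z) (\<alpha> c' (transition c c' z))"
  using assms unfolding smooth_form_alt by blast+

definition cscale :: "complex \<Rightarrow> ('a, 'n::finite) form \<Rightarrow> ('a, 'n) form"
  where "cscale a \<alpha> = (\<lambda>c z vs. a * \<alpha> c z vs)"

text \<open>The action of a scalar on the tangent vectors. A form of bidegree \<open>(p,q)\<close> is an eigenvector with
  eigenvalue \<open>a\<^sup>p (cnj a)\<^sup>q\<close>, so finite linear combinations of these operators separate bidegrees.\<close>

definition rot :: "complex \<Rightarrow> ('a, 'n::finite) form \<Rightarrow> ('a, 'n) form"
  where "rot a \<alpha> = (\<lambda>c z. pull ((*s) a) (\<alpha> c z))"

definition deg_part :: "nat \<Rightarrow> ('a, 'n::finite) form \<Rightarrow> ('a, 'n) form"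
  where "deg_part k \<alpha> = (\<lambda>c z vs. if length vs = k then \<alpha> c z vs else 0)"

lemma scale_form_eq_cscale: "scale_form t = cscale (of_real t)"
  by (simp add: scale_form_def cscale_def fun_eq_iff)

context complex_atlas
begin

text \<open>Operations on covectors that commute with pull-back and preserve smoothness induce operations on forms.\<close>

lemma smooth_form_map:
  assumes \<alpha>: "smooth_form A \<alpha>" and 0: "\<Phi> (\<lambda>_. 0) = (\<lambda>_. 0)"
    and alt: "\<And>c z. c \<in> A \<Longrightarrow> z \<in> chart_image c \<Longrightarrow> alternating (\<Phi> (\<alpha> c z))"
    and sm: "\<And>c. c \<in> A \<Longrightarrow> smooth_family (chart_image c) (\<lambda>z. \<Phi> (\<alpha> c z))"
    and pull: "\<And>c c' z. c \<in> A \<Longrightarrow> c' \<in> A \<Longrightarrow> z \<in> overlap c c' \<Longrightarrow>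
      \<Phi> (pull (dtrans c c' z) (\<alpha> c' (transition c c' z)))
        = pull (dtrans c c' z) (\<Phi> (\<alpha> c' (transition c c' z)))"
  shows "smooth_form A (\<lambda>c z. \<Phi> (\<alpha> c z))"
  unfolding smooth_form_alt
proof (intro conjI allI impI ballI)
  fix c z assume "\<not> (c \<in> A \<and> z \<in> chart_image c)"
  from smooth_formD(1)[OF \<alpha> this] show "\<Phi> (\<alpha> c z) = (\<lambda>_. 0)" by (simp add: 0)
next
  fix c c' z assume c: "c \<in> A" "c' \<in> A" "z \<in> overlap c c'"
  show "\<Phi> (\<alpha> c z) = pull (dtrans c c' z) (\<Phi> (\<alpha> c' (transition c c' z)))"
    unfolding pull[OF c, symmetric] smooth_formD(4)[OF \<alpha> c] ..
qed (auto intro: alt sm)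

lemma smooth_form_zero: "smooth_form A 0"
  by (auto simp: smooth_form_def alternating_zero linear_zero alternating_def smooth_on_const open_chart)

lemma smooth_form_add:
  assumes "smooth_form A \<alpha>" "smooth_form A \<beta>" shows "smooth_form A (\<alpha> + \<beta>)"
  unfolding smooth_form_alt
proof (intro conjI allI impI ballI)
  fix c z assume "\<not> (c \<in> A \<and> z \<in> chart_image c)"
  from smooth_formD(1)[OF assms(1) this] smooth_formD(1)[OF assms(2) this]
  show "(\<alpha> + \<beta>) c z = (\<lambda>_. 0)" by (simp add: fun_eq_iff)
next
  fix c z assume "c \<in> A" "z \<in> chart_image c"
  then show "alternating ((\<alpha> + \<beta>) c z)"
    using alternating_add[OF smooth_formD(2)[OF assms(1)] smooth_formD(2)[OF assms(2)]]
    by (simp add: plus_fun_def)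
next
  fix c assume "c \<in> A"
  then show "smooth_family (chart_image c) ((\<alpha> + \<beta>) c)"
    using smooth_formD(3)[OF assms(1)] smooth_formD(3)[OF assms(2)]
    by (simp add: smooth_family_def smooth_on_add open_chart)
next
  fix c c' z assume c: "c \<in> A" "c' \<in> A" "z \<in> overlap c c'"
  show "(\<alpha> + \<beta>) c z = pull (dtrans c c' z) ((\<alpha> + \<beta>) c' (transition c c' z))"
    unfolding plus_fun_apply smooth_formD(4)[OF assms(1) c] smooth_formD(4)[OF assms(2) c]
    by (simp add: pull_def fun_eq_iff)
qed

lemma smooth_form_cscale:
  assumes "smooth_form A \<alpha>" shows "smooth_form A (cscale a \<alpha>)"
  unfolding cscale_def
  by (rule smooth_form_map[OF assms, of "\<lambda>f vs. a * f vs"])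
    (use smooth_formD[OF assms] in \<open>auto simp: smooth_family_def pull_def
      intro!: alternating_scale smooth_on_mult smooth_on_const open_chart\<close>)

lemma smooth_form_conj:
  assumes "smooth_form A \<alpha>" shows "smooth_form A (conj_form \<alpha>)"
  unfolding conj_form_def
proof (rule smooth_form_map[OF assms, of "\<lambda>f vs. cnj (f vs)"])
  fix c z assume "c \<in> A" "z \<in> chart_image c"
  note a = smooth_formD(2)[OF assms this]
  show "alternating (\<lambda>vs. cnj (\<alpha> c z vs))"
    unfolding alternating_def
  proof (intro conjI allI impI)
    fix us ws show "linear (\<lambda>v. cnj (\<alpha> c z (us @ v # ws)))"
      using linear_compose[OF alternating_linear[OF a, of us ws] bounded_linear.linear[OF bounded_linear_cnj]]
      by (simp add: o_def)
  qed (simp add: alternating_not_distinct[OF a])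
qed (use smooth_formD(3)[OF assms] in \<open>auto simp: smooth_family_def pull_def
      intro!: smooth_on_bounded_linear[OF bounded_linear_cnj] open_chart\<close>)

lemma smooth_form_rot:
  assumes "smooth_form A \<alpha>" shows "smooth_form A (rot a \<alpha>)"
  unfolding rot_def
proof (rule smooth_form_map[OF assms, of "pull ((*s) a)"])
  fix c z assume "c \<in> A" "z \<in> chart_image c"
  then show "alternating (pull ((*s) a) (\<alpha> c z))"
    by (intro alternating_pull linear_vector_smult smooth_formD(2)[OF assms])
next
  fix c assume "c \<in> A"
  then show "smooth_family (chart_image c) (\<lambda>z. pull ((*s) a) (\<alpha> c z))"
    using smooth_formD(3)[OF assms] by (simp add: smooth_family_def pull_def)
qed (simp_all add: pull_def o_def dtrans_smult)

lemma smooth_form_deg_part: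
  assumes "smooth_form A \<alpha>" shows "smooth_form A (deg_part k \<alpha>)"
  unfolding deg_part_def
proof (rule smooth_form_map[OF assms, of "\<lambda>f vs. if length vs = k then f vs else 0"])
  fix c z assume "c \<in> A" "z \<in> chart_image c"
  note a = smooth_formD(2)[OF assms this]
  show "alternating (\<lambda>vs. if length vs = k then \<alpha> c z vs else 0)"
    unfolding alternating_def
  proof (intro conjI allI impI)
    fix us ws show "linear (\<lambda>v. if length (us @ v # ws) = k then \<alpha> c z (us @ v # ws) else 0)"
      using alternating_linear[OF a, of us ws]
      by (cases "Suc (length us + length ws) = k") (simp_all add: linear_zero)
  qed (simp add: alternating_not_distinct[OF a])
next
  fix c assume c: "c \<in> A"
  show "smooth_family (chart_image c) (\<lambda>z vs. if length vs = k then \<alpha> c z vs else 0)"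
    unfolding smooth_family_def
  proof
    fix vs show "smooth_on (chart_image c) (\<lambda>z. if length vs = k then \<alpha> c z vs else 0)"
      using smooth_formD(3)[OF assms c] open_chart[OF c]
      by (cases "length vs = k") (auto simp: smooth_family_def smooth_on_const)
  qed
qed (auto simp: pull_def fun_eq_iff)

end

section \<open>The operators del and delbar\<close>

text \<open>The complex linear (\<open>s = -1\<close>) and antilinear (\<open>s = 1\<close>) part of the differential, so that each fact
  about del and delbar is proved once.\<close>

definition wirtinger_part :: "complex \<Rightarrow> (complex ^ 'n::finite \<Rightarrow> complex) \<Rightarrow> complex ^ 'n \<Rightarrow> complex ^ 'n \<Rightarrow> complex"
  where "wirtinger_part s f z v = (frechet_derivative f (at z) v + s * \<i> * frechet_derivative f (at z) (\<i> *s v)) / 2"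

definition wirtinger_d :: "complex \<Rightarrow> ('a, 'n::finite) chart set \<Rightarrow> ('a, 'n) form \<Rightarrow> ('a, 'n) form"
  where "wirtinger_d s = exterior_by (wirtinger_part s)"

lemma del_eq: "del = wirtinger_d (-1)" and delbar_eq: "delbar = wirtinger_d 1"
  unfolding del_def delbar_def wirtinger_d_def
  by (rule arg_cong[where f = exterior_by]; simp add: fun_eq_iff wirtinger_part_def lin_part_def antilin_part_def)+

lemma lin_part_add_antilin_part: "lin_part f z v + antilin_part f z v = frechet_derivative f (at z) v"
  by (simp add: lin_part_def antilin_part_def field_simps)

lemma ext_d_eq: "ext_d A \<alpha> = del A \<alpha> + delbar A \<alpha>"
proof (intro ext)
  fix c z vs show "ext_d A \<alpha> c z vs = (del A \<alpha> + delbar A \<alpha>) c z vs"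
    by (auto simp: ext_d_def del_def delbar_def exterior_by_def lin_part_add_antilin_part
        simp flip: sum.distrib distrib_left)
qed

text \<open>The part of smoothness that second derivatives such as del delbar require of the first ones; it can be
  checked in each chart separately.\<close>

definition smooth_coeff :: "('a, 'n::finite) chart set \<Rightarrow> ('a, 'n) form \<Rightarrow> bool"
  where "smooth_coeff A \<alpha> \<longleftrightarrow> (\<forall>c\<in>A. smooth_family (chart_image c) (\<alpha> c))"

lemma smooth_coeff_smooth_form: "smooth_form A \<alpha> \<Longrightarrow> smooth_coeff A \<alpha>"
  by (simp add: smooth_coeff_def smooth_formD)

lemma wirtinger_part_add:
  assumes "f differentiable (at z)" "g differentiable (at z)"
  shows "wirtinger_part s (\<lambda>w. f w + g w) z v = wirtinger_part s f z v + wirtinger_part s g z v"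
proof -
  have "frechet_derivative (\<lambda>w. f w + g w) (at z)
    = (\<lambda>v. frechet_derivative f (at z) v + frechet_derivative g (at z) v)"
    using assms by (intro frechet_derivative_at[symmetric] has_derivative_add)
      (simp_all add: frechet_derivative_works)
  then show ?thesis by (simp add: wirtinger_part_def algebra_simps add_divide_distrib)
qed

lemma wirtinger_part_scale:
  assumes "f differentiable (at z)"
  shows "wirtinger_part s (\<lambda>w. a * f w) z v = a * wirtinger_part s f z v"
proof -
  have "frechet_derivative (\<lambda>w. a * f w) (at z) = (\<lambda>v. a * frechet_derivative f (at z) v)"
    using assms by (intro frechet_derivative_at[symmetric] has_derivative_mult_right)
      (simp_all add: frechet_derivative_works)
  then show ?thesis by (simp add: wirtinger_part_def algebra_simps add_divide_distrib)
qed

lemma wirtinger_part_cnj: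
  assumes "f differentiable (at z)"
  shows "wirtinger_part s (\<lambda>w. cnj (f w)) z v = cnj (wirtinger_part (- cnj s) f z v)"
proof -
  have "frechet_derivative (\<lambda>w. cnj (f w)) (at z) = (\<lambda>v. cnj (frechet_derivative f (at z) v))"
    using assms by (intro frechet_derivative_at[symmetric] bounded_linear.has_derivative[OF bounded_linear_cnj])
      (simp_all add: frechet_derivative_works)
  then show ?thesis by (simp add: wirtinger_part_def)
qed

lemma wirtinger_part_zero [simp]: "wirtinger_part s (\<lambda>w. 0) z v = 0"
  by (simp add: wirtinger_part_def frechet_derivative_const)

lemma wirtinger_part_smult:
  assumes "f differentiable (at z)" "s * s = 1"
  shows "wirtinger_part s f z (a *s v) = (Re a - s * \<i> * Im a) * wirtinger_part s f z v"
proof -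
  let ?D = "frechet_derivative f (at z)"
  have l: "linear ?D" by (rule linear_frechet_derivative[OF assms(1)])
  have D1: "?D (a *s v) = Re a * ?D v + Im a * ?D (\<i> *s v)"
    unfolding vector_smult_complex[of a] linear_add[OF l] linear_scale[OF l] by (simp only: scaleR_conv_of_real)
  have "\<i> *s (a *s v) = Re a *\<^sub>R (\<i> *s v) + (- Im a) *\<^sub>R v"
    by (simp add: vec_eq_iff complex_eq_iff)
  then have "?D (\<i> *s (a *s v)) = ?D (Re a *\<^sub>R (\<i> *s v) + (- Im a) *\<^sub>R v)" by (rule arg_cong)
  then have "?D (\<i> *s (a *s v)) = Re a *\<^sub>R ?D (\<i> *s v) + (- Im a) *\<^sub>R ?D v"
    by (simp only: linear_add[OF l] linear_scale[OF l])
  then have D2: "?D (\<i> *s (a *s v)) = Re a * ?D (\<i> *s v) - Im a * ?D v"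
    by (simp add: scaleR_conv_of_real del: vector_smult_assoc)
  have s: "s * (s * x) = x" for x using assms(2) by (simp flip: mult.assoc)
  show ?thesis unfolding wirtinger_part_def D1 D2
    by (simp add: algebra_simps add_divide_distrib diff_divide_distrib s)
qed

context complex_atlas
begin

lemma smooth_coeff_differentiable:
  "smooth_coeff A \<alpha> \<Longrightarrow> c \<in> A \<Longrightarrow> z \<in> chart_image c \<Longrightarrow> (\<lambda>w. \<alpha> c w vs) differentiable (at z)"
  unfolding smooth_coeff_def smooth_family_def
  by (rule smooth_on_imp_differentiable[OF open_chart]) auto

lemma smooth_coeff_wirtinger_d:
  assumes "smooth_coeff A \<alpha>" shows "smooth_coeff A (wirtinger_d s A \<alpha>)"
  unfolding smooth_coeff_def smooth_family_def
proof (intro ballI allI)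
  fix c vs assume c: "c \<in> A"
  have "smooth_on (chart_image c) (\<lambda>z. \<Sum>i<length vs. (-1) ^ i *
      wirtinger_part s (\<lambda>w. \<alpha> c w (take i vs @ drop (Suc i) vs)) z (vs ! i))"
    unfolding wirtinger_part_def divide_inverse using c assms
    by (intro smooth_on_sum smooth_on_mult smooth_on_const smooth_on_add smooth_on_frechet_derivative open_chart)
      (auto simp: smooth_coeff_def smooth_family_def)
  then show "smooth_on (chart_image c) (\<lambda>z. wirtinger_d s A \<alpha> c z vs)"
    by (rule smooth_on_cong[OF open_chart[OF c], rotated]) (simp add: wirtinger_d_def exterior_by_def c)
qed

lemma wirtinger_d_add:
  assumes "smooth_coeff A \<alpha>" "smooth_coeff A \<beta>"
  shows "wirtinger_d s A (\<alpha> + \<beta>) = wirtinger_d s A \<alpha> + wirtinger_d s A \<beta>"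
  by (auto simp: fun_eq_iff wirtinger_d_def exterior_by_def wirtinger_part_add smooth_coeff_differentiable assms
      algebra_simps sum.distrib)

lemma wirtinger_d_cscale:
  assumes "smooth_coeff A \<alpha>"
  shows "wirtinger_d s A (cscale a \<alpha>) = cscale a (wirtinger_d s A \<alpha>)"
  by (auto simp: fun_eq_iff wirtinger_d_def exterior_by_def cscale_def wirtinger_part_scale smooth_coeff_differentiable assms
      sum_distrib_left mult_ac)

lemma wirtinger_d_conj:
  assumes "smooth_coeff A \<alpha>"
  shows "wirtinger_d s A (conj_form \<alpha>) = conj_form (wirtinger_d (- cnj s) A \<alpha>)"
  by (auto simp: fun_eq_iff wirtinger_d_def exterior_by_def conj_form_def wirtinger_part_cnj smooth_coeff_differentiable assms)

lemma wirtinger_d_zero: "wirtinger_d s A 0 = 0"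
  by (simp add: fun_eq_iff wirtinger_d_def exterior_by_def)

lemma wirtinger_d_deg_part: "wirtinger_d s A (deg_part k \<alpha>) = deg_part (Suc k) (wirtinger_d s A \<alpha>)"
proof (intro ext)
  fix c z vs
  show "wirtinger_d s A (deg_part k \<alpha>) c z vs = deg_part (Suc k) (wirtinger_d s A \<alpha>) c z vs"
  proof (cases "length vs = Suc k")
    case False
    then have "i < length vs \<Longrightarrow> length (take i vs @ drop (Suc i) vs) \<noteq> k" for i by auto
    then have "i < length vs \<Longrightarrow> wirtinger_part s (\<lambda>w. if length (take i vs @ drop (Suc i) vs) = k
        then \<alpha> c w (take i vs @ drop (Suc i) vs) else 0) z (vs ! i) = 0" for i
      by (simp only: if_False wirtinger_part_zero)
    with False show ?thesis by (simp add: wirtinger_d_def exterior_by_def deg_part_def)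
  qed (auto simp: wirtinger_d_def exterior_by_def deg_part_def)
qed

lemma rot_wirtinger_d:
  assumes "smooth_coeff A \<alpha>" "s * s = 1"
  shows "rot a (wirtinger_d s A \<alpha>) = cscale (Re a - s * \<i> * Im a) (wirtinger_d s A (rot a \<alpha>))"
  by (auto simp: fun_eq_iff wirtinger_d_def exterior_by_def rot_def cscale_def pull_def take_map drop_map
      wirtinger_part_smult smooth_coeff_differentiable assms sum_distrib_left mult_ac intro!: sum.cong)

lemma del_delbar_add:
  assumes "smooth_form A \<alpha>" "smooth_form A \<beta>"
  shows "del A (\<alpha> + \<beta>) = del A \<alpha> + del A \<beta>" "delbar A (\<alpha> + \<beta>) = delbar A \<alpha> + delbar A \<beta>"
  using assms by (simp_all add: del_eq delbar_eq wirtinger_d_add smooth_coeff_smooth_form)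

lemma del_delbar_cscale:
  assumes "smooth_form A \<alpha>"
  shows "del A (cscale a \<alpha>) = cscale a (del A \<alpha>)" "delbar A (cscale a \<alpha>) = cscale a (delbar A \<alpha>)"
  using assms by (simp_all add: del_eq delbar_eq wirtinger_d_cscale smooth_coeff_smooth_form)

lemma del_delbar_conj:
  assumes "smooth_form A \<alpha>"
  shows "del A (conj_form \<alpha>) = conj_form (delbar A \<alpha>)" "delbar A (conj_form \<alpha>) = conj_form (del A \<alpha>)"
  using assms by (simp_all add: del_eq delbar_eq wirtinger_d_conj smooth_coeff_smooth_form)

lemma del_delbar_zero: "del A 0 = 0" "delbar A 0 = 0"
  by (simp_all add: del_eq delbar_eq wirtinger_d_zero)

lemma del_delbar_deg_part:
  "del A (deg_part k \<alpha>) = deg_part (Suc k) (del A \<alpha>)" "delbar A (deg_part k \<alpha>) = deg_part (Suc k) (delbar A \<alpha>)"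
  by (simp_all add: del_eq delbar_eq wirtinger_d_deg_part)

lemma rot_del_delbar:
  assumes "smooth_form A \<alpha>"
  shows "rot a (del A \<alpha>) = cscale a (del A (rot a \<alpha>))"
    "rot a (delbar A \<alpha>) = cscale (cnj a) (delbar A (rot a \<alpha>))"
proof -
  have "Re a - (-1) * \<i> * Im a = a" "Re a - 1 * \<i> * Im a = cnj a"
    by (simp_all add: complex_eq_iff)
  then show "rot a (del A \<alpha>) = cscale a (del A (rot a \<alpha>))"
    "rot a (delbar A \<alpha>) = cscale (cnj a) (delbar A (rot a \<alpha>))"
    using rot_wirtinger_d[OF smooth_coeff_smooth_form[OF assms], of "-1" a]
      rot_wirtinger_d[OF smooth_coeff_smooth_form[OF assms], of 1 a]
    by (simp_all only: del_eq delbar_eq) simp_all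
qed

end

section \<open>The vector space of real Aeppli classes\<close>

lemma pq_form_add:
  assumes "complex_atlas A" "pq_form A p q \<alpha>" "pq_form A p q \<beta>" shows "pq_form A p q (\<alpha> + \<beta>)"
  using assms complex_atlas.smooth_form_add[OF assms(1)] unfolding pq_form_def
  by (simp add: algebra_simps)

lemma pq_form_cscale:
  assumes "complex_atlas A" "pq_form A p q \<alpha>" shows "pq_form A p q (cscale a \<alpha>)"
  using assms complex_atlas.smooth_form_cscale[OF assms(1)] unfolding pq_form_def
  by (simp add: cscale_def algebra_simps)

lemma pq_form_zero: "complex_atlas A \<Longrightarrow> pq_form A p q 0"
  by (simp add: pq_form_def complex_atlas.smooth_form_zero)

lemma real_form_add: "real_form \<alpha> \<Longrightarrow> real_form \<beta> \<Longrightarrow> real_form (\<alpha> + \<beta>)"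
  and real_form_scale: "real_form \<alpha> \<Longrightarrow> real_form (scale_form t \<alpha>)"
  and real_form_zero: "real_form 0"
  by (simp_all add: real_form_def conj_form_def scale_form_def fun_eq_iff)

lemma real_form_sum: "(\<And>i. i \<in> I \<Longrightarrow> real_form (f i)) \<Longrightarrow> real_form (\<Sum>i\<in>I. f i)"
  by (induction I rule: infinite_finite_induct) (simp_all add: real_form_zero real_form_add)

lemma cscale_zero: "cscale a 0 = 0"
  by (simp add: cscale_def fun_eq_iff)

lemma cscale_add: "cscale a (\<alpha> + \<beta>) = cscale a \<alpha> + cscale a \<beta>"
  by (simp add: cscale_def fun_eq_iff algebra_simps)

lemma UN_constant_on: "a \<in> P \<Longrightarrow> (\<And>x. x \<in> P \<Longrightarrow> F x = K) \<Longrightarrow> (\<Union>x\<in>P. F x) = K"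
  by auto

text \<open>The system of equations whose solvability is \<open>E\<^sub>r\<close>-closedness for \<open>r \<ge> 2\<close>. It is linear in all the
  forms together, which makes the closed forms a vector space.\<close>

definition zigzag ::
    "('a, 'n::finite) chart set \<Rightarrow> nat \<Rightarrow> ('a, 'n) form \<Rightarrow> (nat \<Rightarrow> ('a, 'n) form) \<Rightarrow> (nat \<Rightarrow> ('a, 'n) form) \<Rightarrow> bool"
  where "zigzag A r \<alpha> \<eta> \<rho> \<longleftrightarrow> (\<forall>i\<in>{1..r-1}. smooth_form A (\<eta> i) \<and> smooth_form A (\<rho> i)) \<and>
       del A \<alpha> = delbar A (\<eta> 1) \<and>
       (\<forall>i\<in>{1..<r-1}. del A (\<eta> i) = delbar A (\<eta> (Suc i))) \<and>
       delbar A \<alpha> = del A (\<rho> 1) \<and>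
       (\<forall>i\<in>{1..<r-1}. delbar A (\<rho> i) = del A (\<rho> (Suc i)))"

lemma ErEr_closed_iff_zigzag: "r \<noteq> 1 \<Longrightarrow> ErEr_closed A r \<alpha> \<longleftrightarrow> (\<exists>\<eta> \<rho>. zigzag A r \<alpha> \<eta> \<rho>)"
  by (simp only: ErEr_closed_def zigzag_def if_False)

context complex_atlas
begin

lemma ErEr_closed_add:
  assumes "r \<ge> 1" "smooth_form A \<alpha>" "smooth_form A \<beta>" "ErEr_closed A r \<alpha>" "ErEr_closed A r \<beta>"
  shows "ErEr_closed A r (\<alpha> + \<beta>)"
proof (cases "r = 1")
  case True
  then show ?thesis
    using assms by (simp add: ErEr_closed_def del_eq delbar_eq wirtinger_d_add smooth_coeff_wirtinger_d smooth_coeff_smooth_form)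
next
  case False
  then obtain \<eta> \<rho> \<eta>' \<rho>' where "zigzag A r \<alpha> \<eta> \<rho>" "zigzag A r \<beta> \<eta>' \<rho>'"
    using assms(4,5) by (auto simp: ErEr_closed_iff_zigzag)
  then have "zigzag A r (\<alpha> + \<beta>) (\<lambda>i. \<eta> i + \<eta>' i) (\<lambda>i. \<rho> i + \<rho>' i)"
    using False assms(1-3) unfolding zigzag_def by (auto simp: smooth_form_add del_delbar_add)
  with False show ?thesis by (auto simp: ErEr_closed_iff_zigzag)
qed

lemma ErEr_closed_cscale:
  assumes "r \<ge> 1" "smooth_form A \<alpha>" "ErEr_closed A r \<alpha>"
  shows "ErEr_closed A r (cscale a \<alpha>)"
proof (cases "r = 1")
  case True
  then show ?thesis
    using assms by (simp add: ErEr_closed_def del_eq delbar_eq wirtinger_d_cscale smooth_coeff_wirtinger_d smooth_coeff_smooth_form cscale_zero)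
next
  case False
  then obtain \<eta> \<rho> where "zigzag A r \<alpha> \<eta> \<rho>"
    using assms(3) by (auto simp: ErEr_closed_iff_zigzag)
  then have "zigzag A r (cscale a \<alpha>) (\<lambda>i. cscale a (\<eta> i)) (\<lambda>i. cscale a (\<rho> i))"
    using False assms(1-2) unfolding zigzag_def by (auto simp: smooth_form_cscale del_delbar_cscale)
  with False show ?thesis by (auto simp: ErEr_closed_iff_zigzag)
qed

lemma Er_cycles_smooth: "\<alpha> \<in> Er_cycles A r p q \<Longrightarrow> smooth_form A \<alpha>"
  by (simp add: Er_cycles_def pq_form_def)

lemma Er_cycles_add:
  "r \<ge> 1 \<Longrightarrow> \<alpha> \<in> Er_cycles A r p q \<Longrightarrow> \<beta> \<in> Er_cycles A r p q \<Longrightarrow> \<alpha> + \<beta> \<in> Er_cycles A r p q"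
  using ErEr_closed_add Er_cycles_smooth pq_form_add[OF complex_atlas_axioms]
  unfolding Er_cycles_def by blast

lemma Er_cycles_cscale:
  "r \<ge> 1 \<Longrightarrow> \<alpha> \<in> Er_cycles A r p q \<Longrightarrow> cscale a \<alpha> \<in> Er_cycles A r p q"
  using ErEr_closed_cscale Er_cycles_smooth pq_form_cscale[OF complex_atlas_axioms]
  unfolding Er_cycles_def by blast

lemma Er_cycles_zero: "0 \<in> Er_cycles A r p q"
  unfolding Er_cycles_def ErEr_closed_def using pq_form_zero[OF complex_atlas_axioms]
  by (auto simp: del_delbar_zero smooth_form_zero intro!: exI[of _ "\<lambda>_. 0"])

lemma Er_cycles_sum:
  "r \<ge> 1 \<Longrightarrow> (\<And>i. i \<in> I \<Longrightarrow> f i \<in> Er_cycles A r p q) \<Longrightarrow> (\<Sum>i\<in>I. f i) \<in> Er_cycles A r p q"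
  by (induction I rule: infinite_finite_induct) (simp_all add: Er_cycles_zero Er_cycles_add)

lemma im_del_delbar_add:
  assumes "\<alpha> \<in> im_del_delbar A" "\<beta> \<in> im_del_delbar A" shows "\<alpha> + \<beta> \<in> im_del_delbar A"
proof -
  obtain a b a' b' where *: "\<alpha> = del A a + delbar A b" "\<beta> = del A a' + delbar A b'"
    "smooth_form A a" "smooth_form A b" "smooth_form A a'" "smooth_form A b'"
    using assms unfolding im_del_delbar_def by blast
  then have "\<alpha> + \<beta> = del A (a + a') + delbar A (b + b')"
    by (simp add: del_delbar_add)
  with * smooth_form_add show ?thesis unfolding im_del_delbar_def by blast
qed

lemma im_del_delbar_cscale:
  assumes "\<alpha> \<in> im_del_delbar A" shows "cscale t \<alpha> \<in> im_del_delbar A"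
proof -
  obtain a b where *: "\<alpha> = del A a + delbar A b" "smooth_form A a" "smooth_form A b"
    using assms unfolding im_del_delbar_def by blast
  then have "cscale t \<alpha> = del A (cscale t a) + delbar A (cscale t b)"
    by (simp add: del_delbar_cscale cscale_add)
  with * smooth_form_cscale show ?thesis unfolding im_del_delbar_def by blast
qed

lemma im_del_delbar_zero: "0 \<in> im_del_delbar A"
  unfolding im_del_delbar_def using smooth_form_zero del_delbar_zero
  by (auto intro!: exI[of _ 0])

lemma equiv_aeppli_rel: "equiv (Er_cycles A r p q) (aeppli_rel A r p q)"
proof (rule equivI)
  show "aeppli_rel A r p q \<subseteq> Er_cycles A r p q \<times> Er_cycles A r p q"
    by (auto simp: aeppli_rel_def)
  show "refl_on (Er_cycles A r p q) (aeppli_rel A r p q)"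
    by (auto simp: refl_on_def aeppli_rel_def im_del_delbar_zero)
  show "sym (aeppli_rel A r p q)"
  proof (rule symI)
    fix \<alpha> \<beta> assume "(\<alpha>, \<beta>) \<in> aeppli_rel A r p q"
    moreover have "cscale (-1) (\<beta> - \<alpha>) = \<alpha> - \<beta>" by (simp add: cscale_def fun_eq_iff)
    ultimately show "(\<beta>, \<alpha>) \<in> aeppli_rel A r p q"
      using im_del_delbar_cscale[of "\<beta> - \<alpha>" "-1"] by (simp add: aeppli_rel_def)
  qed
  show "trans (aeppli_rel A r p q)"
  proof (rule transI)
    fix \<alpha> \<beta> \<gamma> assume "(\<alpha>, \<beta>) \<in> aeppli_rel A r p q" "(\<beta>, \<gamma>) \<in> aeppli_rel A r p q"
    then show "(\<alpha>, \<gamma>) \<in> aeppli_rel A r p q"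
      using im_del_delbar_add[of "\<gamma> - \<beta>" "\<beta> - \<alpha>"] by (simp add: aeppli_rel_def)
  qed
qed

lemma aeppli_class_iff:
  "\<gamma> \<in> aeppli_class A r p q \<alpha> \<longleftrightarrow>
    \<alpha> \<in> Er_cycles A r p q \<and> \<gamma> \<in> Er_cycles A r p q \<and> \<gamma> - \<alpha> \<in> im_del_delbar A"
  by (simp add: aeppli_class_def aeppli_rel_def)

lemma aeppli_class_self: "\<alpha> \<in> Er_cycles A r p q \<Longrightarrow> \<alpha> \<in> aeppli_class A r p q \<alpha>"
  by (simp add: aeppli_class_iff im_del_delbar_zero)

lemma aeppli_class_eq:
  "\<gamma> \<in> aeppli_class A r p q \<alpha> \<Longrightarrow> aeppli_class A r p q \<gamma> = aeppli_class A r p q \<alpha>"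
  unfolding aeppli_class_def using equiv_class_eq[OF equiv_aeppli_rel] by blast

lemma vadd_class:
  assumes r: "r \<ge> 1" and c: "\<alpha> \<in> Er_cycles A r p p" "\<beta> \<in> Er_cycles A r p p"
  shows "vadd (real_aeppli A r p) (aeppli_class A r p p \<alpha>) (aeppli_class A r p p \<beta>)
    = aeppli_class A r p p (\<alpha> + \<beta>)"
proof -
  have "aeppli_class A r p p (a + b) = aeppli_class A r p p (\<alpha> + \<beta>)"
    if "a \<in> aeppli_class A r p p \<alpha>" "b \<in> aeppli_class A r p p \<beta>" for a b
  proof (rule aeppli_class_eq)
    have "(a + b) - (\<alpha> + \<beta>) = (a - \<alpha>) + (b - \<beta>)" by simp
    also have "\<dots> \<in> im_del_delbar A"
      using that by (intro im_del_delbar_add) (simp_all add: aeppli_class_iff)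
    finally show "a + b \<in> aeppli_class A r p p (\<alpha> + \<beta>)"
      using that c by (simp add: aeppli_class_iff Er_cycles_add[OF r])
  qed
  then show ?thesis
    unfolding real_aeppli_def real_space.simps
    by (intro UN_constant_on[OF aeppli_class_self[OF c(1)]] UN_constant_on[OF aeppli_class_self[OF c(2)]])
qed

lemma vscale_class:
  assumes r: "r \<ge> 1" and c: "\<alpha> \<in> Er_cycles A r p p"
  shows "vscale (real_aeppli A r p) t (aeppli_class A r p p \<alpha>)
    = aeppli_class A r p p (scale_form t \<alpha>)"
proof -
  have "aeppli_class A r p p (scale_form t a) = aeppli_class A r p p (scale_form t \<alpha>)"
    if "a \<in> aeppli_class A r p p \<alpha>" for a
  proof (rule aeppli_class_eq)
    have "scale_form t a - scale_form t \<alpha> = cscale (of_real t) (a - \<alpha>)"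
      by (simp add: cscale_def scale_form_def fun_eq_iff algebra_simps)
    also have "\<dots> \<in> im_del_delbar A"
      using that by (intro im_del_delbar_cscale) (simp add: aeppli_class_iff)
    finally show "scale_form t a \<in> aeppli_class A r p p (scale_form t \<alpha>)"
      using that c by (simp add: aeppli_class_iff Er_cycles_cscale[OF r] scale_form_eq_cscale)
  qed
  then show ?thesis
    unfolding real_aeppli_def real_space.simps
    by (intro UN_constant_on[OF aeppli_class_self[OF c]])
qed

lemma lin_comb_class:
  assumes r: "r \<ge> 1" and "\<And>i. i < m \<Longrightarrow> \<beta> i \<in> Er_cycles A r p p" "\<And>i. i < m \<Longrightarrow> b i = aeppli_class A r p p (\<beta> i)"
  shows "lin_comb (real_aeppli A r p) x b m = aeppli_class A r p p (\<Sum>i<m. scale_form (x i) (\<beta> i))"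
  using assms(2,3)
proof (induction m)
  case 0
  then show ?case by (simp add: real_aeppli_def zero_fun_def)
next
  case (Suc m)
  have "(\<Sum>i<m. scale_form (x i) (\<beta> i)) \<in> Er_cycles A r p p" "scale_form (x m) (\<beta> m) \<in> Er_cycles A r p p"
    using Suc.prems(1) by (auto intro!: Er_cycles_sum[OF r] Er_cycles_cscale[OF r] simp: scale_form_eq_cscale)
  then show ?case
    using Suc vscale_class[OF r] vadd_class[OF r] by (simp add: plus_fun_def)
qed

lemma real_aeppli_carr:
  "P \<in> carr (real_aeppli A r p) \<longleftrightarrow>
    (\<exists>\<alpha>. \<alpha> \<in> Er_cycles A r p p \<and> real_form \<alpha> \<and> P = aeppli_class A r p p \<alpha>)"
proof
  assume "P \<in> carr (real_aeppli A r p)"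
  then obtain \<gamma> \<alpha> where "P = aeppli_class A r p p \<gamma>" "\<alpha> \<in> P" "real_form \<alpha>"
    by (auto simp: real_aeppli_def aeppli_cohomology_def aeppli_class_def elim!: quotientE)
  then show "\<exists>\<alpha>. \<alpha> \<in> Er_cycles A r p p \<and> real_form \<alpha> \<and> P = aeppli_class A r p p \<alpha>"
    using aeppli_class_eq aeppli_class_iff by blast
next
  assume "\<exists>\<alpha>. \<alpha> \<in> Er_cycles A r p p \<and> real_form \<alpha> \<and> P = aeppli_class A r p p \<alpha>"
  then obtain \<alpha> where "\<alpha> \<in> Er_cycles A r p p" "real_form \<alpha>" "P = aeppli_class A r p p \<alpha>" by blast
  then show "P \<in> carr (real_aeppli A r p)"
    using aeppli_class_self
    by (auto simp: real_aeppli_def aeppli_cohomology_def aeppli_class_def intro!: quotientI)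
qed

lemma perturbed_cycle:
  assumes r: "r \<ge> 1" and \<theta>: "\<theta> \<in> Er_cycles A r p p" "real_form \<theta>"
    and \<beta>: "\<And>i. i < m \<Longrightarrow> \<beta> i \<in> Er_cycles A r p p \<and> real_form (\<beta> i)"
  shows "\<theta> + (\<Sum>i<m::nat. scale_form (y i) (\<beta> i)) \<in> Er_cycles A r p p"
    "real_form (\<theta> + (\<Sum>i<m. scale_form (y i) (\<beta> i)))"
proof -
  have "scale_form (y i) (\<beta> i) \<in> Er_cycles A r p p" if "i < m" for i
    unfolding scale_form_eq_cscale using \<beta>[OF that] by (intro Er_cycles_cscale r) auto
  then show "\<theta> + (\<Sum>i<m. scale_form (y i) (\<beta> i)) \<in> Er_cycles A r p p"
    by (intro Er_cycles_add r \<theta> Er_cycles_sum) auto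
  show "real_form (\<theta> + (\<Sum>i<m. scale_form (y i) (\<beta> i)))"
    using \<beta> by (intro real_form_add \<theta> real_form_sum real_form_scale) auto
qed

text \<open>Openness is tested along a linear map from \<open>\<real>\<^sup>m\<close>, given by real cycles \<open>\<beta>\<^sub>i\<close>. If the class of \<open>\<Sum> x\<^sub>i \<beta>\<^sub>i\<close>
  is represented by \<open>\<theta>\<close> in \<open>G\<close>, then the class of \<open>\<Sum> x'\<^sub>i \<beta>\<^sub>i\<close> is represented by
  \<open>\<theta> + \<Sum> (x'\<^sub>i - x\<^sub>i) \<beta>\<^sub>i\<close>, which by the last hypothesis is in \<open>G\<close> for \<open>x'\<close> near \<open>x\<close>.\<close>

theorem open_convex_cone_of_cycles:
  assumes r: "r \<ge> 1"
    and G: "\<And>\<theta>. \<theta> \<in> G \<Longrightarrow> \<theta> \<in> Er_cycles A r p p" "\<And>\<theta>. \<theta> \<in> G \<Longrightarrow> real_form \<theta>"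
    and scale: "\<And>\<theta> t. \<theta> \<in> G \<Longrightarrow> t > 0 \<Longrightarrow> scale_form t \<theta> \<in> G"
    and add: "\<And>\<theta> \<theta>'. \<theta> \<in> G \<Longrightarrow> \<theta>' \<in> G \<Longrightarrow> \<theta> + \<theta>' \<in> G"
    and stable: "\<And>\<theta> (m::nat) \<beta>. \<theta> \<in> G \<Longrightarrow> (\<And>i. i < m \<Longrightarrow> \<beta> i \<in> Er_cycles A r p p \<and> real_form (\<beta> i)) \<Longrightarrow>
      \<exists>\<epsilon>>0. \<forall>y. (\<forall>i<m. \<bar>y i\<bar> < \<epsilon>) \<longrightarrow> \<theta> + (\<Sum>i<m. scale_form (y i) (\<beta> i)) \<in> G"
  shows "open_convex_cone_in (real_aeppli A r p) (aeppli_class A r p p ` G)"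
  unfolding open_convex_cone_in_def convex_cone_in_def
proof (intro conjI ballI allI impI)
  show sub: "aeppli_class A r p p ` G \<subseteq> carr (real_aeppli A r p)"
    using G real_aeppli_carr by blast
  show "vscale (real_aeppli A r p) t x \<in> aeppli_class A r p p ` G"
    if "x \<in> aeppli_class A r p p ` G" "t > 0" for x t
    using that scale G(1) vscale_class[OF r] by auto
  show "vadd (real_aeppli A r p) (vscale (real_aeppli A r p) (1 - t) x) (vscale (real_aeppli A r p) t y)
      \<in> aeppli_class A r p p ` G"
    if xy: "x \<in> aeppli_class A r p p ` G" "y \<in> aeppli_class A r p p ` G" and t: "t \<in> {0..1}" for x y t
  proof -
    obtain \<theta> \<theta>' where \<theta>: "\<theta> \<in> G" "x = aeppli_class A r p p \<theta>" "\<theta>' \<in> G" "y = aeppli_class A r p p \<theta>'"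
      using xy by blast
    have c: "scale_form s \<theta> \<in> Er_cycles A r p p" "scale_form s \<theta>' \<in> Er_cycles A r p p" for s
      using G(1) \<theta> Er_cycles_cscale[OF r] by (auto simp: scale_form_eq_cscale)
    have z: "scale_form 0 \<gamma> = 0" "scale_form 1 \<gamma> = \<gamma>" for \<gamma> :: "('a, 'n) form"
      by (simp_all add: scale_form_def fun_eq_iff)
    have "scale_form (1 - t) \<theta> + scale_form t \<theta>' \<in> G"
    proof (cases "t = 0 \<or> t = 1")
      case True
      then show ?thesis using \<theta> by (auto simp: z)
    next
      case False
      with t show ?thesis by (intro add scale \<theta>) auto
    qed
    moreover have "vadd (real_aeppli A r p) (vscale (real_aeppli A r p) (1 - t) x) (vscale (real_aeppli A r p) t y)
        = aeppli_class A r p p (scale_form (1 - t) \<theta> + scale_form t \<theta>')"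
      using \<theta> G(1) by (simp add: vscale_class[OF r] vadd_class[OF r] c)
    ultimately show ?thesis by blast
  qed
  show "openin (vs_topology (real_aeppli A r p)) (aeppli_class A r p p ` G)"
    unfolding openin_vs_topology
  proof (intro conjI sub allI impI)
    fix m :: nat and b assume "b ` {..<m} \<subseteq> carr (real_aeppli A r p)"
    then have "\<forall>i\<in>{..<m}. \<exists>\<alpha>. \<alpha> \<in> Er_cycles A r p p \<and> real_form \<alpha> \<and> b i = aeppli_class A r p p \<alpha>"
      unfolding real_aeppli_carr[symmetric] by blast
    then obtain \<beta> where \<beta>: "\<And>i. i < m \<Longrightarrow> \<beta> i \<in> Er_cycles A r p p" "\<And>i. i < m \<Longrightarrow> real_form (\<beta> i)"
      "\<And>i. i < m \<Longrightarrow> b i = aeppli_class A r p p (\<beta> i)"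
      unfolding bchoice_iff by auto
    let ?s = "\<lambda>x. \<Sum>i<m. scale_form (x i) (\<beta> i)"
    have s: "?s x \<in> Er_cycles A r p p" for x
      using \<beta>(1) by (auto intro!: Er_cycles_sum[OF r] Er_cycles_cscale[OF r] simp: scale_form_eq_cscale)
    have lc: "lin_comb (real_aeppli A r p) x b m = aeppli_class A r p p (?s x)" for x
      by (rule lin_comb_class[OF r \<beta>(1,3)])
    let ?pre = "{x \<in> topspace (powertop_real {..<m}). lin_comb (real_aeppli A r p) x b m \<in> aeppli_class A r p p ` G}"
    show "openin (powertop_real {..<m}) ?pre"
      unfolding openin_product_topology_alt
    proof
      fix x assume x: "x \<in> ?pre"
      then obtain \<theta> where \<theta>: "\<theta> \<in> G" "aeppli_class A r p p (?s x) = aeppli_class A r p p \<theta>"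
        by (auto simp: lc)
      then have d: "\<theta> - ?s x \<in> im_del_delbar A"
        using aeppli_class_self[OF G(1)[OF \<theta>(1)]] unfolding \<theta>(2)[symmetric] aeppli_class_iff by blast
      obtain \<epsilon> where \<epsilon>: "\<epsilon> > 0" "\<And>y. (\<forall>i<m. \<bar>y i\<bar> < \<epsilon>) \<Longrightarrow> \<theta> + ?s y \<in> G"
        using stable[OF \<theta>(1), of m \<beta>] \<beta>(1,2) by blast
      let ?U = "\<lambda>i. {x i - \<epsilon><..<x i + \<epsilon>}"
      have "lin_comb (real_aeppli A r p) x' b m \<in> aeppli_class A r p p ` G" if x': "x' \<in> Pi\<^sub>E {..<m} ?U" for x'
      proof -
        let ?y = "\<lambda>i. x' i - x i"
        have "\<forall>i<m. \<bar>?y i\<bar> < \<epsilon>" using x' by (force simp: PiE_def Pi_def abs_less_iff)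
        then have g: "\<theta> + ?s ?y \<in> G" by (rule \<epsilon>(2))
        have "scale_form (x' i) (\<beta> i) = scale_form (x i) (\<beta> i) + scale_form (?y i) (\<beta> i)" for i
          by (simp add: scale_form_def fun_eq_iff algebra_simps)
        then have "?s x' = ?s x + ?s ?y" by (simp add: sum.distrib)
        then have "\<theta> + ?s ?y - ?s x' = \<theta> - ?s x" by simp
        with d have "\<theta> + ?s ?y - ?s x' \<in> im_del_delbar A" by (rule ssubst[rotated])
        then have "\<theta> + ?s ?y \<in> aeppli_class A r p p (?s x')"
          using s G(1)[OF g] unfolding aeppli_class_iff by blast
        then have "aeppli_class A r p p (?s x') = aeppli_class A r p p (\<theta> + ?s ?y)"
          using aeppli_class_eq by blast
        with g show ?thesis unfolding lc by blast
      qed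
      then have "Pi\<^sub>E {..<m} ?U \<subseteq> ?pre"
        by (auto simp: PiE_def)
      moreover have "x \<in> Pi\<^sub>E {..<m} ?U" using x \<epsilon>(1) by (auto simp: PiE_def)
      ultimately show "\<exists>U. finite {i \<in> {..<m}. U i \<noteq> topspace euclideanreal} \<and>
          (\<forall>i\<in>{..<m}. openin euclideanreal (U i)) \<and> x \<in> Pi\<^sub>E {..<m} U \<and> Pi\<^sub>E {..<m} U \<subseteq> ?pre"
        by (intro exI[of _ ?U]) auto
    qed
  qed
qed

end

section \<open>Stability of positivity on a compact manifold\<close>

lemma alternating_pair_expand:
  fixes f :: "'v::euclidean_space list \<Rightarrow> complex"
  assumes "alternating f"
  shows "f [u, v] = (\<Sum>a\<in>Basis. \<Sum>b\<in>Basis. ((u \<bullet> a) * (v \<bullet> b)) *\<^sub>R f [a, b])"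
proof -
  have 1: "f [u, v] = (\<Sum>a\<in>Basis. (u \<bullet> a) *\<^sub>R f [a, v])" for u v
  proof -
    have "f [u, v] = f [\<Sum>a\<in>Basis. (u \<bullet> a) *\<^sub>R a, v]" by (simp add: euclidean_representation)
    also have "\<dots> = (\<Sum>a\<in>Basis. (u \<bullet> a) *\<^sub>R f [a, v])"
      by (simp only: linear_sum[OF alternating_pair(1)[OF assms]] linear_scale[OF alternating_pair(1)[OF assms]])
    finally show ?thesis .
  qed
  have 2: "f [u, v] = (\<Sum>b\<in>Basis. (v \<bullet> b) *\<^sub>R f [u, b])" for u v
  proof -
    have "f [u, v] = f [u, \<Sum>a\<in>Basis. (v \<bullet> a) *\<^sub>R a]" by (simp add: euclidean_representation)
    also have "\<dots> = (\<Sum>a\<in>Basis. (v \<bullet> a) *\<^sub>R f [u, a])"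
      by (simp only: linear_sum[OF alternating_pair(2)[OF assms]] linear_scale[OF alternating_pair(2)[OF assms]])
    finally show ?thesis .
  qed
  show ?thesis
    by (subst 1, subst 2) (simp add: scaleR_sum_right)
qed

definition cont_pairs :: "(complex ^ 'n::finite) set \<Rightarrow> (complex ^ 'n \<Rightarrow> (complex ^ 'n) list \<Rightarrow> complex) \<Rightarrow> bool"
  where "cont_pairs S F \<longleftrightarrow> (\<forall>z\<in>S. alternating (F z)) \<and> (\<forall>u v. continuous_on S (\<lambda>z. F z [u, v]))"

text \<open>Expanded in a basis, the form is a finite sum of products of a coefficient, depending on the point,
  and coordinates of the vector.\<close>

lemma continuous_quadratic:
  fixes F :: "complex ^ 'n::finite \<Rightarrow> (complex ^ 'n) list \<Rightarrow> complex"
  assumes "cont_pairs S F"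
  shows "continuous_on (S \<times> UNIV) (\<lambda>(z, v). Re (F z [v, \<i> *s v]))"
proof -
  have J: "continuous_on T (\<lambda>x. \<i> *s snd x)" for T :: "((complex ^ 'n) \<times> (complex ^ 'n)) set"
    using linear_continuous_on[OF linear_conv_bounded_linear[THEN iffD1, OF linear_vector_smult[of \<i>]]]
    by (rule continuous_on_compose2[of UNIV _ _ snd]) (auto intro: continuous_intros)
  have F: "continuous_on (S \<times> UNIV) (\<lambda>x. F (fst x) [a, b])" for a b
    by (rule continuous_on_compose2[of S "\<lambda>z. F z [a, b]" _ fst])
      (use assms in \<open>auto simp: cont_pairs_def intro: continuous_intros\<close>)
  have "continuous_on (S \<times> UNIV) (\<lambda>x. Re (\<Sum>a\<in>Basis. \<Sum>b\<in>Basis.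
      ((snd x \<bullet> a) * ((\<i> *s snd x) \<bullet> b)) *\<^sub>R F (fst x) [a, b]))"
    by (intro continuous_intros J F)
  then show ?thesis
  proof (rule continuous_on_eq)
    fix x assume "x \<in> S \<times> (UNIV :: (complex ^ 'n) set)"
    then obtain z v where x: "x = (z, v)" "z \<in> S" by blast
    with assms have "alternating (F z)" by (simp add: cont_pairs_def)
    from alternating_pair_expand[OF this, of v "\<i> *s v"]
    show "Re (\<Sum>a\<in>Basis. \<Sum>b\<in>Basis. ((snd x \<bullet> a) * ((\<i> *s snd x) \<bullet> b)) *\<^sub>R F (fst x) [a, b])
        = (case x of (z, v) \<Rightarrow> Re (F z [v, \<i> *s v]))"
      unfolding x by (simp only: fst_conv snd_conv prod.case)
  qed
qed

text \<open>On a compact ball around the point times the unit sphere, the positive form is bounded below and the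
  perturbing forms are bounded above; homogeneity extends the estimate to all vectors.\<close>

lemma positivity_locally_stable:
  fixes F :: "complex ^ 'n::finite \<Rightarrow> (complex ^ 'n) list \<Rightarrow> complex"
    and G :: "nat \<Rightarrow> complex ^ 'n \<Rightarrow> (complex ^ 'n) list \<Rightarrow> complex"
  assumes "open S" "z0 \<in> S" and F: "cont_pairs S F" and G: "\<And>i. i < m \<Longrightarrow> cont_pairs S (G i)"
    and pos: "\<And>z v. z \<in> S \<Longrightarrow> v \<noteq> 0 \<Longrightarrow> Re (F z [v, \<i> *s v]) > 0"
  obtains \<delta> \<epsilon> where "\<delta> > 0" "\<epsilon> > 0" "\<And>z y v. z \<in> S \<Longrightarrow> z \<in> ball z0 \<delta> \<Longrightarrow> (\<forall>i<m. \<bar>y i\<bar> < \<epsilon>) \<Longrightarrow> v \<noteq> 0 \<Longrightarrow>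
    Re (F z [v, \<i> *s v] + (\<Sum>i<m. of_real (y i) * G i z [v, \<i> *s v])) > 0"
proof -
  obtain \<delta> where \<delta>: "\<delta> > 0" "cball z0 \<delta> \<subseteq> S"
    using assms(1,2) open_contains_cball by blast
  let ?K = "cball z0 \<delta> \<times> sphere (0 :: complex ^ 'n) 1"
  have K: "compact ?K" by (intro compact_Times compact_cball compact_sphere)
  have sub: "?K \<subseteq> S \<times> UNIV" using \<delta>(2) by auto
  define q where "q F = (\<lambda>(z, v). Re (F z [v, \<i> *s v]))"
    for F :: "complex ^ 'n \<Rightarrow> (complex ^ 'n) list \<Rightarrow> complex"
  have cq: "continuous_on ?K (q F)" if "cont_pairs S F" for F
    using continuous_on_subset[OF continuous_quadratic[OF that] sub] unfolding q_def .
  have "axis undefined 1 \<in> sphere (0 :: complex ^ 'n) 1"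
    by (simp add: norm_eq_sqrt_inner inner_axis_axis)
  then have ne: "?K \<noteq> {}" using \<delta>(1) by fastforce
  obtain x0 where x0: "x0 \<in> ?K" "\<And>x. x \<in> ?K \<Longrightarrow> q F x0 \<le> q F x"
    using continuous_attains_inf[OF K ne cq[OF F]] by blast
  define \<mu> where "\<mu> = q F x0"
  have \<mu>: "\<mu> > 0"
    unfolding \<mu>_def q_def using x0(1) \<delta>(2) by (auto intro!: pos simp: subset_iff)
  have "\<exists>M. \<forall>x\<in>?K. \<bar>q (G i) x\<bar> \<le> M" if "i < m" for i
    using compact_imp_bounded[OF compact_continuous_image[OF cq[OF G[OF that]] K]]
    unfolding bounded_iff by auto
  then obtain M where M: "\<And>i x. i < m \<Longrightarrow> x \<in> ?K \<Longrightarrow> \<bar>q (G i) x\<bar> \<le> M i" by metis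
  \<comment> \<open>the summand 1 keeps \<open>N\<close> positive and the final estimate strict\<close>
  define N where "N = (\<Sum>i<m. \<bar>M i\<bar>) + 1"
  have N: "N > 0" unfolding N_def by (simp add: add_nonneg_pos sum_nonneg)
  define \<epsilon> where "\<epsilon> = \<mu> / N"
  have \<epsilon>: "\<epsilon> > 0" using \<mu> N by (simp add: \<epsilon>_def)
  show thesis
  proof (rule that[OF \<delta>(1) \<epsilon>])
    fix z y and v :: "complex ^ 'n"
    assume z: "z \<in> S" "z \<in> ball z0 \<delta>" and y: "\<forall>i<m. \<bar>y i\<bar> < \<epsilon>" and v: "v \<noteq> 0"
    define w where "w = (1 / norm v) *\<^sub>R v"
    have vw: "v = norm v *\<^sub>R w" using v by (simp add: w_def)
    have zw: "(z, w) \<in> ?K" using z v by (simp add: w_def)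
    have hom: "f [v, \<i> *s v] = of_real (norm v ^ 2) * f [w, \<i> *s w]" if f: "alternating f" for f
    proof -
      have "\<i> *s v = norm v *\<^sub>R (\<i> *s w)" by (subst vw) (rule linear_scale[OF linear_vector_smult])
      then have "f [v, \<i> *s v] = f [norm v *\<^sub>R w, norm v *\<^sub>R (\<i> *s w)]" using vw by metis
      also have "\<dots> = norm v *\<^sub>R norm v *\<^sub>R f [w, \<i> *s w]"
        by (simp only: linear_scale[OF alternating_pair(1)[OF f]] linear_scale[OF alternating_pair(2)[OF f]])
      finally show ?thesis by (simp add: scaleR_conv_of_real power2_eq_square)
    qed
    have "\<bar>\<Sum>i<m. y i * q (G i) (z, w)\<bar> \<le> (\<Sum>i<m. \<epsilon> * \<bar>M i\<bar>)"
    proof (rule order_trans[OF sum_abs sum_mono])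
      fix i assume "i \<in> {..<m}"
      then have "\<bar>y i\<bar> \<le> \<epsilon>" "\<bar>q (G i) (z, w)\<bar> \<le> \<bar>M i\<bar>"
        using y M[OF _ zw, of i] by force+
      then show "\<bar>y i * q (G i) (z, w)\<bar> \<le> \<epsilon> * \<bar>M i\<bar>"
        unfolding abs_mult by (intro mult_mono) (use \<epsilon> in auto)
    qed
    also have "\<dots> = \<epsilon> * (N - 1)" by (simp add: N_def sum_distrib_left)
    also have "\<dots> < \<mu>"
      using \<epsilon> N by (simp add: \<epsilon>_def field_simps)
    also have "\<mu> \<le> q F (z, w)" unfolding \<mu>_def by (rule x0(2)[OF zw])
    finally have p: "q F (z, w) + (\<Sum>i<m. y i * q (G i) (z, w)) > 0" by linarith
    have "Re (F z [v, \<i> *s v] + (\<Sum>i<m. of_real (y i) * G i z [v, \<i> *s v]))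
      = norm v ^ 2 * (q F (z, w) + (\<Sum>i<m. y i * q (G i) (z, w)))"
    proof -
      have "F z [v, \<i> *s v] = of_real (norm v ^ 2) * F z [w, \<i> *s w]"
        using F z by (intro hom) (auto simp: cont_pairs_def)
      moreover have "G i z [v, \<i> *s v] = of_real (norm v ^ 2) * G i z [w, \<i> *s w]" if "i < m" for i
        using G[OF that] z by (intro hom) (auto simp: cont_pairs_def)
      ultimately show ?thesis
        by (simp add: q_def Re_sum sum_distrib_left algebra_simps)
    qed
    then show "Re (F z [v, \<i> *s v] + (\<Sum>i<m. of_real (y i) * G i z [v, \<i> *s v])) > 0"
      using p v by simp
  qed
qed

text \<open>Finitely many of the neighbourhoods found locally cover the compact manifold. Positivity is obtained
  in some chart around each point; independence of the chart is a separate matter, with different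
  reasons for forms of bidegree \<open>(1,1)\<close> and \<open>(n-1,n-1)\<close>.\<close>

lemma positivity_stable:
  fixes F :: "('a, 'n::finite) form" and G :: "nat \<Rightarrow> ('a, 'n) form"
  assumes X: "compact_complex_manifold X A"
    and F: "\<And>c. c \<in> A \<Longrightarrow> cont_pairs (chart_image c) (F c)"
    and G: "\<And>c i. c \<in> A \<Longrightarrow> i < m \<Longrightarrow> cont_pairs (chart_image c) (G i c)"
    and pos: "\<And>c z v. c \<in> A \<Longrightarrow> z \<in> chart_image c \<Longrightarrow> v \<noteq> 0 \<Longrightarrow> Re (F c z [v, \<i> *s v]) > 0"
  obtains \<epsilon> where "\<epsilon> > 0" "\<And>y p. (\<forall>i<m. \<bar>y i\<bar> < \<epsilon>) \<Longrightarrow> p \<in> topspace X \<Longrightarrow>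
    \<exists>c\<in>A. p \<in> fst c \<and> (\<forall>v. v \<noteq> 0 \<longrightarrow>
      Re (F c (snd c p) [v, \<i> *s v] + (\<Sum>i<m. of_real (y i) * G i c (snd c p) [v, \<i> *s v])) > 0)"
proof -
  define P where "P U \<epsilon> \<longleftrightarrow> (\<forall>y. \<forall>p\<in>U. (\<forall>i<m. \<bar>y i\<bar> < \<epsilon>) \<longrightarrow> (\<exists>c\<in>A. p \<in> fst c \<and> (\<forall>v. v \<noteq> 0 \<longrightarrow>
      Re (F c (snd c p) [v, \<i> *s v] + (\<Sum>i<m. of_real (y i) * G i c (snd c p) [v, \<i> *s v])) > 0)))"
    for U and \<epsilon> :: real
  have M: "(\<Union>c\<in>A. fst c) = topspace X" "compact_space X"
    "\<And>c. c \<in> A \<Longrightarrow> openin X (fst c)" "\<And>c. c \<in> A \<Longrightarrow> open (chart_image c)"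
    "\<And>c. c \<in> A \<Longrightarrow> homeomorphic_map (subtopology X (fst c)) (top_of_set (chart_image c)) (snd c)"
    using X unfolding compact_complex_manifold_def complex_manifold_def by blast+
  have "\<exists>U \<epsilon>. openin X U \<and> p \<in> U \<and> \<epsilon> > 0 \<and> P U \<epsilon>" if p: "p \<in> topspace X" for p
  proof -
    obtain c where c: "c \<in> A" "p \<in> fst c" using M(1) p by blast
    obtain \<delta> \<epsilon> where \<delta>: "\<delta> > 0" and \<epsilon>: "\<epsilon> > 0" and *: "\<And>z y v. z \<in> chart_image c \<Longrightarrow> z \<in> ball (snd c p) \<delta> \<Longrightarrow>
        (\<forall>i<m. \<bar>y i\<bar> < \<epsilon>) \<Longrightarrow> v \<noteq> 0 \<Longrightarrow>
        Re (F c z [v, \<i> *s v] + (\<Sum>i<m. of_real (y i) * G i c z [v, \<i> *s v])) > 0"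
      using positivity_locally_stable[where m = m and F = "F c" and G = "\<lambda>i. G i c",
          OF M(4)[OF c(1)] imageI[OF c(2)] F[OF c(1)] G[OF c(1)] pos[OF c(1)]] by blast
    define U where "U = {q \<in> topspace (subtopology X (fst c)). snd c q \<in> chart_image c \<inter> ball (snd c p) \<delta>}"
    have top: "topspace (subtopology X (fst c)) = fst c"
      using openin_subset[OF M(3)[OF c(1)]] by auto
    have "openin (subtopology X (fst c)) U"
      unfolding U_def
      by (rule openin_continuous_map_preimage[OF homeomorphic_imp_continuous_map[OF M(5)[OF c(1)]]])
        (simp add: openin_open_Int)
    then have "openin X U" using M(3)[OF c(1)] openin_trans_full by blast
    moreover have "p \<in> U" using c(2) \<delta> p by (simp add: U_def top)
    moreover have "P U \<epsilon>"
      unfolding P_def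
    proof (intro allI ballI impI)
      fix y q assume q: "q \<in> U" and y: "\<forall>i<m. \<bar>y i\<bar> < \<epsilon>"
      then show "\<exists>c\<in>A. q \<in> fst c \<and> (\<forall>v. v \<noteq> 0 \<longrightarrow>
        Re (F c (snd c q) [v, \<i> *s v] + (\<Sum>i<m. of_real (y i) * G i c (snd c q) [v, \<i> *s v])) > 0)"
        using *[of "snd c q" y] c(1) q unfolding U_def top by (intro bexI[of _ c]) auto
    qed
    ultimately show ?thesis using \<epsilon> by blast
  qed
  then obtain U e where Ue: "\<And>p. p \<in> topspace X \<Longrightarrow> openin X (U p) \<and> p \<in> U p \<and> e p > 0 \<and> P (U p) (e p)"
    by metis
  have "\<exists>\<F>. finite \<F> \<and> \<F> \<subseteq> U ` topspace X \<and> topspace X \<subseteq> \<Union>\<F>"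
    using M(2)[unfolded compact_space_def] Ue by (intro compactinD[of X "topspace X"]) auto
  then obtain T where T: "finite T" "T \<subseteq> topspace X" "topspace X \<subseteq> \<Union>(U ` T)"
    by (metis finite_subset_image)
  \<comment> \<open>1 is inserted because the manifold, and so \<open>T\<close>, may be empty\<close>
  define \<epsilon> where "\<epsilon> = Min (insert 1 (e ` T))"
  have "\<epsilon> > 0" unfolding \<epsilon>_def using T Ue by (subst Min_gr_iff) auto
  moreover have "\<exists>c\<in>A. p \<in> fst c \<and> (\<forall>v. v \<noteq> 0 \<longrightarrow>
      Re (F c (snd c p) [v, \<i> *s v] + (\<Sum>i<m. of_real (y i) * G i c (snd c p) [v, \<i> *s v])) > 0)"
    if y: "\<forall>i<m. \<bar>y i\<bar> < \<epsilon>" and p: "p \<in> topspace X" for y p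
  proof -
    obtain t where t: "t \<in> T" "p \<in> U t" using T(3) p by blast
    have "\<epsilon> \<le> e t" unfolding \<epsilon>_def using T(1) t(1) by (intro Min_le) auto
    then have "\<forall>i<m. \<bar>y i\<bar> < e t" using y by force
    moreover have "P (U t) (e t)" using Ue T(2) t(1) by blast
    ultimately show ?thesis using t(2) unfolding P_def by blast
  qed
  ultimately show thesis by (rule that)
qed

section \<open>Hermitian metrics and the SKT cone\<close>

lemma pos11_add: "pos11 \<sigma> \<Longrightarrow> pos11 \<tau> \<Longrightarrow> pos11 (\<lambda>vs. \<sigma> vs + \<tau> vs)"
  unfolding pos11_def two_form_def real_valued_def
  by (auto intro!: alternating_add add_pos_pos)

text \<open>Invariance under \<open>i\<close> and bilinearity give the bidegree \<open>(1,1)\<close>: in the expansion for \<open>a = x + i y\<close>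
  the mixed terms cancel.\<close>

lemma pos11_smult:
  assumes pos: "pos11 \<sigma>" shows "\<sigma> [a *s u, a *s v] = a * cnj a * \<sigma> [u, v]"
proof -
  note l = linear_add[OF alternating_pair(1)[OF pos11D(1)[OF pos]]]
    linear_add[OF alternating_pair(2)[OF pos11D(1)[OF pos]]]
    linear_scale[OF alternating_pair(1)[OF pos11D(1)[OF pos]]]
    linear_scale[OF alternating_pair(2)[OF pos11D(1)[OF pos]]]
  have "\<sigma> [a *s u, a *s v] = Re a *\<^sub>R Re a *\<^sub>R \<sigma> [u, v] + Im a *\<^sub>R Re a *\<^sub>R \<sigma> [u, \<i> *s v]
      + (Re a *\<^sub>R Im a *\<^sub>R \<sigma> [\<i> *s u, v] + Im a *\<^sub>R Im a *\<^sub>R \<sigma> [\<i> *s u, \<i> *s v])"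
    unfolding vector_smult_complex[of a] by (simp only: l scaleR_left_commute scaleR_add_right add_ac)
  also have "\<dots> = of_real (Re a ^ 2 + Im a ^ 2) * \<sigma> [u, v]"
    unfolding J_skew[OF pos, of u] pos11D(4)[OF pos]
    by (simp add: scaleR_conv_of_real power2_eq_square algebra_simps)
  finally show ?thesis by (simp only: complex_mult_cnj)
qed

lemma pos11_pull:
  assumes pos: "pos11 \<sigma>" and g: "linear g" "\<And>a v. g (a *s v) = a *s g v" "\<And>v. v \<noteq> 0 \<Longrightarrow> g v \<noteq> 0"
  shows "pos11 (pull g \<sigma>)"
  unfolding pos11_def
  using alternating_pull[OF g(1) pos11D(1)[OF pos]] pos11D(2-5)[OF pos] g(2,3)
  by (auto simp: two_form_def real_valued_def pull_def)

lemma form_sum_apply: "(\<Sum>i\<in>I. f i) c z vs = (\<Sum>i\<in>I. f i c z vs)"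
  for f :: "'i \<Rightarrow> ('a, 'n) form"
  by (induction I rule: infinite_finite_induct) simp_all

lemma perturbed_form_apply:
  "(\<theta> + (\<Sum>i<m. scale_form (y i) (\<beta> i))) c z vs = \<theta> c z vs + (\<Sum>i<m. of_real (y i) * \<beta> i c z vs)"
  by (simp add: form_sum_apply scale_form_def)

lemma pq_formD:
  assumes "pq_form A p q \<alpha>"
  shows "smooth_form A \<alpha>" "length vs \<noteq> p + q \<Longrightarrow> \<alpha> c z vs = 0"
    "length vs = p + q \<Longrightarrow> \<alpha> c z (map ((*s) a) vs) = a ^ p * cnj a ^ q * \<alpha> c z vs"
  using assms unfolding pq_form_def by blast+

lemma pq_form_pull:
  assumes "pq_form A p q \<alpha>"
  shows "pull ((*s) a) (\<alpha> c z) = (\<lambda>vs. a ^ p * cnj a ^ q * \<alpha> c z vs)"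
proof
  fix vs show "pull ((*s) a) (\<alpha> c z) vs = a ^ p * cnj a ^ q * \<alpha> c z vs"
    by (cases "length vs = p + q") (simp_all add: pq_formD(2,3)[OF assms] pull_def)
qed

lemma real_form_valued: "real_form \<alpha> \<longleftrightarrow> (\<forall>c z. real_valued (\<alpha> c z))"
  by (auto simp: real_form_def conj_form_def real_valued_def fun_eq_iff Reals_cnj_iff)

lemma hermitian_metricD:
  assumes "hermitian_metric A \<omega>"
  shows "pq_form A 1 1 \<omega>" "real_form \<omega>" "real_valued (\<omega> c z)"
    "c \<in> A \<Longrightarrow> z \<in> chart_image c \<Longrightarrow> v \<noteq> 0 \<Longrightarrow> Re (\<omega> c z [v, \<i> *s v]) > 0"
  using assms unfolding hermitian_metric_def real_form_valued by blast+

context complex_atlas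
begin

lemma cont_pairs_smooth_form:
  assumes "smooth_form A \<alpha>" "c \<in> A" shows "cont_pairs (chart_image c) (\<alpha> c)"
  using smooth_formD(2)[OF assms(1,2)] smooth_formD(3)[OF assms]
  unfolding cont_pairs_def smooth_family_def by (blast intro: smooth_on_imp_continuous)

lemma cont_pairs_star:
  assumes "smooth_form A \<alpha>" "c \<in> A" shows "cont_pairs (chart_image c) (\<lambda>z. star (\<alpha> c z))"
  using smooth_family_star[OF open_chart[OF assms(2)] smooth_formD(3)[OF assms]]
  unfolding cont_pairs_def smooth_family_def by (blast intro: smooth_on_imp_continuous alternating_star)

lemma hermitian_metric_iff:
  "hermitian_metric A \<omega> \<longleftrightarrow> smooth_form A \<omega> \<and> (\<forall>c\<in>A. \<forall>z\<in>chart_image c. pos11 (\<omega> c z))"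
proof
  assume h: "hermitian_metric A \<omega>"
  then have pq: "pq_form A 1 1 \<omega>" and re: "real_form \<omega>" and s: "smooth_form A \<omega>"
    by (auto simp: hermitian_metric_def pq_form_def)
  have "pos11 (\<omega> c z)" if c: "c \<in> A" "z \<in> chart_image c" for c z
    unfolding pos11_def
  proof (intro conjI allI impI)
    show "two_form (\<omega> c z)" using pq_formD(2)[OF pq] by (simp add: two_form_def)
    show "\<omega> c z [\<i> *s u, \<i> *s v] = \<omega> c z [u, v]" for u v
      using fun_cong[OF pq_form_pull[OF pq, of \<i> c z], of "[u, v]"] by (simp add: pull_def)
  qed (use smooth_formD(2)[OF s c] hermitian_metricD(3,4)[OF h] c in blast)+
  with s show "smooth_form A \<omega> \<and> (\<forall>c\<in>A. \<forall>z\<in>chart_image c. pos11 (\<omega> c z))" by blast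
next
  assume h: "smooth_form A \<omega> \<and> (\<forall>c\<in>A. \<forall>z\<in>chart_image c. pos11 (\<omega> c z))"
  have out: "\<omega> c z = (\<lambda>_. 0)" if "\<not> (c \<in> A \<and> z \<in> chart_image c)" for c z
    using smooth_formD(1)[of A \<omega>] h that by blast
  have two: "length vs \<noteq> 2 \<Longrightarrow> \<omega> c z vs = 0" for c z vs
    using out[of c z] h pos11D(2)[of "\<omega> c z"] by (cases "c \<in> A \<and> z \<in> chart_image c") (auto simp: two_form_def)
  have "real_valued (\<omega> c z)" for c z
    using out[of c z] h pos11D(3)[of "\<omega> c z"]
    by (cases "c \<in> A \<and> z \<in> chart_image c") (auto simp: real_valued_def)
  then have re: "real_form \<omega>" by (simp only: real_form_valued) blast
  have sc: "\<omega> c z (map ((*s) a) vs) = a * cnj a * \<omega> c z vs" if len: "length vs = 2" for a c z vs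
  proof -
    obtain u v where vs: "vs = [u, v]"
      using len by (auto elim: length_2E)
    show ?thesis
      using out[of c z] h pos11_smult[of "\<omega> c z" a u v]
      by (cases "c \<in> A \<and> z \<in> chart_image c") (auto simp: vs)
  qed
  have "pq_form A 1 1 \<omega>"
    unfolding pq_form_def one_add_one power_one_right
    by (intro conjI allI impI) (rule conjunct1[OF h] two sc; assumption)+
  moreover have "Re (\<omega> c z [v, \<i> *s v]) > 0" if "c \<in> A" "z \<in> chart_image c" "v \<noteq> 0" for c z v
    using h that pos11D(5)[of "\<omega> c z" v] by blast
  ultimately show "hermitian_metric A \<omega>"
    using re unfolding hermitian_metric_def by blast
qed

text \<open>A metric detects nonzero vectors in every chart, so its compatibility with the transition maps
  makes their derivatives injective.\<close>

lemma dtrans_nonzero: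
  assumes "hermitian_metric A \<omega>" "c \<in> A" "c' \<in> A" "z \<in> overlap c c'" "v \<noteq> 0"
  shows "dtrans c c' z v \<noteq> 0"
proof
  assume 0: "dtrans c c' z v = 0"
  have s: "smooth_form A \<omega>" using assms(1) by (simp add: hermitian_metric_def pq_form_def)
  have "\<omega> c z [v, \<i> *s v] = \<omega> c' (transition c c' z) [0, 0]"
    unfolding smooth_formD(4)[OF s assms(2-4)] using dtrans_smult[OF assms(2-4), of \<i> v] 0
    by (simp add: pull_def)
  also have "\<dots> = 0"
    using alternating_not_distinct[OF smooth_formD(2)[OF s assms(3) transition_in[OF assms(2-4)]]] by simp
  finally show False
    using hermitian_metricD(4)[OF assms(1,2) subsetD[OF overlap_subset assms(4)] assms(5)] by simp
qed

lemma pos11_change_chart: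
  assumes "hermitian_metric A \<omega>" "c \<in> A" "c' \<in> A" "z \<in> overlap c c'" "pos11 \<sigma>"
  shows "pos11 (pull (dtrans c c' z) \<sigma>)"
  by (rule pos11_pull[OF assms(5) linear_dtrans[OF assms(2-4)] dtrans_smult[OF assms(2-4)]
        dtrans_nonzero[OF assms(1-4)]])

lemma hermitian_metric_add:
  assumes "hermitian_metric A \<omega>" "hermitian_metric A \<omega>'" shows "hermitian_metric A (\<omega> + \<omega>')"
  using assms smooth_form_add pos11_add unfolding hermitian_metric_iff
  by (fastforce simp: plus_fun_def)

lemma hermitian_metric_scale:
  assumes "hermitian_metric A \<omega>" "t > 0" shows "hermitian_metric A (scale_form t \<omega>)"
  using assms smooth_form_cscale[of \<omega> "of_real t"] pos11_scale unfolding hermitian_metric_iff scale_form_eq_cscale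
  by (auto simp: cscale_def)

lemma hermitian_metric_cycle:
  "hermitian_metric A \<omega> \<Longrightarrow> ErEr_closed A r \<omega> \<Longrightarrow> \<omega> \<in> Er_cycles A r 1 1"
  by (simp add: hermitian_metric_def Er_cycles_def)

end

text \<open>The common statement for the SKT cone (\<open>r = 1\<close>) and the Hermitian-symplectic cone (\<open>r = 3\<close>).\<close>

lemma open_convex_cone_of_metrics:
  assumes X: "compact_complex_manifold X A" and r: "r \<ge> 1"
  shows "open_convex_cone_in (real_aeppli A r 1)
    (aeppli_class A r 1 1 ` {\<omega>. hermitian_metric A \<omega> \<and> ErEr_closed A r \<omega>})"
proof -
  have M: "complex_manifold X A" using X by (simp add: compact_complex_manifold_def)
  interpret complex_atlas A by (rule complex_manifold_atlas[OF M])
  let ?G = "{\<omega>. hermitian_metric A \<omega> \<and> ErEr_closed A r \<omega>}"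
  show ?thesis
  proof (rule open_convex_cone_of_cycles[OF r])
    fix \<theta> assume "\<theta> \<in> ?G"
    then show "\<theta> \<in> Er_cycles A r 1 1" "real_form \<theta>"
      using hermitian_metric_cycle by (auto simp: hermitian_metric_def)
  next
    fix \<theta> and t :: real assume "\<theta> \<in> ?G" "t > 0"
    then show "scale_form t \<theta> \<in> ?G"
      using hermitian_metric_scale ErEr_closed_cscale[OF r]
      by (auto simp: scale_form_eq_cscale hermitian_metric_iff)
  next
    fix \<theta> \<theta>' assume "\<theta> \<in> ?G" "\<theta>' \<in> ?G"
    then show "\<theta> + \<theta>' \<in> ?G"
      using hermitian_metric_add ErEr_closed_add[OF r] by (auto simp: hermitian_metric_iff)
  next
    fix \<theta> and m :: nat and \<beta>
    assume \<theta>: "\<theta> \<in> ?G" and \<beta>: "\<And>i. i < m \<Longrightarrow> \<beta> i \<in> Er_cycles A r 1 1 \<and> real_form (\<beta> i)"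
    have h: "hermitian_metric A \<theta>" and \<theta>c: "\<theta> \<in> Er_cycles A r 1 1" and \<theta>r: "real_form \<theta>"
      using \<theta> hermitian_metric_cycle by (auto simp: hermitian_metric_def)
    let ?\<alpha> = "\<lambda>y. \<theta> + (\<Sum>i<m. scale_form (y i) (\<beta> i))"
    have \<alpha>: "?\<alpha> y \<in> Er_cycles A r 1 1" "real_form (?\<alpha> y)" for y
      by (rule perturbed_cycle[OF r \<theta>c \<theta>r \<beta>]; assumption)+
    obtain \<epsilon> where \<epsilon>: "\<epsilon> > 0" "\<And>y p. (\<forall>i<m. \<bar>y i\<bar> < \<epsilon>) \<Longrightarrow> p \<in> topspace X \<Longrightarrow>
        \<exists>c\<in>A. p \<in> fst c \<and> (\<forall>v. v \<noteq> 0 \<longrightarrow>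
          Re (\<theta> c (snd c p) [v, \<i> *s v] + (\<Sum>i<m. of_real (y i) * \<beta> i c (snd c p) [v, \<i> *s v])) > 0)"
    proof (rule positivity_stable[OF X, of \<theta> m \<beta>])
      show "cont_pairs (chart_image c) (\<theta> c)" if "c \<in> A" for c
        by (rule cont_pairs_smooth_form[OF Er_cycles_smooth[OF \<theta>c] that])
      show "cont_pairs (chart_image c) (\<beta> i c)" if "c \<in> A" "i < m" for c i
        by (rule cont_pairs_smooth_form[OF Er_cycles_smooth that(1)]) (use \<beta> that in blast)
      show "Re (\<theta> c z [v, \<i> *s v]) > 0" if "c \<in> A" "z \<in> chart_image c" "v \<noteq> 0" for c z v
        using hermitian_metricD(4)[OF h that] .
    qed blast
    have "?\<alpha> y \<in> ?G" if y: "\<forall>i<m. \<bar>y i\<bar> < \<epsilon>" for y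
    proof -
      have s: "smooth_form A (?\<alpha> y)" by (rule Er_cycles_smooth[OF \<alpha>(1)])
      have "Re (?\<alpha> y c z [v, \<i> *s v]) > 0" if c: "c \<in> A" and z: "z \<in> chart_image c" and v: "v \<noteq> 0" for c z v
      proof -
        obtain p where p: "z = snd c p" "p \<in> fst c" using z by blast
        have "p \<in> topspace X" using M c p(2) unfolding complex_manifold_def by blast
        from \<epsilon>(2)[OF y this] obtain c' where c': "c' \<in> A" "p \<in> fst c'" and
          pos: "\<And>v. v \<noteq> 0 \<Longrightarrow> Re (?\<alpha> y c' (snd c' p) [v, \<i> *s v]) > 0"
          unfolding perturbed_form_apply by blast
        have ov: "z \<in> overlap c c'" using p c'(2) by (auto simp: overlap_def)
        have "?\<alpha> y c z [v, \<i> *s v] = ?\<alpha> y c' (snd c' p) [dtrans c c' z v, \<i> *s dtrans c c' z v]"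
          unfolding smooth_formD(4)[OF s c c'(1) ov]
          by (simp only: pull_def list.map dtrans_smult[OF c c'(1) ov, unfolded p(1)] p(1) transition_chart[OF M c p(2)])
        then show ?thesis using pos[OF dtrans_nonzero[OF h c c'(1) ov v]] by metis
      qed
      then show ?thesis
        using \<alpha>[of y] by (simp add: hermitian_metric_def Er_cycles_def)
    qed
    with \<epsilon>(1) show "\<exists>\<epsilon>>0. \<forall>y. (\<forall>i<m. \<bar>y i\<bar> < \<epsilon>) \<longrightarrow> ?\<alpha> y \<in> ?G" by blast
  qed
qed

lemma open_convex_SKT_cone:
  assumes "compact_complex_manifold X A"
  shows "open_convex_cone_in (real_aeppli A 1 1) (SKT_cone A)"
proof -
  have "SKT_cone A = aeppli_class A 1 1 1 ` {\<omega>. hermitian_metric A \<omega> \<and> ErEr_closed A 1 \<omega>}"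
    by (auto simp: SKT_cone_def SKT_metric_def ErEr_closed_def)
  then show ?thesis using open_convex_cone_of_metrics[OF assms, of 1] by simp
qed

section \<open>The Hermitian-symplectic cone\<close>

text \<open>The components of a form of degree 3 of the four bidegrees are independent, as the characters
  \<open>a\<^sup>p (cnj a)\<^sup>q\<close> are; the values \<open>1\<close>, \<open>i\<close>, \<open>1 + i\<close> and \<open>1 + 2i\<close> of \<open>a\<close> suffice to see it.\<close>

lemma four_types_independent:
  assumes "\<And>a::complex. a ^ 3 * x + a ^ 2 * cnj a * y + a * cnj a ^ 2 * z + cnj a ^ 3 * w = 0"
  shows "x = 0 \<and> y = 0 \<and> z = 0 \<and> w = 0"
proof -
  have e1: "x + y + z + w = 0" using assms[of 1] by simp
  have "- \<i> * (x - y + z - w) = 0"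
    using assms[of \<i>] by (simp add: power3_eq_cube power2_eq_square algebra_simps)
  then have e2: "x - y + z - w = 0" by simp
  have "(x + y + z + w) + (x - y + z - w) = 0" "(x + y + z + w) - (x - y + z - w) = 0"
    unfolding e1 e2 by simp_all
  then have z: "z = - x" and w: "w = - y"
    by (simp_all add: algebra_simps add_eq_0_iff2 flip: mult_2)
  \<comment> \<open>the remaining two values of \<open>a\<close> give real linear equations for the coordinates of \<open>x\<close> and \<open>y\<close>\<close>
  have p1: "Complex 1 1 ^ 3 = Complex (-2) 2" "Complex 1 1 ^ 2 * cnj (Complex 1 1) = Complex 2 2"
    "Complex 1 1 * cnj (Complex 1 1) ^ 2 = Complex 2 (-2)" "cnj (Complex 1 1) ^ 3 = Complex (-2) (-2)"
    "Complex 1 2 ^ 3 = Complex (-11) (-2)" "Complex 1 2 ^ 2 * cnj (Complex 1 2) = Complex 5 10"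
    "Complex 1 2 * cnj (Complex 1 2) ^ 2 = Complex 5 (-10)" "cnj (Complex 1 2) ^ 3 = Complex (-11) 2"
    by (simp_all add: power3_eq_cube power2_eq_square complex_eq_iff)
  have f: "Re x + Im y = 0" "Im x = Re y" "2 * Re x + Im x = 2 * Re y - Im y" "Re x - 2 * Im x = - Re y - 2 * Im y"
    using assms[of "Complex 1 1"] assms[of "Complex 1 2"] unfolding p1 z w
    by (simp_all add: complex_eq_iff algebra_simps)
  then have "Re x = 0" "Im x = 0" "Re y = 0" "Im y = 0" by linarith+
  then show ?thesis unfolding z w by (simp add: complex_eq_iff)
qed

lemma pq_form_rot: "pq_form A p q \<alpha> \<Longrightarrow> rot a \<alpha> = cscale (a ^ p * cnj a ^ q) \<alpha>"
  by (simp add: rot_def cscale_def pq_form_pull fun_eq_iff)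

lemma cscale_cscale: "cscale a (cscale b \<alpha>) = cscale (a * b) \<alpha>"
  by (simp add: cscale_def mult.assoc)

lemma cscale_one: "cscale 1 \<alpha> = \<alpha>"
  by (simp add: cscale_def)

lemma cscale_plus_cscale: "cscale a \<alpha> + cscale b \<alpha> = cscale (a + b) \<alpha>"
  by (simp add: cscale_def fun_eq_iff algebra_simps)

lemma conj_form_conj_form: "conj_form (conj_form \<alpha>) = \<alpha>"
  by (simp add: conj_form_def)

lemma conj_form_cscale: "conj_form (cscale a \<alpha>) = cscale (cnj a) (conj_form \<alpha>)"
  by (simp add: conj_form_def cscale_def)

lemma pq_form_conj:
  assumes "complex_atlas A" "pq_form A p q \<alpha>" shows "pq_form A q p (conj_form \<alpha>)"
  using assms complex_atlas.smooth_form_conj[OF assms(1)]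
  by (simp add: pq_form_def conj_form_def add.commute mult_ac)

lemma rot_smult_expand:
  assumes "alternating f"
  shows "f [(1 + \<i>) *s u, (1 + \<i>) *s v] = f [u, v] + f [\<i> *s u, v] + f [u, \<i> *s v] + f [\<i> *s u, \<i> *s v]"
    "f [(1 - \<i>) *s u, (1 - \<i>) *s v] = f [u, v] - f [\<i> *s u, v] - f [u, \<i> *s v] + f [\<i> *s u, \<i> *s v]"
proof -
  note l = linear_add[OF alternating_pair(1)[OF assms]] linear_add[OF alternating_pair(2)[OF assms]]
    linear_diff[OF alternating_pair(1)[OF assms]] linear_diff[OF alternating_pair(2)[OF assms]]
  have "(1 + \<i>) *s w = w + \<i> *s w" "(1 - \<i>) *s w = w - \<i> *s w" for w :: "complex ^ 'b"
    by (simp_all add: vec_eq_iff algebra_simps)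
  then show "f [(1 + \<i>) *s u, (1 + \<i>) *s v] = f [u, v] + f [\<i> *s u, v] + f [u, \<i> *s v] + f [\<i> *s u, \<i> *s v]"
    "f [(1 - \<i>) *s u, (1 - \<i>) *s v] = f [u, v] - f [\<i> *s u, v] - f [u, \<i> *s v] + f [\<i> *s u, \<i> *s v]"
    by (simp_all add: l)
qed

text \<open>The projection of forms of degree 2 to bidegree \<open>(2,0)\<close>. The coefficients \<open>c\<^sub>a\<close> for \<open>a = 1, i, 1 + i, 1 - i\<close>
  solve \<open>\<Sum> c\<^sub>a a\<^sup>2 = 1\<close>, \<open>\<Sum> c\<^sub>a a cnj a = 0\<close>, \<open>\<Sum> c\<^sub>a (cnj a)\<^sup>2 = 0\<close> and \<open>\<Sum> c\<^sub>a (cnj a)\<^sup>3 / a = 0\<close>. The first three conditions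
  single out the bidegree; the last one is needed when the derivatives of the projection are computed.\<close>

definition proj20 :: "('a, 'n::finite) form \<Rightarrow> ('a, 'n) form"
  where "proj20 \<eta> = cscale (1 / 4) \<eta> + cscale (- 1 / 4) (rot \<i> \<eta>)
    + cscale (- \<i> / 8) (rot (1 + \<i>) \<eta>) + cscale (\<i> / 8) (rot (1 - \<i>) \<eta>)"

text \<open>A closed expression in which complex bilinearity of the projection is visible.\<close>

lemma proj20_pair:
  assumes "alternating (\<eta> c z)"
  shows "proj20 \<eta> c z [u, v] = (\<eta> c z [u, v] - \<eta> c z [\<i> *s u, \<i> *s v]
    - \<i> * (\<eta> c z [\<i> *s u, v] + \<eta> c z [u, \<i> *s v])) / 4"
  unfolding proj20_def plus_fun_apply cscale_def rot_def pull_def list.map rot_smult_expand[OF assms]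
  by (simp add: field_simps)

context complex_atlas
begin

lemma smooth_form_outside:
  "smooth_form A \<eta> \<Longrightarrow> \<not> (c \<in> A \<and> z \<in> chart_image c) \<Longrightarrow> \<eta> c z vs = 0"
  using smooth_formD(1) by metis

lemma pq_form_proj20:
  assumes s: "smooth_form A \<eta>" and len: "\<And>c z vs. length vs \<noteq> 2 \<Longrightarrow> \<eta> c z vs = 0"
  shows "pq_form A 2 0 (proj20 \<eta>)"
  unfolding pq_form_def
proof (intro conjI allI impI)
  show "smooth_form A (proj20 \<eta>)"
    unfolding proj20_def by (intro smooth_form_add smooth_form_cscale smooth_form_rot s)
  show "proj20 \<eta> c z vs = 0" if "length vs \<noteq> 2 + 0" for c z vs
    using that by (simp add: proj20_def cscale_def rot_def pull_def len)
  fix c z vs a assume "length (vs :: (complex ^ 'n) list) = 2 + 0"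
  then obtain u v where vs: "vs = [u, v]"
    by (auto elim: length_2E)
  show "proj20 \<eta> c z (map ((*s) a) vs) = a ^ 2 * cnj a ^ 0 * proj20 \<eta> c z vs"
  proof (cases "c \<in> A \<and> z \<in> chart_image c")
    case False
    then show ?thesis
      using smooth_form_outside[OF s] by (simp add: proj20_def cscale_def rot_def pull_def)
  next
    case True
    then have alt: "alternating (\<eta> c z)" using smooth_formD(2)[OF s] by blast
    define q where "q u v = proj20 \<eta> c z [u, v]" for u v
    note l = alternating_pair(1,2)[OF alt]
    have lin: "linear (\<lambda>u. q u v)" "linear (\<lambda>v. q u v)" for u v
      unfolding q_def proj20_pair[of \<eta>, OF alt]
      by (rule linearI; simp only: vector_add_ldistrib linear_add[OF l(1)] linear_add[OF l(2)]
        linear_scale[OF l(1)] linear_scale[OF l(2)] linear_scale[OF linear_vector_smult];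
        simp add: algebra_simps add_divide_distrib diff_divide_distrib scaleR_conv_of_real)+
    have m: "\<eta> c z [- u, v] = - \<eta> c z [u, v]" "\<eta> c z [u, - v] = - \<eta> c z [u, v]" for u v
      by (rule linear_neg[OF l(1)] linear_neg[OF l(2)])+
    have J: "q (\<i> *s u) v = \<i> * q u v" "q u (\<i> *s v) = \<i> * q u v" for u v
      unfolding q_def proj20_pair[of \<eta>, OF alt] by (simp_all add: m field_simps)
    have c: "x *\<^sub>R y = of_real x * y" for x and y :: complex by (rule scaleR_conv_of_real)
    have "q (a *s u) w = a * q u w" for u w
      unfolding vector_smult_complex[of a] linear_add[OF lin(1)] linear_scale[OF lin(1)] J c
      by (subst (5) complex_eq) (simp add: algebra_simps)
    moreover have "q u (a *s w) = a * q u w" for u w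
      unfolding vector_smult_complex[of a] linear_add[OF lin(2)] linear_scale[OF lin(2)] J c
      by (subst (5) complex_eq) (simp add: algebra_simps)
    ultimately show ?thesis by (simp add: vs power2_eq_square flip: q_def)
  qed
qed

text \<open>The four bidegrees of \<open>d(cnj \<rho> + \<omega> + \<rho>) = 0\<close> say that \<open>- cnj \<rho>\<close> and \<open>- \<rho>\<close> solve the equations of
  \<open>E\<^sub>3\<close>-closedness, with 0 in the second step.\<close>

lemma HS_imp_E3_closed:
  assumes "HS_metric A \<omega>" shows "ErEr_closed A 3 \<omega>"
proof -
  obtain \<rho> where \<rho>: "pq_form A 0 2 \<rho>" "ext_d A (conj_form \<rho> + \<omega> + \<rho>) = 0" and \<omega>: "pq_form A 1 1 \<omega>"
    using assms by (auto simp: HS_metric_def hermitian_metric_def)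
  define b where "b = conj_form \<rho>"
  have b: "pq_form A 2 0 b"
    unfolding b_def by (rule pq_form_conj[OF complex_atlas_axioms \<rho>(1)])
  have s: "smooth_form A \<rho>" "smooth_form A \<omega>" "smooth_form A b"
    using \<rho>(1) \<omega> b by (auto simp: pq_form_def)
  have sum: "del A b + (delbar A b + del A \<omega>) + (delbar A \<omega> + del A \<rho>) + delbar A \<rho> = 0"
    using \<rho>(2) unfolding b_def[symmetric] ext_d_eq
    by (simp add: del_delbar_add smooth_form_add s add_ac)
  have r: "rot a (del A b) = cscale (a ^ 3) (del A b)" "rot a (delbar A b) = cscale (a ^ 2 * cnj a) (delbar A b)"
    "rot a (del A \<omega>) = cscale (a ^ 2 * cnj a) (del A \<omega>)" "rot a (delbar A \<omega>) = cscale (a * cnj a ^ 2) (delbar A \<omega>)"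
    "rot a (del A \<rho>) = cscale (a * cnj a ^ 2) (del A \<rho>)" "rot a (delbar A \<rho>) = cscale (cnj a ^ 3) (delbar A \<rho>)" for a
    by (simp_all add: rot_del_delbar s pq_form_rot[OF b] pq_form_rot[OF \<omega>] pq_form_rot[OF \<rho>(1)]
        del_delbar_cscale cscale_cscale power2_eq_square power3_eq_cube mult_ac)
  have types: "del A b c z vs = 0 \<and> delbar A b c z vs + del A \<omega> c z vs = 0 \<and>
      delbar A \<omega> c z vs + del A \<rho> c z vs = 0 \<and> delbar A \<rho> c z vs = 0" for c z vs
  proof (rule four_types_independent)
    fix a
    have "(rot a (del A b) + (rot a (delbar A b) + rot a (del A \<omega>)) + (rot a (delbar A \<omega>) + rot a (del A \<rho>))
        + rot a (delbar A \<rho>)) c z vs = 0"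
      using fun_cong[OF fun_cong[OF fun_cong[OF sum]], of c z "map ((*s) a) vs"]
      by (simp add: rot_def pull_def)
    then show "a ^ 3 * del A b c z vs + a ^ 2 * cnj a * (delbar A b c z vs + del A \<omega> c z vs)
        + a * cnj a ^ 2 * (delbar A \<omega> c z vs + del A \<rho> c z vs) + cnj a ^ 3 * delbar A \<rho> c z vs = 0"
      unfolding r by (simp add: cscale_def algebra_simps)
  qed
  have z: "zigzag A 3 \<omega> (\<lambda>i. if i = 1 then cscale (-1) b else 0) (\<lambda>i. if i = 1 then cscale (-1) \<rho> else 0)"
  proof -
    have t: "del A b c z vs = 0" "delbar A b c z vs + del A \<omega> c z vs = 0"
      "delbar A \<omega> c z vs + del A \<rho> c z vs = 0" "delbar A \<rho> c z vs = 0" for c z vs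
      using types by blast+
    have "del A \<omega> = cscale (-1) (delbar A b)"
      by (intro ext) (use t(2) in \<open>simp add: cscale_def add_eq_0_iff\<close>)
    moreover have "delbar A \<omega> = cscale (-1) (del A \<rho>)"
      by (intro ext) (use t(3) in \<open>simp add: cscale_def eq_neg_iff_add_eq_0\<close>)
    moreover have "del A b = 0" "delbar A \<rho> = 0"
      by (intro ext, use t(1,4) in simp)+
    ultimately show ?thesis
      unfolding zigzag_def
      by (auto simp: smooth_form_cscale smooth_form_zero s del_delbar_cscale del_delbar_zero cscale_zero)
  qed
  then show ?thesis by (auto simp: ErEr_closed_iff_zigzag)
qed

text \<open>Conversely, let \<open>del \<omega> = delbar \<eta>\<^sub>1\<close> and \<open>del \<eta>\<^sub>1 = delbar \<eta>\<^sub>2\<close>. The \<open>(2,0)\<close>-part \<open>Q\<close> of \<open>\<eta>\<^sub>1\<close> satisfies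
  \<open>delbar Q = del \<omega>\<close> and \<open>del Q = 0\<close>, because \<open>\<eta>\<^sub>2\<close> would have to contribute a part of bidegree \<open>(3,-1)\<close>.
  Hence \<open>\<rho> = - cnj Q\<close> is the form required, \<open>\<omega>\<close> being real.\<close>

lemma E3_closed_imp_HS:
  assumes h: "hermitian_metric A \<omega>" and E3: "ErEr_closed A 3 \<omega>" shows "HS_metric A \<omega>"
proof -
  have \<omega>: "pq_form A 1 1 \<omega>" and re: "conj_form \<omega> = \<omega>" and s: "smooth_form A \<omega>"
    using h by (auto simp: hermitian_metric_def pq_form_def real_form_def)
  obtain \<eta> \<rho> where z: "zigzag A 3 \<omega> \<eta> \<rho>" using E3 by (auto simp: ErEr_closed_iff_zigzag)
  define e1 where "e1 = deg_part 2 (\<eta> 1)"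
  define e2 where "e2 = deg_part 2 (\<eta> 2)"
  have se: "smooth_form A e1" "smooth_form A e2"
    using z unfolding zigzag_def e1_def e2_def by (auto intro!: smooth_form_deg_part)
  have len: "length vs \<noteq> 2 \<Longrightarrow> e1 c z vs = 0" "length vs \<noteq> 2 \<Longrightarrow> e2 c z vs = 0" for c z vs
    by (simp_all add: e1_def e2_def deg_part_def)
  have \<omega>2: "deg_part 2 \<omega> = \<omega>" using pq_formD(2)[OF \<omega>] by (simp add: deg_part_def fun_eq_iff)
  have d1: "delbar A e1 = del A \<omega>"
    using z del_delbar_deg_part(1)[of 2 \<omega>] by (simp add: zigzag_def e1_def del_delbar_deg_part \<omega>2)
  have "del A (\<eta> 1) = delbar A (\<eta> 2)" using z by (simp add: zigzag_def numeral_2_eq_2)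
  then have d2: "del A e1 = delbar A e2"
    by (simp add: e1_def e2_def del_delbar_deg_part)
  have T: "rot a (del A \<omega>) = cscale (a ^ 2 * cnj a) (del A \<omega>)" for a
    by (simp add: rot_del_delbar s pq_form_rot[OF \<omega>] del_delbar_cscale cscale_cscale power2_eq_square mult_ac)
  have r1: "delbar A (rot a e1) = cscale (a ^ 2) (del A \<omega>)" if "a \<noteq> 0" for a
  proof -
    have "delbar A (rot a e1) = cscale (1 / cnj a) (rot a (delbar A e1))"
      using that by (simp add: rot_del_delbar se cscale_cscale cscale_one)
    then show ?thesis using that by (simp add: d1 T cscale_cscale)
  qed
  have r2: "del A (rot a e1) = cscale (cnj a / a) (delbar A (rot a e2))" if "a \<noteq> 0" for a
  proof -
    have "del A (rot a e1) = cscale (1 / a) (rot a (del A e1))"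
      using that by (simp add: rot_del_delbar se cscale_cscale cscale_one)
    then show ?thesis using that by (simp add: d2 rot_del_delbar se cscale_cscale)
  qed
  have a0: "1 + \<i> \<noteq> 0" "1 - \<i> \<noteq> 0" by (simp_all add: complex_eq_iff)
  have a1: "cnj (1 + \<i>) / (1 + \<i>) = - \<i>" "cnj (1 - \<i>) / (1 - \<i>) = \<i>"
    using a0 by (simp_all add: divide_eq_eq algebra_simps)
  have a2: "(1 + \<i>) ^ 2 = 2 * \<i>" "(1 - \<i>) ^ 2 = - 2 * \<i>"
    by (simp_all add: power2_eq_square algebra_simps)
  have r2': "del A (rot \<i> e1) = cscale (- 1) (delbar A (rot \<i> e2))"
    "del A (rot (1 + \<i>) e1) = cscale (- \<i>) (delbar A (rot (1 + \<i>) e2))"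
    "del A (rot (1 - \<i>) e1) = cscale \<i> (delbar A (rot (1 - \<i>) e2))"
    using r2[of \<i>] r2[OF a0(1)] r2[OF a0(2)] unfolding a1 by simp_all
  define Q where "Q = proj20 e1"
  have Q: "pq_form A 2 0 Q" unfolding Q_def by (rule pq_form_proj20[OF se(1) len(1)])
  then have sQ: "smooth_form A Q" by (simp add: pq_form_def)
  have dQ: "delbar A Q = del A \<omega>"
  proof -
    have "delbar A Q = cscale (1 / 4 + (- 1 / 4) * \<i> ^ 2 + (- \<i> / 8) * (1 + \<i>) ^ 2 + (\<i> / 8) * (1 - \<i>) ^ 2) (del A \<omega>)"
      unfolding Q_def proj20_def
      by (simp add: del_delbar_add del_delbar_cscale smooth_form_add smooth_form_cscale smooth_form_rot se
          r1 a0 d1 cscale_cscale cscale_plus_cscale)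
    also have "1 / 4 + (- 1 / 4) * \<i> ^ 2 + (- \<i> / 8) * (1 + \<i>) ^ 2 + (\<i> / 8) * (1 - \<i>) ^ 2 = 1"
      unfolding a2 by (simp add: algebra_simps)
    finally show ?thesis by (simp add: cscale_one)
  qed
  have delQ: "del A Q = 0"
  proof -
    \<comment> \<open>by \<open>r2\<close> the coefficients change by \<open>cnj a / a\<close>; the new combination kills the types \<open>(2,0)\<close>, \<open>(1,1)\<close> and \<open>(0,2)\<close>\<close>
    define k where "k = cscale (1 / 4) e2 + cscale (1 / 4) (rot \<i> e2)
      + cscale (- 1 / 8) (rot (1 + \<i>) e2) + cscale (- 1 / 8) (rot (1 - \<i>) e2)"
    have "del A Q = delbar A k"
      unfolding Q_def proj20_def k_def
      by (simp add: del_delbar_add del_delbar_cscale smooth_form_add smooth_form_cscale smooth_form_rot se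
          r2' d2 cscale_cscale)
    moreover have "k = 0"
    proof (intro ext)
      fix c z vs
      show "k c z vs = (0 :: ('a, 'n) form) c z vs"
      proof (cases "c \<in> A \<and> z \<in> chart_image c \<and> length vs = 2")
        case True
        then obtain u v where vs: "vs = [u, v]"
          by (auto elim: length_2E)
        have "alternating (e2 c z)" using True smooth_formD(2)[OF se(2)] by blast
        then show ?thesis
          unfolding vs k_def plus_fun_apply cscale_def rot_def pull_def list.map
          by (simp only: rot_smult_expand) (simp add: field_simps)
      next
        case False
        then have "e2 c z (map g vs) = 0" for g
          using smooth_form_outside[OF se(2), of c z "map g vs"] len(2)[of "map g vs" c z]
            length_map[of g vs] by metis
        from this[of "\<lambda>x. x"] this show ?thesis
          by (simp add: k_def cscale_def rot_def pull_def)
      qed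
    qed
    ultimately show ?thesis by (simp add: del_delbar_zero)
  qed
  define R where "R = conj_form (cscale (-1) Q)"
  have sR: "smooth_form A (cscale (-1) Q)" by (rule smooth_form_cscale[OF sQ])
  have R: "pq_form A 0 2 R"
    unfolding R_def by (intro pq_form_conj pq_form_cscale complex_atlas_axioms Q)
  then have sR': "smooth_form A R" by (simp add: pq_form_def)
  have cR: "conj_form R = cscale (-1) Q" by (simp add: R_def conj_form_conj_form)
  have 1: "del A (conj_form R) = 0" "delbar A (conj_form R) = cscale (-1) (del A \<omega>)"
    unfolding cR by (simp_all add: del_delbar_cscale sQ delQ dQ cscale_zero)
  have 2: "delbar A R = 0" "del A R = cscale (-1) (conj_form (del A \<omega>))"
    unfolding R_def del_delbar_conj[OF sR] del_delbar_cscale[OF sQ] delQ dQ cscale_zero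
    by (simp_all add: conj_form_cscale) (simp add: conj_form_def fun_eq_iff)
  have 3: "delbar A \<omega> = conj_form (del A \<omega>)"
    using del_delbar_conj(2)[OF s] by (simp add: re)
  have "ext_d A (conj_form R + \<omega> + R) = 0"
    unfolding ext_d_eq
    by (simp add: del_delbar_add smooth_form_add smooth_form_conj s sR' 1 2 3)
      (simp add: cscale_def fun_eq_iff)
  with h R show ?thesis by (auto simp: HS_metric_def)
qed

end

lemma open_convex_HS_cone:
  assumes "compact_complex_manifold X A"
  shows "open_convex_cone_in (real_aeppli A 3 1) (HS_cone A)"
proof -
  interpret complex_atlas A
    using assms complex_manifold_atlas unfolding compact_complex_manifold_def by blast
  have "HS_cone A = aeppli_class A 3 1 1 ` {\<omega>. hermitian_metric A \<omega> \<and> ErEr_closed A 3 \<omega>}"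
    using HS_imp_E3_closed E3_closed_imp_HS by (auto simp: HS_cone_def HS_metric_def)
  then show ?thesis using open_convex_cone_of_metrics[OF assms, of 3] by simp
qed

section \<open>The strongly Gauduchon cone\<close>

lemma wedge_power_zero: "m \<ge> 1 \<Longrightarrow> wedge_power (\<lambda>_. 0) m = (\<lambda>_. 0)"
  by (cases m) simp_all

lemma form_power_eq_wedge_power:
  assumes "smooth_form A \<omega>" "m \<ge> 1"
  shows "form_power A \<omega> m = (\<lambda>c z. wedge_power (\<omega> c z) m)"
proof (intro ext)
  fix c z vs
  show "form_power A \<omega> m c z vs = wedge_power (\<omega> c z) m vs"
  proof (cases "c \<in> A \<and> z \<in> chart_image c")
    case True
    have "form_power A \<omega> k c z = wedge_power (\<omega> c z) k" for k
    proof (induction k)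
      case 0
      show ?case using True by (simp add: unit_form_def fun_eq_iff)
    qed simp
    then show ?thesis by simp
  next
    case False
    then have "\<omega> c z = (\<lambda>_. 0)" by (rule smooth_formD(1)[OF assms(1)])
    with assms(2) show ?thesis by (cases m) simp_all
  qed
qed

lemma star_zero: "star (\<lambda>_. 0) = (\<lambda>_. 0)"
  by (simp add: star_def fun_eq_iff)

lemma root_form_zero:
  assumes "m \<ge> 1"
  shows "root_form m (\<lambda>_ :: (complex ^ 'n::finite) list. 0) = (\<lambda>_. 0)"
  by (simp add: root_form_def star_zero wedge_power_zero[OF assms])

lemma star_perturbed:
  fixes m :: nat
  shows "star (\<lambda>vs. f vs + (\<Sum>i<m. y i * g i vs)) us = star f us + (\<Sum>i<m. y i * star (g i) us)"
proof (induction m)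
  case (Suc m)
  have "(\<lambda>vs. f vs + (\<Sum>i<Suc m. y i * g i vs))
    = (\<lambda>vs. (f vs + (\<Sum>i<m. y i * g i vs)) + y m * g m vs)"
    by (simp add: add.assoc)
  then show ?case
    using Suc.IH by (simp only: star_add star_scale) (simp add: add.assoc)
qed simp

text \<open>The powers \<open>\<omega>\<^bsup>n-1\<^esup>\<close> of sG metrics, characterized without reference to \<open>\<omega>\<close>; in this form the set is
  visibly convex.\<close>

definition positive_cycles :: "('a, 'n::finite) chart set \<Rightarrow> ('a, 'n) form set"
  where "positive_cycles A = {\<alpha> \<in> Er_cycles A 2 (CARD('n) - 1) (CARD('n) - 1). real_form \<alpha> \<and>
    (\<forall>c\<in>A. \<forall>z\<in>chart_image c. pos11 (star (\<alpha> c z)))}"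

text \<open>Any metric \<open>\<omega>0\<close> makes the derivatives of the transition maps injective (\<open>dtrans_nonzero\<close>), as changes of
  charts require; if there is none, the sG cone is empty. The exponent \<open>n - 1\<close> is called \<open>k\<close>.\<close>

locale metric_atlas = complex_atlas A for A :: "('a, 'n::finite) chart set" +
  fixes \<omega>0 and k :: nat
  assumes n: "CARD('n) = Suc k" and k: "k \<ge> 1" and metric: "hermitian_metric A \<omega>0"
begin

lemma pq_form_eq_0: "pq_form A k k \<alpha> \<Longrightarrow> length vs \<noteq> 2 * k \<Longrightarrow> \<alpha> c z vs = 0"
  by (rule pq_formD(2)) auto

lemma positive_cyclesI:
  assumes "\<alpha> \<in> Er_cycles A 2 k k" "real_form \<alpha>"
    "\<And>c z. c \<in> A \<Longrightarrow> z \<in> chart_image c \<Longrightarrow> pos11 (star (\<alpha> c z))"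
  shows "\<alpha> \<in> positive_cycles A"
  using assms unfolding positive_cycles_def n diff_Suc_1 by blast

lemma positive_cyclesD:
  assumes "\<alpha> \<in> positive_cycles A"
  shows "\<alpha> \<in> Er_cycles A 2 k k" "real_form \<alpha>"
    "c \<in> A \<Longrightarrow> z \<in> chart_image c \<Longrightarrow> pos11 (star (\<alpha> c z))"
  using assms unfolding positive_cycles_def n diff_Suc_1 by blast+

lemma form_power_pq:
  assumes "hermitian_metric A \<omega>"
  shows "pq_form A k k (form_power A \<omega> k)" "real_form (form_power A \<omega> k)"
proof -
  have pq: "pq_form A 1 1 \<omega>" and s: "smooth_form A \<omega>" and re: "real_form \<omega>"
    using assms by (auto simp: hermitian_metric_def pq_form_def)
  have eq: "form_power A \<omega> k = (\<lambda>c z. wedge_power (\<omega> c z) k)"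
    by (rule form_power_eq_wedge_power[OF s k])
  have two: "two_form (\<omega> c z)" for c z using pq_formD(2)[OF pq] by (simp add: two_form_def)
  show "real_form (form_power A \<omega> k)"
    using re unfolding eq real_form_valued by (simp add: real_valued_wedge_power)
  show "pq_form A k k (form_power A \<omega> k)"
    unfolding pq_form_def eq
  proof (intro conjI allI impI)
    show "smooth_form A (\<lambda>c z. wedge_power (\<omega> c z) k)"
      by (rule smooth_form_map[OF s, of "\<lambda>f. wedge_power f k"])
        (simp_all add: wedge_power_zero[OF k] alternating_wedge_power smooth_formD[OF s] smooth_family_wedge_power open_chart pull_wedge_power)
    show "wedge_power (\<omega> c z) k vs = 0" if "length vs \<noteq> k + k" for c z vs
      using wedge_power_eq_0_if_length[OF two, of vs k] that by simp
    fix c z vs a assume "length (vs :: (complex ^ 'n) list) = k + k"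
    have "wedge_power (\<omega> c z) k (map ((*s) a) vs) = pull ((*s) a) (wedge_power (\<omega> c z) k) vs" by (simp add: pull_def)
    also have "\<dots> = wedge_power (\<lambda>vs. (a * cnj a) * \<omega> c z vs) k vs"
      unfolding pull_wedge_power pq_form_pull[OF pq] by simp
    also have "\<dots> = a ^ k * cnj a ^ k * wedge_power (\<omega> c z) k vs"
      unfolding wedge_power_scale by (simp add: power_mult_distrib)
    finally show "wedge_power (\<omega> c z) k (map ((*s) a) vs) = a ^ k * cnj a ^ k * wedge_power (\<omega> c z) k vs" .
  qed
qed

text \<open>Since \<open>\<omega>\<^sup>k\<close> is real, conjugating \<open>del \<omega>\<^sup>k = delbar \<eta>\<close> yields the second of the two equations of
  \<open>E\<^sub>2\<close>-closedness.\<close>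

lemma form_power_in_positive_cycles:
  assumes "sG_metric A \<omega>" shows "form_power A \<omega> k \<in> positive_cycles A"
proof -
  let ?\<theta> = "form_power A \<omega> k"
  obtain \<eta> where h: "hermitian_metric A \<omega>" and \<eta>: "smooth_form A \<eta>" "del A ?\<theta> = delbar A \<eta>"
    using assms by (auto simp: sG_metric_def n)
  note pq = form_power_pq[OF h]
  have s: "smooth_form A ?\<theta>" using pq(1) by (simp add: pq_form_def)
  have "delbar A ?\<theta> = del A (conj_form \<eta>)"
    using del_delbar_conj(2)[OF s] del_delbar_conj(1)[OF \<eta>(1)] pq(2) \<eta>(2) by (simp add: real_form_def)
  then have "zigzag A 2 ?\<theta> (\<lambda>_. \<eta>) (\<lambda>_. conj_form \<eta>)"
    using \<eta> smooth_form_conj by (simp add: zigzag_def)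
  then have "ErEr_closed A 2 ?\<theta>" by (auto simp: ErEr_closed_iff_zigzag)
  moreover have "pos11 (star (?\<theta> c z))" if "c \<in> A" "z \<in> chart_image c" for c z
  proof -
    have "pos11 (\<omega> c z)" "smooth_form A \<omega>" using h that unfolding hermitian_metric_iff by blast+
    then show ?thesis using pos11_star_wedge_power[OF _ n] by (simp only: form_power_eq_wedge_power[OF _ k])
  qed
  ultimately show ?thesis using pq by (intro positive_cyclesI) (simp_all add: Er_cycles_def)
qed

text \<open>The root is taken in each chart separately. By uniqueness of roots the results agree under the
  transition maps, although \<open>star\<close> itself depends on the chart.\<close>

lemma positive_cycle_root:
  assumes "\<alpha> \<in> positive_cycles A"
  obtains \<omega> where "sG_metric A \<omega>" "form_power A \<omega> k = \<alpha>"
proof -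
  have pq: "pq_form A k k \<alpha>" and E2: "ErEr_closed A 2 \<alpha>" and pos: "\<And>c z. c \<in> A \<Longrightarrow> z \<in> chart_image c \<Longrightarrow> pos11 (star (\<alpha> c z))"
    using positive_cyclesD[OF assms] unfolding Er_cycles_def by blast+
  then have s: "smooth_form A \<alpha>" by (simp add: pq_form_def)
  define \<omega> where "\<omega> = (\<lambda>c z. root_form k (\<alpha> c z))"
  have root: "pos11 (\<omega> c z)" "wedge_power (\<omega> c z) k = \<alpha> c z" if "c \<in> A" "z \<in> chart_image c" for c z
    unfolding \<omega>_def
    using root_form[OF n k smooth_formD(2)[OF s that] pq_form_eq_0[OF pq] pos[OF that]] by blast+
  have "smooth_form A \<omega>"
    unfolding \<omega>_def
  proof (rule smooth_form_map[OF s, of "root_form k"])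
    show "root_form k (\<lambda>_. 0) = (\<lambda>_. 0)" by (rule root_form_zero[OF k])
  next
    fix c z assume "c \<in> A" "z \<in> chart_image c"
    from pos11D(1)[OF root(1)[OF this]] show "alternating (root_form k (\<alpha> c z))" by (simp add: \<omega>_def)
  next
    fix c assume "c \<in> A"
    then show "smooth_family (chart_image c) (\<lambda>z. root_form k (\<alpha> c z))"
      by (intro smooth_family_root_form open_chart smooth_formD(3)[OF s] n pos)
  next
    fix c c' z assume c: "c \<in> A" "c' \<in> A" "z \<in> overlap c c'"
    let ?g = "dtrans c c' z" and ?z = "transition c c' z"
    note z = transition_in[OF c]
    have "pull ?g (\<alpha> c' ?z) = wedge_power (pull ?g (\<omega> c' ?z)) k"
      unfolding root(2)[OF c(2) z, symmetric] pull_wedge_power ..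
    then have "root_form k (pull ?g (\<alpha> c' ?z)) = pull ?g (\<omega> c' ?z)"
      using root_form_wedge_power[OF n k pos11_change_chart[OF metric c root(1)[OF c(2) z]]] by simp
    then show "root_form k (pull ?g (\<alpha> c' ?z)) = pull ?g (root_form k (\<alpha> c' ?z))"
      by (simp add: \<omega>_def)
  qed
  then have h: "hermitian_metric A \<omega>" using root(1) by (simp add: hermitian_metric_iff)
  have eq: "form_power A \<omega> k = \<alpha>"
  proof (intro ext)
    fix c z vs
    have "wedge_power (\<omega> c z) k = \<alpha> c z"
    proof (cases "c \<in> A \<and> z \<in> chart_image c")
      case False
      then show ?thesis
        using smooth_formD(1)[OF s] by (simp add: \<omega>_def root_form_zero[OF k] wedge_power_zero[OF k])
    qed (simp add: root)
    then show "form_power A \<omega> k c z vs = \<alpha> c z vs"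
      using form_power_eq_wedge_power[OF \<open>smooth_form A \<omega>\<close> k] by simp
  qed
  obtain \<eta> \<rho> where "zigzag A 2 \<alpha> \<eta> \<rho>" using E2 by (auto simp: ErEr_closed_iff_zigzag)
  then have "smooth_form A (\<eta> 1)" "del A \<alpha> = delbar A (\<eta> 1)" by (auto simp: zigzag_def)
  with h eq have "sG_metric A \<omega>" by (auto simp: sG_metric_def n)
  then show thesis using eq by (rule that)
qed

lemma pos11_star_if_positive:
  assumes "pq_form A k k \<alpha>" "real_form \<alpha>" "c \<in> A" "z \<in> chart_image c"
    and pos: "\<And>v. v \<noteq> 0 \<Longrightarrow> Re (star (\<alpha> c z) [v, \<i> *s v]) > 0"
  shows "pos11 (star (\<alpha> c z))"
  unfolding pos11_def
proof (intro conjI allI impI)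
  have s: "smooth_form A \<alpha>" using assms(1) by (simp add: pq_form_def)
  have "\<alpha> c z (map ((*s) \<i>) vs) = \<alpha> c z vs" for vs
    using fun_cong[OF pq_form_pull[OF assms(1), of \<i> c z], of vs]
    by (simp add: pull_def flip: power_mult_distrib)
  then show "star (\<alpha> c z) [\<i> *s u, \<i> *s v] = star (\<alpha> c z) [u, v]" for u v
    by (intro star_J_invariant smooth_formD(2)[OF s assms(3,4)])
  have "real_valued (\<alpha> c z)" using assms(2) unfolding real_form_valued by blast
  then show "real_valued (star (\<alpha> c z))" by (rule real_valued_star)
qed (simp_all add: alternating_star two_form_star pos)

text \<open>Positivity of the dual means being the \<open>k\<close>-th power of a positive covector of bidegree \<open>(1,1)\<close>, and pulling
  back commutes with powers.\<close>

lemma pos11_star_change_chart: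
  assumes \<alpha>: "pq_form A k k \<alpha>" and c: "c \<in> A" "c' \<in> A" "z \<in> overlap c c'"
    and pos: "pos11 (star (\<alpha> c' (transition c c' z)))"
  shows "pos11 (star (\<alpha> c z))"
proof -
  let ?g = "dtrans c c' z" and ?f = "\<alpha> c' (transition c c' z)"
  have s: "smooth_form A \<alpha>" using \<alpha> by (simp add: pq_form_def)
  have root: "pos11 (root_form k ?f)" "wedge_power (root_form k ?f) k = ?f"
    using root_form[OF n k smooth_formD(2)[OF s c(2) transition_in[OF c]] pq_form_eq_0[OF \<alpha>] pos] by blast+
  have "\<alpha> c z = pull ?g (wedge_power (root_form k ?f) k)"
    unfolding root(2) by (rule smooth_formD(4)[OF s c])
  then show ?thesis
    using pos11_star_wedge_power[OF pos11_change_chart[OF metric c root(1)] n] by (simp add: pull_wedge_power)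
qed

lemma positive_cycles_stable:
  fixes m :: nat
  assumes X: "compact_complex_manifold X A" and \<theta>: "\<theta> \<in> positive_cycles A"
    and \<beta>: "\<And>i. i < m \<Longrightarrow> \<beta> i \<in> Er_cycles A 2 k k \<and> real_form (\<beta> i)"
  shows "\<exists>\<epsilon>>0. \<forall>y. (\<forall>i<m. \<bar>y i\<bar> < \<epsilon>) \<longrightarrow> \<theta> + (\<Sum>i<m. scale_form (y i) (\<beta> i)) \<in> positive_cycles A"
proof -
  have M: "complex_manifold X A" using X by (simp add: compact_complex_manifold_def)
  note \<theta>c = positive_cyclesD(1)[OF \<theta>] and \<theta>r = positive_cyclesD(2)[OF \<theta>] and \<theta>p = positive_cyclesD(3)[OF \<theta>]
  let ?\<alpha> = "\<lambda>y. \<theta> + (\<Sum>i<m. scale_form (y i) (\<beta> i))"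
  have \<alpha>: "?\<alpha> y \<in> Er_cycles A 2 k k" "real_form (?\<alpha> y)" for y
    by (rule perturbed_cycle[OF one_le_numeral \<theta>c \<theta>r \<beta>]; assumption)+
  have \<alpha>s: "star (?\<alpha> y c z) vs = star (\<theta> c z) vs + (\<Sum>i<m. of_real (y i) * star (\<beta> i c z) vs)" for y c z vs
  proof -
    have "?\<alpha> y c z = (\<lambda>vs. \<theta> c z vs + (\<Sum>i<m. of_real (y i) * \<beta> i c z vs))"
      by (rule ext) (rule perturbed_form_apply)
    then have "star (?\<alpha> y c z) vs = star (\<lambda>vs. \<theta> c z vs + (\<Sum>i<m. of_real (y i) * \<beta> i c z vs)) vs"
      by (rule arg_cong)
    also have "\<dots> = star (\<theta> c z) vs + (\<Sum>i<m. of_real (y i) * star (\<beta> i c z) vs)"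
      by (rule star_perturbed)
    finally show ?thesis .
  qed
  obtain \<epsilon> where \<epsilon>: "\<epsilon> > 0" "\<And>y p. (\<forall>i<m. \<bar>y i\<bar> < \<epsilon>) \<Longrightarrow> p \<in> topspace X \<Longrightarrow>
      \<exists>c\<in>A. p \<in> fst c \<and> (\<forall>v. v \<noteq> 0 \<longrightarrow> Re (star (\<theta> c (snd c p)) [v, \<i> *s v]
        + (\<Sum>i<m. of_real (y i) * star (\<beta> i c (snd c p)) [v, \<i> *s v])) > 0)"
  proof (rule positivity_stable[OF X, of "\<lambda>c z. star (\<theta> c z)" m "\<lambda>i c z. star (\<beta> i c z)"])
    show "cont_pairs (chart_image c) (\<lambda>z. star (\<theta> c z))" if "c \<in> A" for c
      by (rule cont_pairs_star[OF Er_cycles_smooth[OF \<theta>c] that])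
    show "cont_pairs (chart_image c) (\<lambda>z. star (\<beta> i c z))" if "c \<in> A" "i < m" for c i
      by (rule cont_pairs_star[OF Er_cycles_smooth that(1)]) (use \<beta> that in blast)
    show "Re (star (\<theta> c z) [v, \<i> *s v]) > 0" if "c \<in> A" "z \<in> chart_image c" "v \<noteq> 0" for c z v
      using pos11D(5)[OF \<theta>p] that by blast
  qed blast
  have "?\<alpha> y \<in> positive_cycles A" if y: "\<forall>i<m. \<bar>y i\<bar> < \<epsilon>" for y
  proof -
    have pq: "pq_form A k k (?\<alpha> y)" using \<alpha>(1) by (simp add: Er_cycles_def)
    have "pos11 (star (?\<alpha> y c z))" if c: "c \<in> A" and z: "z \<in> chart_image c" for c z
    proof -
      obtain p where p: "z = snd c p" "p \<in> fst c" using z by blast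
      have "p \<in> topspace X" using M c p(2) unfolding complex_manifold_def by blast
      from \<epsilon>(2)[OF y this] obtain c' where c': "c' \<in> A" "p \<in> fst c'" and
        pos: "\<And>v. v \<noteq> 0 \<Longrightarrow> Re (star (?\<alpha> y c' (snd c' p)) [v, \<i> *s v]) > 0"
        unfolding \<alpha>s by blast
      have ov: "z \<in> overlap c c'" using p c'(2) by (auto simp: overlap_def)
      have "pos11 (star (?\<alpha> y c' (snd c' p)))"
        by (rule pos11_star_if_positive[OF pq \<alpha>(2) c'(1) imageI[OF c'(2)] pos])
      then show ?thesis
        using pos11_star_change_chart[OF pq c c'(1) ov] by (simp only: p(1) transition_chart[OF M c p(2)])
    qed
    then show ?thesis by (rule positive_cyclesI[OF \<alpha>])
  qed
  with \<epsilon>(1) show ?thesis by blast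
qed

lemma positive_cycles_add:
  assumes "\<theta> \<in> positive_cycles A" "\<theta>' \<in> positive_cycles A" shows "\<theta> + \<theta>' \<in> positive_cycles A"
proof -
  have s: "star ((\<theta> + \<theta>') c z) = (\<lambda>vs. star (\<theta> c z) vs + star (\<theta>' c z) vs)" for c z
    by (rule ext) (simp add: plus_fun_def star_add)
  note \<theta> = positive_cyclesD[OF assms(1)] and \<theta>' = positive_cyclesD[OF assms(2)]
  show ?thesis
    by (rule positive_cyclesI[OF Er_cycles_add[OF one_le_numeral \<theta>(1) \<theta>'(1)] real_form_add[OF \<theta>(2) \<theta>'(2)]])
      (simp only: s pos11_add \<theta>(3) \<theta>'(3))
qed

lemma positive_cycles_scale:
  assumes "\<theta> \<in> positive_cycles A" "t > 0" shows "scale_form t \<theta> \<in> positive_cycles A"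
proof -
  have s: "star (scale_form t \<theta> c z) = (\<lambda>vs. of_real t * star (\<theta> c z) vs)" for c z
    by (rule ext) (simp add: scale_form_def star_scale)
  note \<theta> = positive_cyclesD[OF assms(1)]
  have "scale_form t \<theta> \<in> Er_cycles A 2 k k"
    unfolding scale_form_eq_cscale by (rule Er_cycles_cscale[OF _ \<theta>(1)]) simp
  then show ?thesis
    by (rule positive_cyclesI[OF _ real_form_scale[OF \<theta>(2)]])
      (simp only: s pos11_scale[OF \<theta>(3) assms(2)])
qed

end

lemma open_convex_SG_cone:
  fixes A :: "('a, 'n::finite) chart set"
  assumes X: "compact_complex_manifold X A" and n2: "CARD('n) \<ge> 2"
  shows "open_convex_cone_in (real_aeppli A 2 (CARD('n) - 1)) (SG_cone A)"
proof -
  interpret complex_atlas A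
    using X complex_manifold_atlas unfolding compact_complex_manifold_def by blast
  define k where "k = CARD('n) - 1"
  have n: "CARD('n) = Suc k" and k: "k \<ge> 1" using n2 by (auto simp: k_def)
  let ?G = "{form_power A \<omega> k | \<omega>. sG_metric A \<omega>}"
  have eq: "SG_cone A = aeppli_class A 2 k k ` ?G"
    by (auto simp: SG_cone_def k_def)
  have G: "metric_atlas A \<omega>0 k \<and> ?G = positive_cycles A" if "sG_metric A \<omega>0" for \<omega>0
  proof -
    have h: "hermitian_metric A \<omega>0" using that by (simp add: sG_metric_def)
    interpret metric_atlas A \<omega>0 k by unfold_locales (fact n k h)+
    have "?G = positive_cycles A" using form_power_in_positive_cycles positive_cycle_root by blast
    then show ?thesis using metric_atlas_axioms by blast
  qed
  have "open_convex_cone_in (real_aeppli A 2 k) (aeppli_class A 2 k k ` ?G)"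
  proof (rule open_convex_cone_of_cycles)
    fix \<theta> assume \<theta>: "\<theta> \<in> ?G"
    then obtain \<omega>0 where "sG_metric A \<omega>0" by blast
    from G[OF this] have ma: "metric_atlas A \<omega>0 k" and Ge: "?G = positive_cycles A" by auto
    interpret metric_atlas A \<omega>0 k by (rule ma)
    from \<theta> show "\<theta> \<in> Er_cycles A 2 k k" "real_form \<theta>"
      unfolding Ge by (rule positive_cyclesD)+
    from \<theta> show "scale_form t \<theta> \<in> ?G" if "t > 0" for t
      unfolding Ge using positive_cycles_scale that by blast
    from \<theta> show "\<theta> + \<theta>' \<in> ?G" if "\<theta>' \<in> ?G" for \<theta>'
      using that unfolding Ge by (rule positive_cycles_add)
    from \<theta> show "\<exists>\<epsilon>>0. \<forall>y. (\<forall>i<m. \<bar>y i\<bar> < \<epsilon>) \<longrightarrow> \<theta> + (\<Sum>i<m. scale_form (y i) (\<beta> i)) \<in> ?G"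
      if "\<And>i. i < m \<Longrightarrow> \<beta> i \<in> Er_cycles A 2 k k \<and> real_form (\<beta> i)" for m :: nat and \<beta>
      unfolding Ge by (rule positive_cycles_stable[OF X _ that])
  qed simp
  then show ?thesis by (simp add: eq k_def)
qed

theorem lemma6p4:
  fixes X :: "'a topology" and A :: "('a, 'n::finite) chart set"
  assumes "compact_complex_manifold X A"
  shows "(CARD('n) \<ge> 2 \<longrightarrow> open_convex_cone_in (real_aeppli A 2 (CARD('n) - 1)) (SG_cone A)) \<and>
    open_convex_cone_in (real_aeppli A 3 1) (HS_cone A) \<and>
    open_convex_cone_in (real_aeppli A 1 1) (SKT_cone A)"
  using open_convex_SG_cone open_convex_HS_cone open_convex_SKT_cone assms by blast

end
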